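(* Let $A$ be a (not necessarily commutative) $\Bbbk$-algebra. The assignment $(L,\omega)\mapsto A\,\#\,U(L)$ induces a functor $\mathcal{U}_A:\mathsf{AnchLie}_A\to\mathsf{Ring}_A$ which is left adjoint to the functor $\mathcal{L}_A:\mathsf{Ring}_A\to\mathsf{AnchLie}_A$.
   Context: $\Bbbk$ is a field of characteristic $0$; algebras are associative and unital. An $A$-ring is a pair $(R,\phi)$ with $R$ a $\Bbbk$-algebra and $\phi:A\to R$ a $\Bbbk$-algebra map; a morphism $(R,\phi)\to(S,\psi)$ is a $\Bbbk$-algebra map $\varphi$ with $\varphi\circ\phi=\psi$. The category is $\mathsf{Ring}_A$. An $A$-anchored Lie algebra is a Lie algebra $L$ over $\Bbbk$ with a Lie algebra morphism $\omega:L\to\mathrm{Der}_\Bbbk(A)$ (the anchor); a morphism $(L,\omega)\to(L',\omega')$ is a Lie algebra morphism $f$ with $\omega'\circ f=\omega$. The category is $\mathsf{AnchLie}_A$. $U(L)$ is the universal enveloping algebra of the Lie algebra $L$, with comultiplication $\Delta(u)=\sum u_1\otimes u_2$ for which elements of $L$ are primitive. The anchor $\omega$ extends uniquely to an algebra map $\Omega:U(L)\to\mathrm{End}_\Bbbk(A)$, and $u\cdot a=\Omega(u)(a)$ makes $A$ a $U(L)$-module algebra (so $X\cdot a=\omega(X)(a)$ for $X\in L$). $A\,\#\,U(L)$ is the $A$-ring with underlying space $A\otimes U(L)$, unit $1\otimes1$, multiplication $(a\otimes u)(b\otimes v)=\sum a(u_1\cdot b)\otimes u_2v$, and structure map $a\mapsto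 a\otimes1$. On a morphism $f:(L,\omega)\to(L',\omega')$ the functor $\mathcal{U}_A$ is $a\otimes u\mapsto a\otimes U(f)(u)$. The functor $\mathcal{L}_A$ sends $(R,\phi)$ to $\{(r,\delta)\in R\times\mathrm{Der}_\Bbbk(A)\mid[r,\phi(a)]=\phi(\delta(a))\ \forall a\in A\}$ with component-wise bracket (commutator brackets) and anchor $(r,\delta)\mapsto\delta$, and a morphism $\varphi$ to $(r,\delta)\mapsto(\varphi(r),\delta)$. *)

theory Defs
  imports "HOL-Algebra.QuotRing" "HOL-Algebra.Module"
begin

text \<open>
  All structures live on carrier sets.  Maps between them are taken to be extensional
  (\<open>undefined\<close> outside the carrier of their domain), so that equality of morphisms is equality
  of HOL functions.  A vector space over the field \<open>K\<close> is a record \<open>M\<close> with \<^term>\<open>module K M\<close>;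
  the fields \<open>mult\<close> and \<open>one\<close> of \<open>M\<close> are meaningful only where \<open>M\<close> is an algebra.
\<close>

section \<open>Algebras, Lie algebras, derivations\<close>

definition char_zero :: "'k ring \<Rightarrow> bool" where
  "char_zero K \<longleftrightarrow> (\<forall>n::nat. 0 < n \<longrightarrow> [n] \<cdot>\<^bsub>K\<^esub> \<one>\<^bsub>K\<^esub> \<noteq> \<zero>\<^bsub>K\<^esub>)"

text \<open>Associative unital algebras; the library's \<^locale>\<open>algebra\<close> is commutative.\<close>

locale assoc_algebra = module K R + ring R for K :: "'k ring" and R :: "('k, 'r) module" +
  assumes smult_mult_left:
      "\<lbrakk>c \<in> carrier K; x \<in> carrier R; y \<in> carrier R\<rbrakk> \<Longrightarrow>
        (c \<odot>\<^bsub>R\<^esub> x) \<otimes>\<^bsub>R\<^esub> y = c \<odot>\<^bsub>R\<^esub> (x \<otimes>\<^bsub>R\<^esub> y)"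
    and smult_mult_right:
      "\<lbrakk>c \<in> carrier K; x \<in> carrier R; y \<in> carrier R\<rbrakk> \<Longrightarrow>
        x \<otimes>\<^bsub>R\<^esub> (c \<odot>\<^bsub>R\<^esub> y) = c \<odot>\<^bsub>R\<^esub> (x \<otimes>\<^bsub>R\<^esub> y)"

definition lin_hom ::
  "'k ring \<Rightarrow> ('k, 'm, 'x) module_scheme \<Rightarrow> ('k, 'n, 'y) module_scheme \<Rightarrow> ('m \<Rightarrow> 'n) set" where
  "lin_hom K M N = {f \<in> carrier M \<rightarrow>\<^sub>E carrier N.
     (\<forall>x\<in>carrier M. \<forall>y\<in>carrier M. f (x \<oplus>\<^bsub>M\<^esub> y) = f x \<oplus>\<^bsub>N\<^esub> f y) \<and>
     (\<forall>c\<in>carrier K. \<forall>x\<in>carrier M. f (c \<odot>\<^bsub>M\<^esub> x) = c \<odot>\<^bsub>N\<^esub> f x)}"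

definition alg_hom ::
  "'k ring \<Rightarrow> ('k, 'r) module \<Rightarrow> ('k, 's) module \<Rightarrow> ('r \<Rightarrow> 's) set" where
  "alg_hom K R S = ring_hom R S \<inter> lin_hom K R S"

definition commutator :: "('k, 'r) module \<Rightarrow> 'r \<Rightarrow> 'r \<Rightarrow> 'r" where
  "commutator R x y = x \<otimes>\<^bsub>R\<^esub> y \<ominus>\<^bsub>R\<^esub> y \<otimes>\<^bsub>R\<^esub> x"

record ('k, 'l) lie_alg = "('k, 'l) module" +
  bracket :: "'l \<Rightarrow> 'l \<Rightarrow> 'l"

locale lie_algebra = module K L for K :: "'k ring" and L :: "('k, 'l) lie_alg" +
  assumes bracket_closed:
      "\<lbrakk>x \<in> carrier L; y \<in> carrier L\<rbrakk> \<Longrightarrow> bracket L x y \<in> carrier L"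
    and bracket_add_left:
      "\<lbrakk>x \<in> carrier L; y \<in> carrier L; z \<in> carrier L\<rbrakk> \<Longrightarrow>
        bracket L (x \<oplus>\<^bsub>L\<^esub> y) z = bracket L x z \<oplus>\<^bsub>L\<^esub> bracket L y z"
    and bracket_add_right:
      "\<lbrakk>x \<in> carrier L; y \<in> carrier L; z \<in> carrier L\<rbrakk> \<Longrightarrow>
        bracket L x (y \<oplus>\<^bsub>L\<^esub> z) = bracket L x y \<oplus>\<^bsub>L\<^esub> bracket L x z"
    and bracket_smult_left:
      "\<lbrakk>c \<in> carrier K; x \<in> carrier L; y \<in> carrier L\<rbrakk> \<Longrightarrow>
        bracket L (c \<odot>\<^bsub>L\<^esub> x) y = c \<odot>\<^bsub>L\<^esub> bracket L x y"
    and bracket_smult_right: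
      "\<lbrakk>c \<in> carrier K; x \<in> carrier L; y \<in> carrier L\<rbrakk> \<Longrightarrow>
        bracket L x (c \<odot>\<^bsub>L\<^esub> y) = c \<odot>\<^bsub>L\<^esub> bracket L x y"
    and bracket_self: "x \<in> carrier L \<Longrightarrow> bracket L x x = \<zero>\<^bsub>L\<^esub>"
    and jacobi:
      "\<lbrakk>x \<in> carrier L; y \<in> carrier L; z \<in> carrier L\<rbrakk> \<Longrightarrow>
        bracket L x (bracket L y z) \<oplus>\<^bsub>L\<^esub> bracket L y (bracket L z x)
          \<oplus>\<^bsub>L\<^esub> bracket L z (bracket L x y) = \<zero>\<^bsub>L\<^esub>"

definition lie_hom ::
  "'k ring \<Rightarrow> ('k, 'l) lie_alg \<Rightarrow> ('k, 'm) lie_alg \<Rightarrow> ('l \<Rightarrow> 'm) set" where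
  "lie_hom K L M = {f \<in> lin_hom K L M.
     \<forall>x\<in>carrier L. \<forall>y\<in>carrier L. f (bracket L x y) = bracket M (f x) (f y)}"

definition End_alg :: "'k ring \<Rightarrow> ('k, 'a) module \<Rightarrow> ('k, 'a \<Rightarrow> 'a) module" where
  "End_alg K A =
     \<lparr>carrier = lin_hom K A A,
      mult = compose (carrier A),
      one = (\<lambda>a\<in>carrier A. a),
      zero = (\<lambda>a\<in>carrier A. \<zero>\<^bsub>A\<^esub>),
      add = (\<lambda>f g. \<lambda>a\<in>carrier A. f a \<oplus>\<^bsub>A\<^esub> g a),
      smult = (\<lambda>c f. \<lambda>a\<in>carrier A. c \<odot>\<^bsub>A\<^esub> f a)\<rparr>"

definition Der :: "'k ring \<Rightarrow> ('k, 'a) module \<Rightarrow> ('k, 'a \<Rightarrow> 'a) lie_alg" where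
  "Der K A = module.extend
     ((End_alg K A)\<lparr>carrier := {\<delta> \<in> lin_hom K A A. \<forall>a\<in>carrier A. \<forall>b\<in>carrier A.
         \<delta> (a \<otimes>\<^bsub>A\<^esub> b) = \<delta> a \<otimes>\<^bsub>A\<^esub> b \<oplus>\<^bsub>A\<^esub> a \<otimes>\<^bsub>A\<^esub> \<delta> b}\<rparr>)
     (lie_alg.fields (commutator (End_alg K A)))"

section \<open>The categories\<close>

type_synonym ('k, 'a, 'r) aring = "('k, 'r) module \<times> ('a \<Rightarrow> 'r)"
type_synonym ('k, 'a, 'l) anch = "('k, 'l) lie_alg \<times> ('l \<Rightarrow> 'a \<Rightarrow> 'a)"

definition Ring_Ob :: "'k ring \<Rightarrow> ('k, 'a) module \<Rightarrow> ('k, 'a, 'r) aring set" where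
  "Ring_Ob K A = {(R, \<phi>). assoc_algebra K R \<and> \<phi> \<in> alg_hom K A R}"

definition Ring_Hom ::
  "'k ring \<Rightarrow> ('k, 'a) module \<Rightarrow> ('k, 'a, 'r) aring \<Rightarrow> ('k, 'a, 's) aring \<Rightarrow> ('r \<Rightarrow> 's) set" where
  "Ring_Hom K A = (\<lambda>(R, \<phi>) (S, \<psi>). {h \<in> alg_hom K R S. \<forall>a\<in>carrier A. h (\<phi> a) = \<psi> a})"

definition AnchLie_Ob :: "'k ring \<Rightarrow> ('k, 'a) module \<Rightarrow> ('k, 'a, 'l) anch set" where
  "AnchLie_Ob K A = {(L, \<omega>). lie_algebra K L \<and> \<omega> \<in> lie_hom K L (Der K A)}"

definition AnchLie_Hom ::
  "'k ring \<Rightarrow> ('k, 'a, 'l) anch \<Rightarrow> ('k, 'a, 'm) anch \<Rightarrow> ('l \<Rightarrow> 'm) set" where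
  "AnchLie_Hom K = (\<lambda>(L, \<omega>) (L', \<omega>'). {f \<in> lie_hom K L L'. \<forall>X\<in>carrier L. \<omega>' (f X) = \<omega> X})"

text \<open>Identities and composition, uniformly for both categories: \<open>X\<close> is the domain.\<close>

definition Id_mor :: "('x, 'y) partial_object_scheme \<times> 'z \<Rightarrow> 'x \<Rightarrow> 'x" where
  "Id_mor X = (\<lambda>x\<in>carrier (fst X). x)"

definition comp_mor ::
  "('x, 'y) partial_object_scheme \<times> 'z \<Rightarrow> ('v \<Rightarrow> 'w) \<Rightarrow> ('x \<Rightarrow> 'v) \<Rightarrow> 'x \<Rightarrow> 'w" where
  "comp_mor X g f = compose (carrier (fst X)) g f"

section \<open>Free modules, quotients, tensor products\<close>

definition free_mod :: "'k ring \<Rightarrow> 'p set \<Rightarrow> ('k, 'p \<Rightarrow> 'k) module" where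
  "free_mod K S =
     \<lparr>carrier = {f. (\<forall>p. f p \<in> carrier K) \<and> {p. f p \<noteq> \<zero>\<^bsub>K\<^esub>} \<subseteq> S \<and> finite {p. f p \<noteq> \<zero>\<^bsub>K\<^esub>}},
      mult = undefined,
      one = undefined,
      zero = (\<lambda>_. \<zero>\<^bsub>K\<^esub>),
      add = (\<lambda>f g p. f p \<oplus>\<^bsub>K\<^esub> g p),
      smult = (\<lambda>c f p. c \<otimes>\<^bsub>K\<^esub> f p)\<rparr>"

definition basis_elt :: "'k ring \<Rightarrow> 'p \<Rightarrow> 'p \<Rightarrow> 'k" where
  "basis_elt K p = (\<lambda>q. if q = p then \<one>\<^bsub>K\<^esub> else \<zero>\<^bsub>K\<^esub>)"

definition lin_span :: "'k ring \<Rightarrow> ('k, 'm) module \<Rightarrow> 'm set \<Rightarrow> 'm set" where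
  "lin_span K M S = \<Inter>{N. submodule N K M \<and> S \<subseteq> N}"

text \<open>
  Quotient of a module by a submodule \<open>N\<close>; if \<open>M\<close> is an algebra and \<open>N\<close> an ideal, the ring
  structure carried along from \<^term>\<open>M Quot N\<close> makes it the quotient algebra.
\<close>

definition quot_mod :: "('k, 'm) module \<Rightarrow> 'm set \<Rightarrow> ('k, 'm set) module" where
  "quot_mod M N = ring.extend (M Quot N)
     (module.fields (\<lambda>c X. \<Union>x\<in>X. N +>\<^bsub>M\<^esub> (c \<odot>\<^bsub>M\<^esub> x)))"

type_synonym ('k, 'm, 'n) tens = "('m \<times> 'n \<Rightarrow> 'k) set"

definition tensor_rels ::
  "'k ring \<Rightarrow> ('k, 'm) module \<Rightarrow> ('k, 'n) module \<Rightarrow> ('m \<times> 'n \<Rightarrow> 'k) set" where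
  "tensor_rels K M N =
     (let F = free_mod K (carrier M \<times> carrier N); e = basis_elt K in
      {e (m \<oplus>\<^bsub>M\<^esub> m', n) \<ominus>\<^bsub>F\<^esub> (e (m, n) \<oplus>\<^bsub>F\<^esub> e (m', n)) | m m' n.
         m \<in> carrier M \<and> m' \<in> carrier M \<and> n \<in> carrier N}
    \<union> {e (m, n \<oplus>\<^bsub>N\<^esub> n') \<ominus>\<^bsub>F\<^esub> (e (m, n) \<oplus>\<^bsub>F\<^esub> e (m, n')) | m n n'.
         m \<in> carrier M \<and> n \<in> carrier N \<and> n' \<in> carrier N}
    \<union> {e (c \<odot>\<^bsub>M\<^esub> m, n) \<ominus>\<^bsub>F\<^esub> c \<odot>\<^bsub>F\<^esub> e (m, n) | c m n.
         c \<in> carrier K \<and> m \<in> carrier M \<and> n \<in> carrier N}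
    \<union> {e (m, c \<odot>\<^bsub>N\<^esub> n) \<ominus>\<^bsub>F\<^esub> c \<odot>\<^bsub>F\<^esub> e (m, n) | c m n.
         c \<in> carrier K \<and> m \<in> carrier M \<and> n \<in> carrier N})"

definition tensor ::
  "'k ring \<Rightarrow> ('k, 'm) module \<Rightarrow> ('k, 'n) module \<Rightarrow> ('k, ('k, 'm, 'n) tens) module" where
  "tensor K M N =
     (let F = free_mod K (carrier M \<times> carrier N) in
      quot_mod F (lin_span K F (tensor_rels K M N)))"

definition tens ::
  "'k ring \<Rightarrow> ('k, 'm) module \<Rightarrow> ('k, 'n) module \<Rightarrow> 'm \<Rightarrow> 'n \<Rightarrow> ('k, 'm, 'n) tens" where
  "tens K M N m n =
     (let F = free_mod K (carrier M \<times> carrier N) in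
      lin_span K F (tensor_rels K M N) +>\<^bsub>F\<^esub> basis_elt K (m, n))"

text \<open>
  The linear map \<open>m \<otimes> n \<mapsto> \<beta> m n\<close> induced by a bilinear \<open>\<beta>\<close>.  Applied to \<open>t = \<Sum> m\<^sub>i \<otimes> n\<^sub>i\<close> it is
  the Sweedler-style sum \<open>\<Sum> \<beta> m\<^sub>i n\<^sub>i\<close>.
\<close>

definition tensor_lift ::
  "'k ring \<Rightarrow> ('k, 'm) module \<Rightarrow> ('k, 'n) module \<Rightarrow> ('k, 'p) module \<Rightarrow>
     ('m \<Rightarrow> 'n \<Rightarrow> 'p) \<Rightarrow> ('k, 'm, 'n) tens \<Rightarrow> 'p" where
  "tensor_lift K M N P \<beta> =
     (THE h. h \<in> lin_hom K (tensor K M N) P \<and>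
        (\<forall>m\<in>carrier M. \<forall>n\<in>carrier N. h (tens K M N m n) = \<beta> m n))"

text \<open>The algebra \<open>R \<otimes> S\<close> with \<open>(r \<otimes> s)(r' \<otimes> s') = rr' \<otimes> ss'\<close>.\<close>

definition tensor_alg ::
  "'k ring \<Rightarrow> ('k, 'r) module \<Rightarrow> ('k, 's) module \<Rightarrow> ('k, ('k, 'r, 's) tens) module" where
  "tensor_alg K R S = (tensor K R S)
     \<lparr>mult := (\<lambda>x y.
        tensor_lift K R S (tensor K R S)
          (\<lambda>r s. tensor_lift K R S (tensor K R S)
             (\<lambda>r' s'. tens K R S (r \<otimes>\<^bsub>R\<^esub> r') (s \<otimes>\<^bsub>S\<^esub> s')) y) x),
      one := tens K R S \<one>\<^bsub>R\<^esub> \<one>\<^bsub>S\<^esub>\<rparr>"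

section \<open>The universal enveloping algebra\<close>

text \<open>The free algebra on \<open>S\<close>: linear combinations of words, multiplied by concatenation.\<close>

definition free_alg :: "'k ring \<Rightarrow> 'l set \<Rightarrow> ('k, 'l list \<Rightarrow> 'k) module" where
  "free_alg K S = (free_mod K (lists S))
     \<lparr>mult := (\<lambda>f g w. \<Oplus>\<^bsub>K\<^esub>i\<in>{..length w}. f (take i w) \<otimes>\<^bsub>K\<^esub> g (drop i w)),
      one := basis_elt K []\<rparr>"

type_synonym ('k, 'l) env = "('l list \<Rightarrow> 'k) set"

text \<open>
  \<open>U(L) = T(L)/(xy - yx - [x, y])\<close>, where the tensor algebra \<open>T(L)\<close> is presented as the free
  algebra on the underlying set of \<open>L\<close> modulo the linear relations of \<open>L\<close>; both sets of relations
  are factored out at once.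
\<close>

definition env_ideal :: "'k ring \<Rightarrow> ('k, 'l) lie_alg \<Rightarrow> ('l list \<Rightarrow> 'k) set" where
  "env_ideal K L =
     (let F = free_alg K (carrier L); e = (\<lambda>x. basis_elt K [x]) in
      Idl\<^bsub>F\<^esub>
       ({e (x \<oplus>\<^bsub>L\<^esub> y) \<ominus>\<^bsub>F\<^esub> (e x \<oplus>\<^bsub>F\<^esub> e y) | x y. x \<in> carrier L \<and> y \<in> carrier L}
      \<union> {e (c \<odot>\<^bsub>L\<^esub> x) \<ominus>\<^bsub>F\<^esub> c \<odot>\<^bsub>F\<^esub> e x | c x. c \<in> carrier K \<and> x \<in> carrier L}
      \<union> {commutator F (e x) (e y) \<ominus>\<^bsub>F\<^esub> e (bracket L x y) | x y.
           x \<in> carrier L \<and> y \<in> carrier L}))"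

definition env :: "'k ring \<Rightarrow> ('k, 'l) lie_alg \<Rightarrow> ('k, ('k, 'l) env) module" where
  "env K L = quot_mod (free_alg K (carrier L)) (env_ideal K L)"

definition env_incl :: "'k ring \<Rightarrow> ('k, 'l) lie_alg \<Rightarrow> 'l \<Rightarrow> ('k, 'l) env" where
  "env_incl K L x = env_ideal K L +>\<^bsub>free_alg K (carrier L)\<^esub> basis_elt K [x]"

definition env_lift ::
  "'k ring \<Rightarrow> ('k, 'l) lie_alg \<Rightarrow> ('k, 's) module \<Rightarrow> ('l \<Rightarrow> 's) \<Rightarrow> ('k, 'l) env \<Rightarrow> 's" where
  "env_lift K L S f =
     (THE h. h \<in> alg_hom K (env K L) S \<and> (\<forall>x\<in>carrier L. h (env_incl K L x) = f x))"

definition env_map ::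
  "'k ring \<Rightarrow> ('k, 'l) lie_alg \<Rightarrow> ('k, 'm) lie_alg \<Rightarrow> ('l \<Rightarrow> 'm) \<Rightarrow> ('k, 'l) env \<Rightarrow> ('k, 'm) env"
  where
  "env_map K L L' f = env_lift K L (env K L') (\<lambda>x. env_incl K L' (f x))"

definition env_comult ::
  "'k ring \<Rightarrow> ('k, 'l) lie_alg \<Rightarrow> ('k, 'l) env \<Rightarrow> ('k, ('k, 'l) env, ('k, 'l) env) tens" where
  "env_comult K L =
     (let U = env K L; T = tensor_alg K U U in
      env_lift K L T
        (\<lambda>x. tens K U U (env_incl K L x) \<one>\<^bsub>U\<^esub> \<oplus>\<^bsub>T\<^esub> tens K U U \<one>\<^bsub>U\<^esub> (env_incl K L x)))"

definition env_act ::
  "'k ring \<Rightarrow> ('k, 'a) module \<Rightarrow> ('k, 'a, 'l) anch \<Rightarrow> ('k, 'l) env \<Rightarrow> 'a \<Rightarrow> 'a" where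
  "env_act K A = (\<lambda>(L, \<omega>). env_lift K L (End_alg K A) \<omega>)"

section \<open>The functors\<close>

type_synonym ('k, 'a, 'l) smash = "('k, 'a, ('k, 'l) env) tens"

definition smash_alg ::
  "'k ring \<Rightarrow> ('k, 'a) module \<Rightarrow> ('k, 'a, 'l) anch \<Rightarrow> ('k, ('k, 'a, 'l) smash) module" where
  "smash_alg K A X =
     (let U = env K (fst X); T = tensor K A U in
      T\<lparr>mult := (\<lambda>s t.
          tensor_lift K A U T (\<lambda>a u.
            tensor_lift K A U T (\<lambda>b v.
              tensor_lift K U U T (\<lambda>u1 u2.
                tens K A U (a \<otimes>\<^bsub>A\<^esub> env_act K A X u1 b) (u2 \<otimes>\<^bsub>U\<^esub> v))
              (env_comult K (fst X) u)) t) s),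
        one := tens K A U \<one>\<^bsub>A\<^esub> \<one>\<^bsub>U\<^esub>\<rparr>)"

definition U_ob ::
  "'k ring \<Rightarrow> ('k, 'a) module \<Rightarrow> ('k, 'a, 'l) anch \<Rightarrow> ('k, 'a, ('k, 'a, 'l) smash) aring" where
  "U_ob K A X =
     (smash_alg K A X, \<lambda>a\<in>carrier A. tens K A (env K (fst X)) a \<one>\<^bsub>env K (fst X)\<^esub>)"

definition U_mor ::
  "'k ring \<Rightarrow> ('k, 'a) module \<Rightarrow> ('k, 'a, 'l) anch \<Rightarrow> ('k, 'a, 'm) anch \<Rightarrow> ('l \<Rightarrow> 'm) \<Rightarrow>
     ('k, 'a, 'l) smash \<Rightarrow> ('k, 'a, 'm) smash" where
  "U_mor K A X Y f =
     tensor_lift K A (env K (fst X)) (smash_alg K A Y)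
       (\<lambda>a u. tens K A (env K (fst Y)) a (env_map K (fst X) (fst Y) f u))"

definition L_alg ::
  "'k ring \<Rightarrow> ('k, 'a) module \<Rightarrow> ('k, 'a, 'r) aring \<Rightarrow> ('k, 'r \<times> ('a \<Rightarrow> 'a)) lie_alg" where
  "L_alg K A = (\<lambda>(R, \<phi>).
     let D = Der K A in
     \<lparr>carrier = {(r, \<delta>). r \<in> carrier R \<and> \<delta> \<in> carrier D \<and>
                   (\<forall>a\<in>carrier A. commutator R r (\<phi> a) = \<phi> (\<delta> a))},
      mult = undefined,
      one = undefined,
      zero = (\<zero>\<^bsub>R\<^esub>, \<zero>\<^bsub>D\<^esub>),
      add = (\<lambda>(r, \<delta>) (s, \<epsilon>). (r \<oplus>\<^bsub>R\<^esub> s, \<delta> \<oplus>\<^bsub>D\<^esub> \<epsilon>)),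
      smult = (\<lambda>c (r, \<delta>). (c \<odot>\<^bsub>R\<^esub> r, c \<odot>\<^bsub>D\<^esub> \<delta>)),
      bracket = (\<lambda>(r, \<delta>) (s, \<epsilon>). (commutator R r s, bracket D \<delta> \<epsilon>))\<rparr>)"

definition L_ob ::
  "'k ring \<Rightarrow> ('k, 'a) module \<Rightarrow> ('k, 'a, 'r) aring \<Rightarrow> ('k, 'a, 'r \<times> ('a \<Rightarrow> 'a)) anch" where
  "L_ob K A Y = (L_alg K A Y, \<lambda>x\<in>carrier (L_alg K A Y). snd x)"

definition L_mor ::
  "'k ring \<Rightarrow> ('k, 'a) module \<Rightarrow> ('k, 'a, 'r) aring \<Rightarrow> ('r \<Rightarrow> 's) \<Rightarrow>
     'r \<times> ('a \<Rightarrow> 'a) \<Rightarrow> 's \<times> ('a \<Rightarrow> 'a)" where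
  "L_mor K A Y h = (\<lambda>x\<in>carrier (L_alg K A Y). (h (fst x), snd x))"

section \<open>Transposition\<close>

text \<open>
  Since HOL cannot quantify over types, a hom-set bijection that is natural across carriers of
  different types has to be given as a polymorphic constant: \<open>h \<mapsto> (X \<mapsto> (h (1 \<otimes> X), \<omega> X))\<close>, the
  composite of \<open>L_mor h\<close> with the unit \<open>X \<mapsto> (1 \<otimes> X, \<omega> X)\<close>.
\<close>

definition adj_transpose ::
  "'k ring \<Rightarrow> ('k, 'a) module \<Rightarrow> ('k, 'a, 'l) anch \<Rightarrow> (('k, 'a, 'l) smash \<Rightarrow> 'r) \<Rightarrow>
     'l \<Rightarrow> 'r \<times> ('a \<Rightarrow> 'a)" where
  "adj_transpose K A X h = (\<lambda>x\<in>carrier (fst X).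
     (h (tens K A (env K (fst X)) \<one>\<^bsub>A\<^esub> (env_incl K (fst X) x)), snd X x))"

end

theory Submission
  imports Defs
begin

text \<open>
  Write \<open>T\<close> for the space \<open>A \<otimes> U(L)\<close>.  Composing the comultiplication with the factorwise action
  of \<open>U(L) \<otimes> U(L)\<close> gives an algebra map \<open>\<rho> : U(L) \<rightarrow> End(T)\<close>, and the smash product is
  \<open>(a \<otimes> u) t = \<lambda>\<^sub>a (\<rho>\<^sub>u t)\<close>, where \<open>\<lambda>\<^sub>a\<close> is left multiplication by \<open>a\<close> on the first factor.
  Associativity reduces to \<open>(\<rho>\<^sub>u s) t = \<rho>\<^sub>u (s t)\<close>, which only has to be checked for \<open>u = X \<in> L\<close>,
  where it says that \<open>X\<close> acts on \<open>A\<close> by a derivation; neither coassociativity nor the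
  Poincare-Birkhoff-Witt theorem is needed.  A map of \<open>A\<close>-rings out of \<open>A # U(L)\<close> is
  determined by its values \<open>r\<^sub>X\<close> on \<open>1 \<otimes> X\<close>, and conversely a Lie map \<open>X \<mapsto> (r\<^sub>X, \<omega> X)\<close> extends to
  \<open>G : U(L) \<rightarrow> R\<close> and yields \<open>a \<otimes> u \<mapsto> \<phi>(a) G(u)\<close>; this is multiplicative because
  \<open>[r\<^sub>X, \<phi>(a)] = \<phi>(\<omega>(X)(a))\<close>, again a condition on generators only.
\<close>

section \<open>Modules and algebras\<close>

text \<open>\<open>tensor_lift\<close> and \<open>env_lift\<close> are definite descriptions, so
  nothing is known about their values until existence and uniqueness of the induced map are proved.
  Hence a universal property precedes every computation, and an inner lift needs its own proof of
  bilinear dependence on parameters (\<open>bilin_tensor_lift\<close>) before an outer lift around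
  it makes sense. The smash product is three nested lifts, the innermost over the comultiplication.
  A Sweedler sum has no explicit summands here; \<open>smash_inner\<close> removes it by recognising
  it as the value at the comultiplication of u of one linear map, and from then on products are
  operator identities. Generators suffice for (rho_u s) t = rho_u (s t) because for X in L the claim
  holds with every s: applied to rho_u s, it carries the claim from u to X u, as rho is
  multiplicative. The same one-sided induction, \<open>env_induct\<close>, shows that a # u ->
  phi(a) G(u) intertwines rho_u with left multiplication by G(u).\<close>

lemma lin_hom_closed: "\<lbrakk>f \<in> lin_hom K M N; x \<in> carrier M\<rbrakk> \<Longrightarrow> f x \<in> carrier N"
  by (auto simp: lin_hom_def)

lemma lin_hom_add:
  "\<lbrakk>f \<in> lin_hom K M N; x \<in> carrier M; y \<in> carrier M\<rbrakk> \<Longrightarrow> f (x \<oplus>\<^bsub>M\<^esub> y) = f x \<oplus>\<^bsub>N\<^esub> f y"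
  by (auto simp: lin_hom_def)

lemma lin_hom_smult:
  "\<lbrakk>f \<in> lin_hom K M N; c \<in> carrier K; x \<in> carrier M\<rbrakk> \<Longrightarrow> f (c \<odot>\<^bsub>M\<^esub> x) = c \<odot>\<^bsub>N\<^esub> f x"
  by (auto simp: lin_hom_def)

lemma lin_hom_ext:
  "\<lbrakk>f \<in> lin_hom K M N; g \<in> lin_hom K M P; \<And>x. x \<in> carrier M \<Longrightarrow> f x = g x\<rbrakk> \<Longrightarrow> f = g"
  by (rule extensionalityI[where A = "carrier M"]) (auto simp: lin_hom_def PiE_def)

lemma lin_hom_restrictI:
  assumes "module K M"
    and "\<And>x. x \<in> carrier M \<Longrightarrow> f x \<in> carrier N"
    and "\<And>x y. \<lbrakk>x \<in> carrier M; y \<in> carrier M\<rbrakk> \<Longrightarrow> f (x \<oplus>\<^bsub>M\<^esub> y) = f x \<oplus>\<^bsub>N\<^esub> f y"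
    and "\<And>c x. \<lbrakk>c \<in> carrier K; x \<in> carrier M\<rbrakk> \<Longrightarrow> f (c \<odot>\<^bsub>M\<^esub> x) = c \<odot>\<^bsub>N\<^esub> f x"
  shows "restrict f (carrier M) \<in> lin_hom K M N"
proof -
  interpret module K M by fact
  show ?thesis using assms(2-4) by (auto simp: lin_hom_def)
qed

lemma lin_hom_compose:
  assumes "module K M" "f \<in> lin_hom K M N" "g \<in> lin_hom K N P"
  shows "compose (carrier M) g f \<in> lin_hom K M P"
  unfolding compose_def using assms
  by (intro lin_hom_restrictI) (auto simp: lin_hom_closed lin_hom_add lin_hom_smult)

lemma lin_hom_id: "module K M \<Longrightarrow> (\<lambda>x\<in>carrier M. x) \<in> lin_hom K M M"
  by (rule lin_hom_restrictI) auto

lemma lin_hom_zero: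
  assumes "module K M" "module K N" "f \<in> lin_hom K M N"
  shows "f \<zero>\<^bsub>M\<^esub> = \<zero>\<^bsub>N\<^esub>"
proof -
  interpret M: module K M by fact
  interpret N: module K N by fact
  have "f (\<zero>\<^bsub>K\<^esub> \<odot>\<^bsub>M\<^esub> \<zero>\<^bsub>M\<^esub>) = \<zero>\<^bsub>K\<^esub> \<odot>\<^bsub>N\<^esub> f \<zero>\<^bsub>M\<^esub>"
    by (rule lin_hom_smult[OF assms(3)]) auto
  then show ?thesis using lin_hom_closed[OF assms(3) M.M.zero_closed] by simp
qed

lemma lin_hom_uminus:
  assumes "module K M" "module K N" "f \<in> lin_hom K M N" "x \<in> carrier M"
  shows "f (\<ominus>\<^bsub>M\<^esub> x) = \<ominus>\<^bsub>N\<^esub> f x"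
proof -
  interpret M: module K M by fact
  interpret N: module K N by fact
  have "f (\<ominus>\<^bsub>M\<^esub> x) \<oplus>\<^bsub>N\<^esub> f x = f (\<ominus>\<^bsub>M\<^esub> x \<oplus>\<^bsub>M\<^esub> x)"
    using lin_hom_add[OF assms(3)] assms(4) by simp
  also have "\<dots> = \<zero>\<^bsub>N\<^esub>" using lin_hom_zero[OF assms(1-3)] assms(4) by (simp add: M.M.l_neg)
  finally show ?thesis
    using lin_hom_closed[OF assms(3)] assms(4) by (intro N.M.minus_equality[symmetric]) auto
qed

lemma lin_hom_minus:
  assumes "module K M" "module K N" "f \<in> lin_hom K M N" "x \<in> carrier M" "y \<in> carrier M"
  shows "f (x \<ominus>\<^bsub>M\<^esub> y) = f x \<ominus>\<^bsub>N\<^esub> f y"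
proof -
  interpret M: module K M by fact
  show ?thesis
    using assms(4,5) by (simp add: a_minus_def lin_hom_add[OF assms(3)] lin_hom_uminus[OF assms(1-3)])
qed

text \<open>Used to kill relations: a span or ideal is the least one containing its generators, and
  a kernel containing the generators is another.\<close>

lemma submodule_ker:
  assumes "module K M" "module K N" "f \<in> lin_hom K M N"
  shows "submodule {x \<in> carrier M. f x = \<zero>\<^bsub>N\<^esub>} K M"
proof -
  interpret M: module K M by fact
  interpret N: module K N by fact
  show ?thesis
    by (rule M.submoduleI)
       (auto simp: lin_hom_zero[OF assms] lin_hom_uminus[OF assms] lin_hom_add[OF assms(3)]
          lin_hom_smult[OF assms(3)])
qed

lemma submodule_lin_span:
  assumes "module K M" "S \<subseteq> carrier M"
  shows "submodule (lin_span K M S) K M"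
proof -
  interpret M: module K M by fact
  \<comment> \<open>The intersected family must be nonempty, since an intersection over no
    submodules would be the whole type.\<close>
  have "carrier M \<in> {N. submodule N K M \<and> S \<subseteq> N}"
    using assms(2) M.carrier_is_submodule by simp
  then show ?thesis
    unfolding lin_span_def
    by (intro M.submoduleI)
       (auto dest: M.submoduleE(1,3,4) intro: M.submoduleE(5)
          simp: subgroup.one_closed[OF submodule.axioms(1), simplified])
qed

lemma lin_span_superset: "S \<subseteq> lin_span K M S"
  by (auto simp: lin_span_def)

lemma lin_span_minimal: "\<lbrakk>submodule N K M; S \<subseteq> N\<rbrakk> \<Longrightarrow> lin_span K M S \<subseteq> N"
  by (auto simp: lin_span_def)

text \<open>The laws of \<open>Q\<close> are pulled through the surjection \<open>q\<close> from
  those of \<open>M\<close>. With \<open>q\<close> a coset map this treats quotients; with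
  \<open>q\<close> the identity it passes to another record carrying the same vector space.\<close>

lemma module_image:
  assumes "module K M" "q ` carrier M = carrier Q"
    and add: "\<And>x y. \<lbrakk>x \<in> carrier M; y \<in> carrier M\<rbrakk> \<Longrightarrow> q (x \<oplus>\<^bsub>M\<^esub> y) = q x \<oplus>\<^bsub>Q\<^esub> q y"
    and smult: "\<And>c x. \<lbrakk>c \<in> carrier K; x \<in> carrier M\<rbrakk> \<Longrightarrow> q (c \<odot>\<^bsub>M\<^esub> x) = c \<odot>\<^bsub>Q\<^esub> q x"
    and zero: "q \<zero>\<^bsub>M\<^esub> = \<zero>\<^bsub>Q\<^esub>"
  shows "module K Q"
proof -
  interpret M: module K M by fact
  have im: "x \<in> carrier Q \<Longrightarrow> \<exists>x'\<in>carrier M. x = q x'" for x using assms(2) by auto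
  have cl: "x \<in> carrier M \<Longrightarrow> q x \<in> carrier Q" for x using assms(2) by auto
  show ?thesis
  proof (rule moduleI)
    show "abelian_group Q"
    proof (rule abelian_groupI)
      show "\<zero>\<^bsub>Q\<^esub> \<in> carrier Q" using cl[of "\<zero>\<^bsub>M\<^esub>"] zero by simp
    next
      fix x assume "x \<in> carrier Q"
      then obtain x' where x': "x' \<in> carrier M" "x = q x'" using im by blast
      then have "q (\<ominus>\<^bsub>M\<^esub> x') \<oplus>\<^bsub>Q\<^esub> x = \<zero>\<^bsub>Q\<^esub>"
        by (simp add: add[symmetric] zero[symmetric] M.M.l_neg)
      then show "\<exists>y\<in>carrier Q. y \<oplus>\<^bsub>Q\<^esub> x = \<zero>\<^bsub>Q\<^esub>" using x' cl M.M.a_inv_closed by blast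
    qed (auto dest!: im simp: add[symmetric] zero[symmetric] cl M.M.a_ac)
  qed (auto dest!: im simp: add[symmetric] smult[symmetric] cl M.smult_l_distr M.smult_r_distr
      M.smult_assoc1 intro: M.R.is_cring)
qed

lemma assoc_algebraI:
  assumes "module K R"
    and "\<And>x y. \<lbrakk>x \<in> carrier R; y \<in> carrier R\<rbrakk> \<Longrightarrow> x \<otimes>\<^bsub>R\<^esub> y \<in> carrier R"
    and "\<one>\<^bsub>R\<^esub> \<in> carrier R"
    and "\<And>x y z. \<lbrakk>x \<in> carrier R; y \<in> carrier R; z \<in> carrier R\<rbrakk> \<Longrightarrow>
      (x \<otimes>\<^bsub>R\<^esub> y) \<otimes>\<^bsub>R\<^esub> z = x \<otimes>\<^bsub>R\<^esub> (y \<otimes>\<^bsub>R\<^esub> z)"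
    and "\<And>x. x \<in> carrier R \<Longrightarrow> \<one>\<^bsub>R\<^esub> \<otimes>\<^bsub>R\<^esub> x = x"
    and "\<And>x. x \<in> carrier R \<Longrightarrow> x \<otimes>\<^bsub>R\<^esub> \<one>\<^bsub>R\<^esub> = x"
    and "\<And>x y z. \<lbrakk>x \<in> carrier R; y \<in> carrier R; z \<in> carrier R\<rbrakk> \<Longrightarrow>
      (x \<oplus>\<^bsub>R\<^esub> y) \<otimes>\<^bsub>R\<^esub> z = x \<otimes>\<^bsub>R\<^esub> z \<oplus>\<^bsub>R\<^esub> y \<otimes>\<^bsub>R\<^esub> z"
    and "\<And>x y z. \<lbrakk>x \<in> carrier R; y \<in> carrier R; z \<in> carrier R\<rbrakk> \<Longrightarrow>
      x \<otimes>\<^bsub>R\<^esub> (y \<oplus>\<^bsub>R\<^esub> z) = x \<otimes>\<^bsub>R\<^esub> y \<oplus>\<^bsub>R\<^esub> x \<otimes>\<^bsub>R\<^esub> z"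
    and "\<And>c x y. \<lbrakk>c \<in> carrier K; x \<in> carrier R; y \<in> carrier R\<rbrakk> \<Longrightarrow>
      (c \<odot>\<^bsub>R\<^esub> x) \<otimes>\<^bsub>R\<^esub> y = c \<odot>\<^bsub>R\<^esub> (x \<otimes>\<^bsub>R\<^esub> y)"
    and "\<And>c x y. \<lbrakk>c \<in> carrier K; x \<in> carrier R; y \<in> carrier R\<rbrakk> \<Longrightarrow>
      x \<otimes>\<^bsub>R\<^esub> (c \<odot>\<^bsub>R\<^esub> y) = c \<odot>\<^bsub>R\<^esub> (x \<otimes>\<^bsub>R\<^esub> y)"
  shows "assoc_algebra K R"
proof -
  interpret module K R by fact
  have "ring R"
    by (intro ringI monoidI M.abelian_group_axioms) (use assms in auto)
  then show ?thesis
    by (intro assoc_algebra.intro assoc_algebra_axioms.intro assms)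
qed

lemma assoc_algebra_module: "assoc_algebra K R \<Longrightarrow> module K R"
  by (rule assoc_algebra.axioms)

lemma assoc_algebra_ring: "assoc_algebra K R \<Longrightarrow> ring R"
  by (rule assoc_algebra.axioms)

lemma assoc_algebra_image:
  assumes "assoc_algebra K R" "q ` carrier R = carrier Q"
    and add: "\<And>x y. \<lbrakk>x \<in> carrier R; y \<in> carrier R\<rbrakk> \<Longrightarrow> q (x \<oplus>\<^bsub>R\<^esub> y) = q x \<oplus>\<^bsub>Q\<^esub> q y"
    and smult: "\<And>c x. \<lbrakk>c \<in> carrier K; x \<in> carrier R\<rbrakk> \<Longrightarrow> q (c \<odot>\<^bsub>R\<^esub> x) = c \<odot>\<^bsub>Q\<^esub> q x"
    and zero: "q \<zero>\<^bsub>R\<^esub> = \<zero>\<^bsub>Q\<^esub>"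
    and mult: "\<And>x y. \<lbrakk>x \<in> carrier R; y \<in> carrier R\<rbrakk> \<Longrightarrow> q (x \<otimes>\<^bsub>R\<^esub> y) = q x \<otimes>\<^bsub>Q\<^esub> q y"
    and one: "q \<one>\<^bsub>R\<^esub> = \<one>\<^bsub>Q\<^esub>"
  shows "assoc_algebra K Q"
proof -
  interpret R: assoc_algebra K R by fact
  have im: "x \<in> carrier Q \<Longrightarrow> \<exists>x'\<in>carrier R. x = q x'" for x using assms(2) by auto
  have cl: "x \<in> carrier R \<Longrightarrow> q x \<in> carrier Q" for x using assms(2) by auto
  show ?thesis
  proof (rule assoc_algebraI)
    show "module K Q"
      by (rule module_image[OF R.module_axioms assms(2) add smult zero])
  qed (auto dest!: im simp: add[symmetric] smult[symmetric] mult[symmetric] one[symmetric] cl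
      R.m_assoc R.l_distr R.r_distr R.smult_mult_left R.smult_mult_right)
qed

lemma alg_homI:
  assumes "h \<in> lin_hom K R S"
    and "\<And>x y. \<lbrakk>x \<in> carrier R; y \<in> carrier R\<rbrakk> \<Longrightarrow> h (x \<otimes>\<^bsub>R\<^esub> y) = h x \<otimes>\<^bsub>S\<^esub> h y"
    and "h \<one>\<^bsub>R\<^esub> = \<one>\<^bsub>S\<^esub>"
  shows "h \<in> alg_hom K R S"
  using assms lin_hom_closed[OF assms(1)] lin_hom_add[OF assms(1)]
  by (auto simp: alg_hom_def intro!: ring_hom_memI)

lemma alg_hom_lin: "h \<in> alg_hom K R S \<Longrightarrow> h \<in> lin_hom K R S"
  by (simp add: alg_hom_def)

lemma alg_hom_mult:
  "\<lbrakk>h \<in> alg_hom K R S; x \<in> carrier R; y \<in> carrier R\<rbrakk> \<Longrightarrow> h (x \<otimes>\<^bsub>R\<^esub> y) = h x \<otimes>\<^bsub>S\<^esub> h y"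
  by (auto simp: alg_hom_def ring_hom_mult)

lemma alg_hom_one: "h \<in> alg_hom K R S \<Longrightarrow> h \<one>\<^bsub>R\<^esub> = \<one>\<^bsub>S\<^esub>"
  by (auto simp: alg_hom_def ring_hom_one)

lemmas alg_hom_closed = lin_hom_closed[OF alg_hom_lin]
lemmas alg_hom_add = lin_hom_add[OF alg_hom_lin]
lemmas alg_hom_smult = lin_hom_smult[OF alg_hom_lin]
lemmas alg_hom_minus = lin_hom_minus[OF assoc_algebra_module assoc_algebra_module alg_hom_lin]

lemma alg_hom_compose:
  assumes "assoc_algebra K R" "f \<in> alg_hom K R S" "g \<in> alg_hom K S T"
  shows "compose (carrier R) g f \<in> alg_hom K R T"
proof -
  interpret assoc_algebra K R by fact
  show ?thesis
  proof (rule alg_homI)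
    show "compose (carrier R) g f \<in> lin_hom K R T"
      by (rule lin_hom_compose[OF module_axioms alg_hom_lin[OF assms(2)] alg_hom_lin[OF assms(3)]])
  qed (use assms in \<open>auto simp: compose_def alg_hom_mult alg_hom_one alg_hom_closed\<close>)
qed

lemma alg_hom_id: "assoc_algebra K R \<Longrightarrow> (\<lambda>x\<in>carrier R. x) \<in> alg_hom K R R"
  by (rule alg_homI)
     (auto intro: lin_hom_id assoc_algebra_module monoid.m_closed monoid.one_closed
        dest: assoc_algebra_ring ring.is_monoid)

lemma alg_hom_commutator:
  assumes "assoc_algebra K R" "assoc_algebra K S" "h \<in> alg_hom K R S" "x \<in> carrier R" "y \<in> carrier R"
  shows "h (commutator R x y) = commutator S (h x) (h y)"
proof -
  interpret assoc_algebra K R by fact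
  show ?thesis
    using assms by (simp add: commutator_def alg_hom_minus alg_hom_mult)
qed

section \<open>Quotients\<close>

context
  fixes K :: "'k ring" and M :: "('k, 'm) module" and N
  assumes module: "module K M" and submodule: "submodule N K M"
begin

interpretation M: module K M by (rule module)

interpretation N: abelian_subgroup N M
  using submodule
  by (intro abelian_subgroupI3 additive_subgroupI M.abelian_group_axioms) (rule submodule.axioms)

lemma quot_mod_carrier: "carrier (quot_mod M N) = (\<lambda>x. N +>\<^bsub>M\<^esub> x) ` carrier M"
  by (auto simp: quot_mod_def FactRing_simps ring.extend_def module.fields_def)

text \<open>The zero of the quotient is \<open>N\<close> itself; written as the coset of zero it has
  the shape that \<open>module_image\<close> asks for.\<close>

lemma quot_mod_zero: "\<zero>\<^bsub>quot_mod M N\<^esub> = N +>\<^bsub>M\<^esub> \<zero>\<^bsub>M\<^esub>"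
  using M.a_coset_add_zero[OF N.a_subset]
  by (simp add: quot_mod_def FactRing_simps ring.extend_def module.fields_def)

lemma quot_mod_one: "\<one>\<^bsub>quot_mod M N\<^esub> = N +>\<^bsub>M\<^esub> \<one>\<^bsub>M\<^esub>"
  by (simp add: quot_mod_def FactRing_simps ring.extend_def module.fields_def)

lemma quot_mod_add:
  "\<lbrakk>x \<in> carrier M; y \<in> carrier M\<rbrakk> \<Longrightarrow>
    (N +>\<^bsub>M\<^esub> x) \<oplus>\<^bsub>quot_mod M N\<^esub> (N +>\<^bsub>M\<^esub> y) = N +>\<^bsub>M\<^esub> (x \<oplus>\<^bsub>M\<^esub> y)"
  by (simp add: quot_mod_def FactRing_def ring.extend_def module.fields_def N.a_rcos_sum)

lemma coset_eq_iff:
  "\<lbrakk>x \<in> carrier M; y \<in> carrier M\<rbrakk> \<Longrightarrow> N +>\<^bsub>M\<^esub> x = N +>\<^bsub>M\<^esub> y \<longleftrightarrow> x \<ominus>\<^bsub>M\<^esub> y \<in> N"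
  using N.a_rcos_module[of y x] N.a_repr_independence'[of x y] N.a_rcos_self[of x]
  by (auto simp: a_minus_def)

text \<open>The definition takes a union over all representatives of the coset. They all give the
  same coset because \<open>N\<close> is stable under scalars, and there is at least one, so the
  union collapses.\<close>

lemma quot_mod_smult:
  assumes c: "c \<in> carrier K" and x: "x \<in> carrier M"
  shows "c \<odot>\<^bsub>quot_mod M N\<^esub> (N +>\<^bsub>M\<^esub> x) = N +>\<^bsub>M\<^esub> (c \<odot>\<^bsub>M\<^esub> x)"
proof -
  have "N +>\<^bsub>M\<^esub> (c \<odot>\<^bsub>M\<^esub> x') = N +>\<^bsub>M\<^esub> (c \<odot>\<^bsub>M\<^esub> x)" if x': "x' \<in> N +>\<^bsub>M\<^esub> x" for x'
  proof -
    have x'c: "x' \<in> carrier M" using x' x N.a_elemrcos_carrier by blast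
    have "x' \<ominus>\<^bsub>M\<^esub> x \<in> N" using x' x'c x by (simp add: N.a_rcos_module a_minus_def)
    then have "c \<odot>\<^bsub>M\<^esub> (x' \<ominus>\<^bsub>M\<^esub> x) \<in> N" using submodule.smult_closed[OF submodule] c by simp
    also have "c \<odot>\<^bsub>M\<^esub> (x' \<ominus>\<^bsub>M\<^esub> x) = c \<odot>\<^bsub>M\<^esub> x' \<ominus>\<^bsub>M\<^esub> c \<odot>\<^bsub>M\<^esub> x"
      using c x x'c by (simp add: a_minus_def M.smult_r_distr M.smult_r_minus)
    finally show ?thesis using c x x'c by (simp add: coset_eq_iff)
  qed
  moreover have "x \<in> N +>\<^bsub>M\<^esub> x" using x by (rule N.a_rcos_self)
  ultimately have "(\<Union>x'\<in>N +>\<^bsub>M\<^esub> x. N +>\<^bsub>M\<^esub> (c \<odot>\<^bsub>M\<^esub> x')) = N +>\<^bsub>M\<^esub> (c \<odot>\<^bsub>M\<^esub> x)" by blast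
  then show ?thesis by (simp add: quot_mod_def FactRing_def ring.extend_def module.fields_def)
qed

lemma quot_mod_mult:
  assumes "ideal N M" "x \<in> carrier M" "y \<in> carrier M"
  shows "(N +>\<^bsub>M\<^esub> x) \<otimes>\<^bsub>quot_mod M N\<^esub> (N +>\<^bsub>M\<^esub> y) = N +>\<^bsub>M\<^esub> (x \<otimes>\<^bsub>M\<^esub> y)"
  using assms
  by (simp add: quot_mod_def FactRing_def ring.extend_def module.fields_def ideal.rcoset_mult_add)

lemma module_quot_mod: "module K (quot_mod M N)"
  by (rule module_image[OF module, where q = "\<lambda>x. N +>\<^bsub>M\<^esub> x"])
     (auto simp: quot_mod_carrier quot_mod_add quot_mod_smult quot_mod_zero)

lemma assoc_algebra_quot_mod:
  assumes "assoc_algebra K M" "ideal N M"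
  shows "assoc_algebra K (quot_mod M N)"
  by (rule assoc_algebra_image[OF assms(1), where q = "\<lambda>x. N +>\<^bsub>M\<^esub> x"])
     (auto simp: quot_mod_carrier quot_mod_add quot_mod_smult quot_mod_zero quot_mod_mult[OF assms(2)]
        quot_mod_one)

lemma quot_mod_lift:
  assumes P: "module K P" and h: "h \<in> lin_hom K M P" and van: "\<And>n. n \<in> N \<Longrightarrow> h n = \<zero>\<^bsub>P\<^esub>"
  obtains g where "g \<in> lin_hom K (quot_mod M N) P" "\<And>x. x \<in> carrier M \<Longrightarrow> g (N +>\<^bsub>M\<^esub> x) = h x"
proof
  interpret P: module K P by fact
  \<comment> \<open>A chosen representative of each coset. Two representatives differ by an element
    of \<open>N\<close>, which \<open>h\<close> kills, so \<open>h (r X)\<close> does not depend on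
    the choice.\<close>
  define r where "r X = (SOME x. x \<in> carrier M \<and> X = N +>\<^bsub>M\<^esub> x)" for X
  let ?g = "\<lambda>X\<in>carrier (quot_mod M N). h (r X)"
  have *: "h (r (N +>\<^bsub>M\<^esub> x)) = h x" if x: "x \<in> carrier M" for x
  proof -
    have r: "r (N +>\<^bsub>M\<^esub> x) \<in> carrier M \<and> N +>\<^bsub>M\<^esub> x = N +>\<^bsub>M\<^esub> r (N +>\<^bsub>M\<^esub> x)"
      unfolding r_def by (rule someI[of _ x]) (use x in simp)
    then have "r (N +>\<^bsub>M\<^esub> x) \<ominus>\<^bsub>M\<^esub> x \<in> N" using x coset_eq_iff by metis
    then have "h (r (N +>\<^bsub>M\<^esub> x) \<ominus>\<^bsub>M\<^esub> x) = \<zero>\<^bsub>P\<^esub>" by (rule van)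
    then have "h (r (N +>\<^bsub>M\<^esub> x)) \<ominus>\<^bsub>P\<^esub> h x = \<zero>\<^bsub>P\<^esub>"
      using r x by (simp add: lin_hom_minus[OF module P h])
    then show ?thesis
      using P.M.minus_equality[of "h (r (N +>\<^bsub>M\<^esub> x))" "\<ominus>\<^bsub>P\<^esub> h x"] r x
      by (simp add: lin_hom_closed[OF h] a_minus_def)
  qed
  show g: "?g (N +>\<^bsub>M\<^esub> x) = h x" if "x \<in> carrier M" for x
    using * that by (simp add: quot_mod_carrier)
  show "?g \<in> lin_hom K (quot_mod M N) P"
    by (rule lin_hom_restrictI[OF module_quot_mod])
       (auto simp: quot_mod_carrier quot_mod_add quot_mod_smult * lin_hom_closed[OF h] lin_hom_add[OF h]
          lin_hom_smult[OF h])
qed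

end

section \<open>Free modules\<close>

lemma free_mod_simps:
  "\<zero>\<^bsub>free_mod K S\<^esub> = (\<lambda>_. \<zero>\<^bsub>K\<^esub>)"
  "f \<oplus>\<^bsub>free_mod K S\<^esub> g = (\<lambda>p. f p \<oplus>\<^bsub>K\<^esub> g p)"
  "c \<odot>\<^bsub>free_mod K S\<^esub> f = (\<lambda>p. c \<otimes>\<^bsub>K\<^esub> f p)"
  by (simp_all add: free_mod_def)

lemma free_mod_carrier:
  "f \<in> carrier (free_mod K S) \<longleftrightarrow>
    (\<forall>p. f p \<in> carrier K) \<and> {p. f p \<noteq> \<zero>\<^bsub>K\<^esub>} \<subseteq> S \<and> finite {p. f p \<noteq> \<zero>\<^bsub>K\<^esub>}"
  by (simp add: free_mod_def)

context
  fixes K :: "'k ring" and S :: "'p set"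
  assumes cring: "cring K"
begin

interpretation K: cring K by (rule cring)

lemma free_mod_add_closed:
  assumes "f \<in> carrier (free_mod K S)" "g \<in> carrier (free_mod K S)"
  shows "f \<oplus>\<^bsub>free_mod K S\<^esub> g \<in> carrier (free_mod K S)"
proof -
  have "{p. f p \<oplus>\<^bsub>K\<^esub> g p \<noteq> \<zero>\<^bsub>K\<^esub>} \<subseteq> {p. f p \<noteq> \<zero>\<^bsub>K\<^esub>} \<union> {p. g p \<noteq> \<zero>\<^bsub>K\<^esub>}" by auto
  with assms show ?thesis
    by (auto simp: free_mod_simps free_mod_carrier dest: finite_subset)
qed

lemma free_mod_smult_closed:
  assumes "c \<in> carrier K" "f \<in> carrier (free_mod K S)"
  shows "c \<odot>\<^bsub>free_mod K S\<^esub> f \<in> carrier (free_mod K S)"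
proof -
  have "{p. c \<otimes>\<^bsub>K\<^esub> f p \<noteq> \<zero>\<^bsub>K\<^esub>} \<subseteq> {p. f p \<noteq> \<zero>\<^bsub>K\<^esub>}" using assms by auto
  with assms show ?thesis
    by (auto simp: free_mod_simps free_mod_carrier dest: finite_subset)
qed

lemma module_free_mod: "module K (free_mod K S)"
proof (rule moduleI)
  show "abelian_group (free_mod K S)"
  proof (rule abelian_groupI)
    fix f assume f: "f \<in> carrier (free_mod K S)"
    \<comment> \<open>Negation is taken as the scalar multiple by -1, so the finiteness of its
      support is already known.\<close>
    let ?g = "(\<ominus>\<^bsub>K\<^esub> \<one>\<^bsub>K\<^esub>) \<odot>\<^bsub>free_mod K S\<^esub> f"
    have "?g \<oplus>\<^bsub>free_mod K S\<^esub> f = \<zero>\<^bsub>free_mod K S\<^esub>"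
      using f by (auto simp: free_mod_simps free_mod_carrier K.l_minus K.l_neg)
    moreover have "?g \<in> carrier (free_mod K S)" using f by (intro free_mod_smult_closed) auto
    ultimately show "\<exists>g\<in>carrier (free_mod K S). g \<oplus>\<^bsub>free_mod K S\<^esub> f = \<zero>\<^bsub>free_mod K S\<^esub>" by blast
  next
    fix f g assume "f \<in> carrier (free_mod K S)" "g \<in> carrier (free_mod K S)"
    then show "f \<oplus>\<^bsub>free_mod K S\<^esub> g \<in> carrier (free_mod K S)" by (rule free_mod_add_closed)
  qed (auto simp: free_mod_simps free_mod_carrier K.a_ac)
next
  fix c f assume "c \<in> carrier K" "f \<in> carrier (free_mod K S)"
  then show "c \<odot>\<^bsub>free_mod K S\<^esub> f \<in> carrier (free_mod K S)" by (rule free_mod_smult_closed)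
qed (use cring in \<open>auto simp: free_mod_simps free_mod_carrier K.l_distr K.r_distr K.m_assoc\<close>)

lemma basis_elt_closed [simp]: "p \<in> S \<Longrightarrow> basis_elt K p \<in> carrier (free_mod K S)"
  by (auto simp: basis_elt_def free_mod_carrier)

end

text \<open>The induction runs over a finite set \<open>T\<close> containing the support, not over
  the support itself. At a new point the coefficient is either zero, and the induction hypothesis
  applies, or it is split off as a multiple of one basis element.\<close>

lemma free_mod_induct [consumes 2, case_names zero basis add smult]:
  assumes "cring K" "f \<in> carrier (free_mod K S)"
    and zero: "P \<zero>\<^bsub>free_mod K S\<^esub>"
    and basis: "\<And>p. p \<in> S \<Longrightarrow> P (basis_elt K p)"
    and add: "\<And>f g. \<lbrakk>f \<in> carrier (free_mod K S); g \<in> carrier (free_mod K S); P f; P g\<rbrakk> \<Longrightarrow>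
      P (f \<oplus>\<^bsub>free_mod K S\<^esub> g)"
    and smult: "\<And>c f. \<lbrakk>c \<in> carrier K; f \<in> carrier (free_mod K S); P f\<rbrakk> \<Longrightarrow>
      P (c \<odot>\<^bsub>free_mod K S\<^esub> f)"
  shows "P f"
proof -
  interpret K: cring K by fact
  have "finite T \<Longrightarrow> \<forall>f\<in>carrier (free_mod K S). {p. f p \<noteq> \<zero>\<^bsub>K\<^esub>} \<subseteq> T \<longrightarrow> P f" for T
  proof (induction T rule: finite_induct)
    case empty
    then show ?case using zero by (auto simp: free_mod_simps fun_eq_iff[symmetric] simp flip: ext)
  next
    case (insert p T)
    show ?case
    proof (intro ballI impI)
      fix f assume f: "f \<in> carrier (free_mod K S)" and sub: "{q. f q \<noteq> \<zero>\<^bsub>K\<^esub>} \<subseteq> insert p T"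
      show "P f"
      proof (cases "f p = \<zero>\<^bsub>K\<^esub>")
        case True
        then show ?thesis using insert.IH f sub by blast
      next
        case False
        then have p: "p \<in> S" using f by (auto simp: free_mod_carrier)
        let ?g = "f(p := \<zero>\<^bsub>K\<^esub>)"
        have "{q. ?g q \<noteq> \<zero>\<^bsub>K\<^esub>} \<subseteq> {q. f q \<noteq> \<zero>\<^bsub>K\<^esub>}" by auto
        moreover from this have "finite {q. ?g q \<noteq> \<zero>\<^bsub>K\<^esub>}"
          using f by (auto simp: free_mod_carrier intro: finite_subset)
        ultimately have g: "?g \<in> carrier (free_mod K S)"
          using f by (simp add: free_mod_carrier) blast
        have "{q. ?g q \<noteq> \<zero>\<^bsub>K\<^esub>} \<subseteq> T" using sub by auto
        then have "P ?g" using insert.IH g by blast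
        moreover have fp: "f p \<in> carrier K" using f by (simp add: free_mod_carrier)
        ultimately have "P (?g \<oplus>\<^bsub>free_mod K S\<^esub> (f p \<odot>\<^bsub>free_mod K S\<^esub> basis_elt K p))"
          using p g by (intro add smult basis free_mod_smult_closed basis_elt_closed K.is_cring) auto
        also have "?g \<oplus>\<^bsub>free_mod K S\<^esub> (f p \<odot>\<^bsub>free_mod K S\<^esub> basis_elt K p) = f"
          using f by (auto simp: free_mod_simps free_mod_carrier basis_elt_def)
        finally show ?thesis .
      qed
    qed
  qed
  then show ?thesis using assms(2) by (auto simp: free_mod_carrier)
qed

context
  fixes K :: "'k ring" and S :: "'p set"
  assumes cring: "cring K"
begin

lemma free_mod_lift:
  assumes P: "module K P" and b: "\<And>p. p \<in> S \<Longrightarrow> b p \<in> carrier P"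
  obtains h where "h \<in> lin_hom K (free_mod K S) P" "\<And>p. p \<in> S \<Longrightarrow> h (basis_elt K p) = b p"
proof
  interpret P: module K P by fact
  let ?supp = "\<lambda>f. {p. f p \<noteq> \<zero>\<^bsub>K\<^esub>}"
  let ?h = "\<lambda>f\<in>carrier (free_mod K S). \<Oplus>\<^bsub>P\<^esub>p\<in>?supp f. f p \<odot>\<^bsub>P\<^esub> b p"
  \<comment> \<open>The sum may run over any finite set between the support and \<open>S\<close>.
    The supports of \<open>f\<close>, \<open>g\<close> and their sum differ, and this allows
    comparison over a common index set.\<close>
  have ext: "?h f = (\<Oplus>\<^bsub>P\<^esub>p\<in>T. f p \<odot>\<^bsub>P\<^esub> b p)"
    if "f \<in> carrier (free_mod K S)" "?supp f \<subseteq> T" "T \<subseteq> S" "finite T" for f T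
  proof -
    have "(\<Oplus>\<^bsub>P\<^esub>p\<in>?supp f. f p \<odot>\<^bsub>P\<^esub> b p) = (\<Oplus>\<^bsub>P\<^esub>p\<in>T. f p \<odot>\<^bsub>P\<^esub> b p)"
    proof (rule P.M.add.finprod_mono_neutral_cong_left)
      show "f i \<odot>\<^bsub>P\<^esub> b i = \<zero>\<^bsub>P\<^esub>" if "i \<in> T - ?supp f" for i
        using that \<open>T \<subseteq> S\<close> b by auto
      show "(\<lambda>p. f p \<odot>\<^bsub>P\<^esub> b p) \<in> T \<rightarrow> carrier P"
        using \<open>T \<subseteq> S\<close> b that(1) by (auto simp: free_mod_carrier)
    qed (use that in auto)
    then show ?thesis using that(1) by simp
  qed
  show "?h (basis_elt K p) = b p" if p: "p \<in> S" for p
  proof -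
    have "?h (basis_elt K p) = (\<Oplus>\<^bsub>P\<^esub>q\<in>{p}. basis_elt K p q \<odot>\<^bsub>P\<^esub> b q)"
      using p by (intro ext basis_elt_closed[OF cring]) (auto simp: basis_elt_def)
    also have "\<dots> = basis_elt K p p \<odot>\<^bsub>P\<^esub> b p"
      using p b by (subst P.M.finsum_insert) (auto simp: basis_elt_def)
    also have "\<dots> = b p" using p b by (simp add: basis_elt_def)
    finally show ?thesis .
  qed
  show "?h \<in> lin_hom K (free_mod K S) P"
  proof (rule lin_hom_restrictI[OF module_free_mod[OF cring]])
    fix f assume f: "f \<in> carrier (free_mod K S)"
    show "(\<Oplus>\<^bsub>P\<^esub>p\<in>?supp f. f p \<odot>\<^bsub>P\<^esub> b p) \<in> carrier P"
      using f b by (intro P.M.finsum_closed) (auto simp: free_mod_carrier)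
    fix c assume c: "c \<in> carrier K"
    show "(\<Oplus>\<^bsub>P\<^esub>p\<in>?supp (c \<odot>\<^bsub>free_mod K S\<^esub> f). (c \<odot>\<^bsub>free_mod K S\<^esub> f) p \<odot>\<^bsub>P\<^esub> b p)
      = c \<odot>\<^bsub>P\<^esub> (\<Oplus>\<^bsub>P\<^esub>p\<in>?supp f. f p \<odot>\<^bsub>P\<^esub> b p)"
    proof -
      have "c \<odot>\<^bsub>P\<^esub> (\<Oplus>\<^bsub>P\<^esub>p\<in>?supp f. f p \<odot>\<^bsub>P\<^esub> b p) = (\<Oplus>\<^bsub>P\<^esub>p\<in>?supp f. c \<odot>\<^bsub>P\<^esub> (f p \<odot>\<^bsub>P\<^esub> b p))"
        using f b c by (intro P.finsum_smult_ldistr) (auto simp: free_mod_carrier)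
      also have "\<dots> = (\<Oplus>\<^bsub>P\<^esub>p\<in>?supp f. (c \<odot>\<^bsub>free_mod K S\<^esub> f) p \<odot>\<^bsub>P\<^esub> b p)"
        using f b c
        by (intro P.M.finsum_cong') (auto simp: free_mod_carrier free_mod_simps P.smult_assoc1)
      also have "\<dots> = ?h (c \<odot>\<^bsub>free_mod K S\<^esub> f)"
        using f c
        by (intro ext[symmetric] free_mod_smult_closed[OF cring]) (auto simp: free_mod_carrier free_mod_simps)
      finally show ?thesis using c f by (simp add: free_mod_smult_closed[OF cring])
    qed
  next
    fix f g assume f: "f \<in> carrier (free_mod K S)" and g: "g \<in> carrier (free_mod K S)"
    let ?T = "?supp f \<union> ?supp g"
    have T: "finite ?T" "?T \<subseteq> S" using f g by (auto simp: free_mod_carrier)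
    have "?h (f \<oplus>\<^bsub>free_mod K S\<^esub> g) = (\<Oplus>\<^bsub>P\<^esub>p\<in>?T. (f \<oplus>\<^bsub>free_mod K S\<^esub> g) p \<odot>\<^bsub>P\<^esub> b p)"
      using f g T by (intro ext free_mod_add_closed[OF cring]) (auto simp: free_mod_simps)
    also have "\<dots> = (\<Oplus>\<^bsub>P\<^esub>p\<in>?T. f p \<odot>\<^bsub>P\<^esub> b p \<oplus>\<^bsub>P\<^esub> g p \<odot>\<^bsub>P\<^esub> b p)"
      using f g b T(2)
      by (intro P.M.finsum_cong') (auto simp: free_mod_carrier free_mod_simps intro!: P.smult_l_distr)
    also have "\<dots> = (\<Oplus>\<^bsub>P\<^esub>p\<in>?T. f p \<odot>\<^bsub>P\<^esub> b p) \<oplus>\<^bsub>P\<^esub> (\<Oplus>\<^bsub>P\<^esub>p\<in>?T. g p \<odot>\<^bsub>P\<^esub> b p)"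
      using f g b T(2) by (intro P.M.finsum_addf) (auto simp: free_mod_carrier)
    also have "\<dots> = ?h f \<oplus>\<^bsub>P\<^esub> ?h g"
      using ext[OF f _ T(2,1)] ext[OF g _ T(2,1)] by simp
    finally show "(\<Oplus>\<^bsub>P\<^esub>p\<in>?supp (f \<oplus>\<^bsub>free_mod K S\<^esub> g). (f \<oplus>\<^bsub>free_mod K S\<^esub> g) p \<odot>\<^bsub>P\<^esub> b p)
      = (\<Oplus>\<^bsub>P\<^esub>p\<in>?supp f. f p \<odot>\<^bsub>P\<^esub> b p) \<oplus>\<^bsub>P\<^esub> (\<Oplus>\<^bsub>P\<^esub>p\<in>?supp g. g p \<odot>\<^bsub>P\<^esub> b p)"
      using f g by (simp add: free_mod_add_closed[OF cring])
  qed
qed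

end

section \<open>Tensor products\<close>

text \<open>Unlike \<open>lin_hom\<close>, this asks for no extensionality, because the function
  passed to \<open>tensor_lift\<close> is a bare lambda term; \<open>bilin_cong\<close> accordingly
  compares on the carriers only.\<close>

definition bilin ::
  "'k ring \<Rightarrow> ('k, 'm) module \<Rightarrow> ('k, 'n) module \<Rightarrow> ('k, 'p) module \<Rightarrow> ('m \<Rightarrow> 'n \<Rightarrow> 'p) \<Rightarrow> bool" where
  "bilin K M N P \<beta> \<longleftrightarrow>
     (\<forall>m\<in>carrier M. \<forall>n\<in>carrier N. \<beta> m n \<in> carrier P) \<and>
     (\<forall>m\<in>carrier M. \<forall>m'\<in>carrier M. \<forall>n\<in>carrier N. \<beta> (m \<oplus>\<^bsub>M\<^esub> m') n = \<beta> m n \<oplus>\<^bsub>P\<^esub> \<beta> m' n) \<and>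
     (\<forall>m\<in>carrier M. \<forall>n\<in>carrier N. \<forall>n'\<in>carrier N. \<beta> m (n \<oplus>\<^bsub>N\<^esub> n') = \<beta> m n \<oplus>\<^bsub>P\<^esub> \<beta> m n') \<and>
     (\<forall>c\<in>carrier K. \<forall>m\<in>carrier M. \<forall>n\<in>carrier N. \<beta> (c \<odot>\<^bsub>M\<^esub> m) n = c \<odot>\<^bsub>P\<^esub> \<beta> m n) \<and>
     (\<forall>c\<in>carrier K. \<forall>m\<in>carrier M. \<forall>n\<in>carrier N. \<beta> m (c \<odot>\<^bsub>N\<^esub> n) = c \<odot>\<^bsub>P\<^esub> \<beta> m n)"

lemma bilinI:
  assumes "\<And>m n. \<lbrakk>m \<in> carrier M; n \<in> carrier N\<rbrakk> \<Longrightarrow> \<beta> m n \<in> carrier P"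
    and "\<And>m m' n. \<lbrakk>m \<in> carrier M; m' \<in> carrier M; n \<in> carrier N\<rbrakk> \<Longrightarrow>
      \<beta> (m \<oplus>\<^bsub>M\<^esub> m') n = \<beta> m n \<oplus>\<^bsub>P\<^esub> \<beta> m' n"
    and "\<And>m n n'. \<lbrakk>m \<in> carrier M; n \<in> carrier N; n' \<in> carrier N\<rbrakk> \<Longrightarrow>
      \<beta> m (n \<oplus>\<^bsub>N\<^esub> n') = \<beta> m n \<oplus>\<^bsub>P\<^esub> \<beta> m n'"
    and "\<And>c m n. \<lbrakk>c \<in> carrier K; m \<in> carrier M; n \<in> carrier N\<rbrakk> \<Longrightarrow>
      \<beta> (c \<odot>\<^bsub>M\<^esub> m) n = c \<odot>\<^bsub>P\<^esub> \<beta> m n"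
    and "\<And>c m n. \<lbrakk>c \<in> carrier K; m \<in> carrier M; n \<in> carrier N\<rbrakk> \<Longrightarrow>
      \<beta> m (c \<odot>\<^bsub>N\<^esub> n) = c \<odot>\<^bsub>P\<^esub> \<beta> m n"
  shows "bilin K M N P \<beta>"
  using assms by (auto simp: bilin_def)

lemma bilinD:
  assumes "bilin K M N P \<beta>"
  shows "\<lbrakk>m \<in> carrier M; n \<in> carrier N\<rbrakk> \<Longrightarrow> \<beta> m n \<in> carrier P"
    and "\<lbrakk>m \<in> carrier M; m' \<in> carrier M; n \<in> carrier N\<rbrakk> \<Longrightarrow>
      \<beta> (m \<oplus>\<^bsub>M\<^esub> m') n = \<beta> m n \<oplus>\<^bsub>P\<^esub> \<beta> m' n"
    and "\<lbrakk>m \<in> carrier M; n \<in> carrier N; n' \<in> carrier N\<rbrakk> \<Longrightarrow>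
      \<beta> m (n \<oplus>\<^bsub>N\<^esub> n') = \<beta> m n \<oplus>\<^bsub>P\<^esub> \<beta> m n'"
    and "\<lbrakk>c \<in> carrier K; m \<in> carrier M; n \<in> carrier N\<rbrakk> \<Longrightarrow> \<beta> (c \<odot>\<^bsub>M\<^esub> m) n = c \<odot>\<^bsub>P\<^esub> \<beta> m n"
    and "\<lbrakk>c \<in> carrier K; m \<in> carrier M; n \<in> carrier N\<rbrakk> \<Longrightarrow> \<beta> m (c \<odot>\<^bsub>N\<^esub> n) = c \<odot>\<^bsub>P\<^esub> \<beta> m n"
  using assms by (auto simp: bilin_def)

lemma bilin_cong:
  assumes "module K M" "module K N"
    and "\<And>m n. \<lbrakk>m \<in> carrier M; n \<in> carrier N\<rbrakk> \<Longrightarrow> \<beta> m n = \<gamma> m n"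
  shows "bilin K M N P \<beta> \<longleftrightarrow> bilin K M N P \<gamma>"
proof -
  interpret M: module K M by fact
  interpret N: module K N by fact
  show ?thesis using assms(3) by (simp add: bilin_def)
qed

lemma bilin_add:
  assumes "module K P" "bilin K M N P \<beta>" "bilin K M N P \<gamma>"
  shows "bilin K M N P (\<lambda>m n. \<beta> m n \<oplus>\<^bsub>P\<^esub> \<gamma> m n)"
proof -
  interpret P: module K P by fact
  show ?thesis
    using assms(2,3) by (auto simp: bilin_def P.smult_r_distr P.M.a_ac)
qed

lemma bilin_lin_hom:
  assumes "bilin K M N P \<beta>" "h \<in> lin_hom K P Q"
  shows "bilin K M N Q (\<lambda>m n. h (\<beta> m n))"
  using assms(1) by (auto simp: bilin_def lin_hom_closed[OF assms(2)] lin_hom_add[OF assms(2)]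
      lin_hom_smult[OF assms(2)])

lemma bilin_minus_left:
  assumes "module K M" "module K P" "bilin K M N P \<beta>" "m \<in> carrier M" "m' \<in> carrier M" "n \<in> carrier N"
  shows "\<beta> (m \<ominus>\<^bsub>M\<^esub> m') n = \<beta> m n \<ominus>\<^bsub>P\<^esub> \<beta> m' n"
proof -
  interpret M: module K M by fact
  have "(\<lambda>x\<in>carrier M. \<beta> x n) \<in> lin_hom K M P"
    by (rule lin_hom_restrictI[OF assms(1)]) (auto simp: bilinD[OF assms(3)] assms(6))
  from lin_hom_minus[OF assms(1,2) this assms(4,5)] show ?thesis using assms(4,5) by simp
qed

lemma bilin_minus_right:
  assumes "module K N" "module K P" "bilin K M N P \<beta>" "m \<in> carrier M" "n \<in> carrier N" "n' \<in> carrier N"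
  shows "\<beta> m (n \<ominus>\<^bsub>N\<^esub> n') = \<beta> m n \<ominus>\<^bsub>P\<^esub> \<beta> m n'"
proof -
  interpret N: module K N by fact
  have "(\<lambda>x\<in>carrier N. \<beta> m x) \<in> lin_hom K N P"
    by (rule lin_hom_restrictI[OF assms(1)]) (auto simp: bilinD[OF assms(3)] assms(4))
  from lin_hom_minus[OF assms(1,2) this assms(5,6)] show ?thesis using assms(5,6) by simp
qed

lemma assoc_algebra_bilinI:
  assumes "module K R" "bilin K R R R (mult R)" "\<one>\<^bsub>R\<^esub> \<in> carrier R"
    and "\<And>x y z. \<lbrakk>x \<in> carrier R; y \<in> carrier R; z \<in> carrier R\<rbrakk> \<Longrightarrow>
      (x \<otimes>\<^bsub>R\<^esub> y) \<otimes>\<^bsub>R\<^esub> z = x \<otimes>\<^bsub>R\<^esub> (y \<otimes>\<^bsub>R\<^esub> z)"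
    and "\<And>x. x \<in> carrier R \<Longrightarrow> \<one>\<^bsub>R\<^esub> \<otimes>\<^bsub>R\<^esub> x = x"
    and "\<And>x. x \<in> carrier R \<Longrightarrow> x \<otimes>\<^bsub>R\<^esub> \<one>\<^bsub>R\<^esub> = x"
  shows "assoc_algebra K R"
  by (rule assoc_algebraI) (use assms bilinD[OF assms(2)] in \<open>auto simp del: assms(4)\<close>)

lemma (in assoc_algebra) bilin_mult: "bilin K R R R (mult R)"
  by (rule bilinI) (auto simp: l_distr r_distr smult_mult_left smult_mult_right)

locale two_modules = M: module K M + N: module K N
  for K :: "'k ring" and M :: "('k, 'm) module" and N :: "('k, 'n) module"
begin

abbreviation "free \<equiv> free_mod K (carrier M \<times> carrier N)"
abbreviation "rels \<equiv> lin_span K free (tensor_rels K M N)"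

interpretation F: module K free by (rule module_free_mod) (rule M.R.is_cring)

lemma tensor_rels_closed: "tensor_rels K M N \<subseteq> carrier free"
  by (auto simp: tensor_rels_def Let_def basis_elt_closed[OF M.R.is_cring])

lemmas submodule_rels = submodule_lin_span[OF F.module_axioms tensor_rels_closed]

lemma tensor_quot: "tensor K M N = quot_mod free rels"
  by (simp add: tensor_def Let_def)

lemma tens_coset: "tens K M N m n = rels +>\<^bsub>free\<^esub> basis_elt K (m, n)"
  by (simp add: tens_def Let_def)

sublocale T: module K "tensor K M N"
  unfolding tensor_quot by (rule module_quot_mod[OF F.module_axioms submodule_rels])

lemmas quot_facts =
  quot_mod_add[OF F.module_axioms submodule_rels, folded tensor_quot]
  quot_mod_smult[OF F.module_axioms submodule_rels, folded tensor_quot]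
  coset_eq_iff[OF F.module_axioms submodule_rels]

lemma tens_closed [simp, intro]:
  "\<lbrakk>m \<in> carrier M; n \<in> carrier N\<rbrakk> \<Longrightarrow> tens K M N m n \<in> carrier (tensor K M N)"
  by (auto simp: tensor_quot tens_coset quot_mod_carrier[OF F.module_axioms submodule_rels]
      basis_elt_closed[OF M.R.is_cring])

text \<open>By \<open>coset_eq_iff\<close> each law says that a difference lies in
  \<open>rels\<close>, and that difference is literally a member of one of the four families in
  \<open>tensor_rels\<close>.\<close>

lemma bilin_tens: "bilin K M N (tensor K M N) (tens K M N)"
proof (rule bilinI)
  note [simp] = basis_elt_closed[OF M.R.is_cring]
  note mem = subsetD[OF lin_span_superset]
  show "tens K M N (m \<oplus>\<^bsub>M\<^esub> m') n = tens K M N m n \<oplus>\<^bsub>tensor K M N\<^esub> tens K M N m' n"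
    if "m \<in> carrier M" "m' \<in> carrier M" "n \<in> carrier N" for m m' n
    using that
    by (simp add: tens_coset quot_facts) (rule mem, unfold tensor_rels_def Let_def, blast)
  show "tens K M N m (n \<oplus>\<^bsub>N\<^esub> n') = tens K M N m n \<oplus>\<^bsub>tensor K M N\<^esub> tens K M N m n'"
    if "m \<in> carrier M" "n \<in> carrier N" "n' \<in> carrier N" for m n n'
    using that
    by (simp add: tens_coset quot_facts) (rule mem, unfold tensor_rels_def Let_def, blast)
  show "tens K M N (c \<odot>\<^bsub>M\<^esub> m) n = c \<odot>\<^bsub>tensor K M N\<^esub> tens K M N m n"
    if "c \<in> carrier K" "m \<in> carrier M" "n \<in> carrier N" for c m n
    using that
    by (simp add: tens_coset quot_facts) (rule mem, unfold tensor_rels_def Let_def, blast)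
  show "tens K M N m (c \<odot>\<^bsub>N\<^esub> n) = c \<odot>\<^bsub>tensor K M N\<^esub> tens K M N m n"
    if "c \<in> carrier K" "m \<in> carrier M" "n \<in> carrier N" for c m n
    using that
    by (simp add: tens_coset quot_facts) (rule mem, unfold tensor_rels_def Let_def, blast)
qed auto

lemmas tens_add_left = bilinD(2)[OF bilin_tens]
lemmas tens_add_right = bilinD(3)[OF bilin_tens]
lemmas tens_smult_left = bilinD(4)[OF bilin_tens]
lemmas tens_smult_right = bilinD(5)[OF bilin_tens]

lemma tens_zero_left:
  assumes "n \<in> carrier N" shows "tens K M N \<zero>\<^bsub>M\<^esub> n = \<zero>\<^bsub>tensor K M N\<^esub>"
  using tens_smult_left[OF M.R.zero_closed M.M.zero_closed assms] assms by simp

text \<open>Scalars need no case of their own: \<open>c (m \<otimes> n) = (c m) \<otimes> n\<close>.\<close>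

lemma tensor_induct [consumes 1, case_names tens add]:
  assumes t: "t \<in> carrier (tensor K M N)"
    and tens: "\<And>m n. \<lbrakk>m \<in> carrier M; n \<in> carrier N\<rbrakk> \<Longrightarrow> P (tens K M N m n)"
    and add: "\<And>s t. \<lbrakk>s \<in> carrier (tensor K M N); t \<in> carrier (tensor K M N); P s; P t\<rbrakk> \<Longrightarrow>
      P (s \<oplus>\<^bsub>tensor K M N\<^esub> t)"
  shows "P t"
proof -
  \<comment> \<open>\<open>free_mod_induct\<close> has a scalar case, for which \<open>P\<close> has
    no closure property. Asserting \<open>P\<close> of every scalar multiple turns that case into
    associativity of scalars; the scalar 1 recovers \<open>P\<close> at the end.\<close>
  define Q where "Q s \<longleftrightarrow> s \<in> carrier (tensor K M N) \<and> (\<forall>c\<in>carrier K. P (c \<odot>\<^bsub>tensor K M N\<^esub> s))" for s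
  obtain f where f: "f \<in> carrier free" "t = rels +>\<^bsub>free\<^esub> f"
    using t by (auto simp: tensor_quot quot_mod_carrier[OF F.module_axioms submodule_rels])
  have "Q (rels +>\<^bsub>free\<^esub> f)"
    using M.R.is_cring f(1)
  proof (induction rule: free_mod_induct)
    case zero
    have "rels +>\<^bsub>free\<^esub> \<zero>\<^bsub>free\<^esub> = \<zero>\<^bsub>tensor K M N\<^esub>"
      by (simp add: tensor_quot quot_mod_zero[OF F.module_axioms submodule_rels])
    \<comment> \<open>\<open>P\<close> is given on pure tensors, so zero has to be presented as
      one.\<close>
    also have "\<dots> = tens K M N \<zero>\<^bsub>M\<^esub> \<zero>\<^bsub>N\<^esub>" by (simp add: tens_zero_left)
    finally show ?case by (simp add: Q_def tens_smult_left[symmetric] tens del: M.smult_r_null)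
  next
    case (basis p)
    then show ?case
      by (cases p) (auto simp: Q_def tens_coset[symmetric] tens_smult_left[symmetric] tens)
  next
    case (add f g)
    then show ?case
      by (auto simp: Q_def quot_facts(1)[symmetric] T.smult_r_distr intro!: assms(3))
  next
    case (smult c f)
    then show ?case
      by (auto simp: Q_def quot_facts(2)[symmetric] T.smult_assoc1[symmetric])
  qed
  then have "P (\<one>\<^bsub>K\<^esub> \<odot>\<^bsub>tensor K M N\<^esub> t)" using f(2) M.R.one_closed unfolding Q_def by blast
  then show ?thesis using t by simp
qed

lemma tensor_hom_ext:
  assumes "h \<in> lin_hom K (tensor K M N) P" "g \<in> lin_hom K (tensor K M N) P"
    and "\<And>m n. \<lbrakk>m \<in> carrier M; n \<in> carrier N\<rbrakk> \<Longrightarrow> h (tens K M N m n) = g (tens K M N m n)"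
  shows "h = g"
proof (rule lin_hom_ext[OF assms(1,2)])
  fix t assume "t \<in> carrier (tensor K M N)"
  then show "h t = g t"
    by (induction rule: tensor_induct) (auto simp: assms(3) lin_hom_add[OF assms(1)] lin_hom_add[OF assms(2)])
qed

lemma tensor_lift_ex:
  assumes P: "module K P" and \<beta>: "bilin K M N P \<beta>"
  obtains h where "h \<in> lin_hom K (tensor K M N) P"
    "\<And>m n. \<lbrakk>m \<in> carrier M; n \<in> carrier N\<rbrakk> \<Longrightarrow> h (tens K M N m n) = \<beta> m n"
proof -
  interpret P: module K P by fact
  note [simp] = basis_elt_closed[OF M.R.is_cring]
  obtain h where h: "h \<in> lin_hom K free P"
      and "\<And>p. p \<in> carrier M \<times> carrier N \<Longrightarrow> h (basis_elt K p) = case_prod \<beta> p"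
    by (rule free_mod_lift[OF M.R.is_cring P, of "carrier M \<times> carrier N" "case_prod \<beta>"])
       (use bilinD(1)[OF \<beta>] in auto)
  then have hb: "h (basis_elt K (m, n)) = \<beta> m n" if "m \<in> carrier M" "n \<in> carrier N" for m n
    using that by simp
  have "rels \<subseteq> {x \<in> carrier free. h x = \<zero>\<^bsub>P\<^esub>}"
    using tensor_rels_closed
    by (intro lin_span_minimal submodule_ker[OF F.module_axioms P h])
       (auto simp: tensor_rels_def Let_def hb lin_hom_minus[OF F.module_axioms P h] lin_hom_add[OF h]
          lin_hom_smult[OF h] bilinD[OF \<beta>] P.M.r_neg a_minus_def[of P])
  then have "\<And>x. x \<in> rels \<Longrightarrow> h x = \<zero>\<^bsub>P\<^esub>" by blast
  from quot_mod_lift[OF F.module_axioms submodule_rels P h this]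
  obtain g where "g \<in> lin_hom K (tensor K M N) P"
    "\<And>x. x \<in> carrier free \<Longrightarrow> g (rels +>\<^bsub>free\<^esub> x) = h x"
    by (auto simp: tensor_quot)
  then show ?thesis using hb by (intro that[of g]) (auto simp: tens_coset)
qed

text \<open>Uniqueness on pure tensors lets the description be evaluated: any linear map with the
  prescribed values is the lift, so exhibiting one settles existence as well.\<close>

lemma tensor_lift_eqI:
  assumes "h \<in> lin_hom K (tensor K M N) P"
    and "\<And>m n. \<lbrakk>m \<in> carrier M; n \<in> carrier N\<rbrakk> \<Longrightarrow> h (tens K M N m n) = \<beta> m n"
  shows "tensor_lift K M N P \<beta> = h"
  unfolding tensor_lift_def
proof (rule the_equality)
  fix g
  assume g: "g \<in> lin_hom K (tensor K M N) P \<and>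
    (\<forall>m\<in>carrier M. \<forall>n\<in>carrier N. g (tens K M N m n) = \<beta> m n)"
  show "g = h"
    by (rule tensor_hom_ext[OF g[THEN conjunct1] assms(1)]) (use g assms(2) in auto)
qed (use assms in auto)

lemma
  assumes "module K P" "bilin K M N P \<beta>"
  shows tensor_lift_lin: "tensor_lift K M N P \<beta> \<in> lin_hom K (tensor K M N) P"
    and tensor_lift_tens: "\<And>m n. \<lbrakk>m \<in> carrier M; n \<in> carrier N\<rbrakk> \<Longrightarrow>
      tensor_lift K M N P \<beta> (tens K M N m n) = \<beta> m n"
proof -
  obtain h where h: "h \<in> lin_hom K (tensor K M N) P"
    "\<And>m n. \<lbrakk>m \<in> carrier M; n \<in> carrier N\<rbrakk> \<Longrightarrow> h (tens K M N m n) = \<beta> m n"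
    using tensor_lift_ex[OF assms] by blast
  then have "tensor_lift K M N P \<beta> = h" by (rule tensor_lift_eqI)
  with h show "tensor_lift K M N P \<beta> \<in> lin_hom K (tensor K M N) P"
    "\<And>m n. \<lbrakk>m \<in> carrier M; n \<in> carrier N\<rbrakk> \<Longrightarrow> tensor_lift K M N P \<beta> (tens K M N m n) = \<beta> m n"
    by auto
qed

text \<open>The predicates under the two descriptions coincide, so the lifts agree whether or not
  the description denotes anything. This permits rewriting inside a lift before any bilinearity is
  known.\<close>

lemma tensor_lift_cong:
  assumes "\<And>m n. \<lbrakk>m \<in> carrier M; n \<in> carrier N\<rbrakk> \<Longrightarrow> \<beta> m n = \<gamma> m n"
  shows "tensor_lift K M N P \<beta> = tensor_lift K M N P \<gamma>"
  using assms by (simp add: tensor_lift_def cong: conj_cong)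

text \<open>On a pure tensor the claim is hypothesis \<open>2\<close>, and sums of bilinear maps are
  bilinear. The result licenses a lift in \<open>a\<close> and \<open>b\<close> around the lift in
  \<open>m\<close> and \<open>n\<close>.\<close>

lemma bilin_tensor_lift:
  assumes P: "module K P" and M': "module K M'" "module K N'"
    and 1: "\<And>a b. \<lbrakk>a \<in> carrier M'; b \<in> carrier N'\<rbrakk> \<Longrightarrow> bilin K M N P (\<beta> a b)"
    and 2: "\<And>m n. \<lbrakk>m \<in> carrier M; n \<in> carrier N\<rbrakk> \<Longrightarrow> bilin K M' N' P (\<lambda>a b. \<beta> a b m n)"
    and t: "t \<in> carrier (tensor K M N)"
  shows "bilin K M' N' P (\<lambda>a b. tensor_lift K M N P (\<beta> a b) t)"
  using t
proof (induction rule: tensor_induct)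
  case (tens m n)
  then show ?case
    using 2[OF tens] by (subst bilin_cong[OF M', of _ "\<lambda>a b. \<beta> a b m n"]) (auto simp: tensor_lift_tens[OF P 1])
next
  case (add s t)
  show ?case
    using bilin_add[OF P add.IH] add.hyps
    by (subst bilin_cong[OF M']) (auto simp: lin_hom_add[OF tensor_lift_lin[OF P 1]])
qed

end

text \<open>The multiplications of \<open>R \<otimes> S\<close> and of \<open>A # U(L)\<close> are both nested lifts of this shape.\<close>

lemma bilin_nested_tensor_lift:
  assumes "two_modules K M N" "two_modules K M' N'" and P: "module K P"
    and 1: "\<And>a b. \<lbrakk>a \<in> carrier M'; b \<in> carrier N'\<rbrakk> \<Longrightarrow> bilin K M N P (\<beta> a b)"
    and 2: "\<And>m n. \<lbrakk>m \<in> carrier M; n \<in> carrier N\<rbrakk> \<Longrightarrow> bilin K M' N' P (\<lambda>a b. \<beta> a b m n)"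
  shows "bilin K (tensor K M' N') (tensor K M N) P
    (\<lambda>s t. tensor_lift K M' N' P (\<lambda>a b. tensor_lift K M N P (\<beta> a b) t) s)" (is "bilin _ _ _ _ ?\<mu>")
proof -
  interpret MN: two_modules K M N by fact
  interpret MN': two_modules K M' N' by fact
  interpret P: module K P by fact
  note lift = MN.bilin_tensor_lift[OF P MN'.M.module_axioms MN'.N.module_axioms 1 2]
  note inner = MN.tensor_lift_lin[OF P 1]
  note outer = MN'.tensor_lift_lin[OF P lift]
  note ev = MN'.tensor_lift_tens[OF P lift]
  show ?thesis
  proof (rule bilinI)
    \<comment> \<open>Linearity in \<open>s\<close> is that of the outer lift. The argument
      \<open>t\<close> sits inside the family being lifted, so linearity there is proved by
      induction on \<open>s\<close>.\<close>
    fix s t t' assume st: "s \<in> carrier (tensor K M' N')" "t \<in> carrier (tensor K M N)"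
      "t' \<in> carrier (tensor K M N)"
    show "?\<mu> s (t \<oplus>\<^bsub>tensor K M N\<^esub> t') = ?\<mu> s t \<oplus>\<^bsub>P\<^esub> ?\<mu> s t'"
      using st(1)
    proof (induction rule: MN'.tensor_induct)
      case (tens m n)
      then show ?case using st by (simp add: ev lin_hom_add[OF inner])
    next
      case (add r s)
      then show ?case
        using st by (simp add: lin_hom_add[OF outer] lin_hom_closed[OF outer] P.M.a_ac)
    qed
  next
    fix c s t assume st: "c \<in> carrier K" "s \<in> carrier (tensor K M' N')" "t \<in> carrier (tensor K M N)"
    show "?\<mu> s (c \<odot>\<^bsub>tensor K M N\<^esub> t) = c \<odot>\<^bsub>P\<^esub> ?\<mu> s t"
      using st(2)
    proof (induction rule: MN'.tensor_induct)
      case (tens m n)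
      then show ?case using st by (simp add: ev lin_hom_smult[OF inner])
    next
      case (add r s)
      then show ?case
        using st by (simp add: lin_hom_add[OF outer] lin_hom_closed[OF outer] P.smult_r_distr)
    qed
  qed (auto simp: lin_hom_closed[OF outer] lin_hom_add[OF outer] lin_hom_smult[OF outer])
qed

section \<open>Endomorphisms\<close>

context
  fixes K :: "'k ring" and M :: "('k, 'm) module"
  assumes module: "module K M"
begin

interpretation M: module K M by (rule module)

lemma End_alg_carrier: "carrier (End_alg K M) = lin_hom K M M"
  by (simp add: End_alg_def)

lemma End_alg_apply:
  assumes "x \<in> carrier M"
  shows "(f \<otimes>\<^bsub>End_alg K M\<^esub> g) x = f (g x)"
    and "(f \<oplus>\<^bsub>End_alg K M\<^esub> g) x = f x \<oplus>\<^bsub>M\<^esub> g x"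
    and "(c \<odot>\<^bsub>End_alg K M\<^esub> f) x = c \<odot>\<^bsub>M\<^esub> f x"
    and "\<one>\<^bsub>End_alg K M\<^esub> x = x"
    and "\<zero>\<^bsub>End_alg K M\<^esub> x = \<zero>\<^bsub>M\<^esub>"
  using assms by (simp_all add: End_alg_def compose_def)

lemma End_alg_closed:
  "\<lbrakk>f \<in> lin_hom K M M; g \<in> lin_hom K M M\<rbrakk> \<Longrightarrow> f \<otimes>\<^bsub>End_alg K M\<^esub> g \<in> lin_hom K M M"
  "\<lbrakk>f \<in> lin_hom K M M; g \<in> lin_hom K M M\<rbrakk> \<Longrightarrow> f \<oplus>\<^bsub>End_alg K M\<^esub> g \<in> lin_hom K M M"
  "\<lbrakk>c \<in> carrier K; f \<in> lin_hom K M M\<rbrakk> \<Longrightarrow> c \<odot>\<^bsub>End_alg K M\<^esub> f \<in> lin_hom K M M"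
  "\<one>\<^bsub>End_alg K M\<^esub> \<in> lin_hom K M M"
  "\<zero>\<^bsub>End_alg K M\<^esub> \<in> lin_hom K M M"
proof -
  show "f \<otimes>\<^bsub>End_alg K M\<^esub> g \<in> lin_hom K M M" if "f \<in> lin_hom K M M" "g \<in> lin_hom K M M"
    using lin_hom_compose[OF module that(2,1)] by (simp add: End_alg_def)
  show "f \<oplus>\<^bsub>End_alg K M\<^esub> g \<in> lin_hom K M M" if fg: "f \<in> lin_hom K M M" "g \<in> lin_hom K M M"
    unfolding End_alg_def
    by (simp, rule lin_hom_restrictI[OF module])
       (auto simp: lin_hom_closed[OF fg(1)] lin_hom_closed[OF fg(2)] lin_hom_add[OF fg(1)]
          lin_hom_add[OF fg(2)] lin_hom_smult[OF fg(1)] lin_hom_smult[OF fg(2)] M.M.a_ac M.smult_r_distr)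
  show "c \<odot>\<^bsub>End_alg K M\<^esub> f \<in> lin_hom K M M" if c: "c \<in> carrier K" and f: "f \<in> lin_hom K M M"
    unfolding End_alg_def
    by (simp, rule lin_hom_restrictI[OF module])
       (use c in \<open>auto simp: lin_hom_closed[OF f] lin_hom_add[OF f] lin_hom_smult[OF f] M.smult_r_distr
          M.smult_assoc1[symmetric] M.R.m_comm\<close>)
  show "\<one>\<^bsub>End_alg K M\<^esub> \<in> lin_hom K M M"
    using lin_hom_id[OF module] by (simp add: End_alg_def)
  show "\<zero>\<^bsub>End_alg K M\<^esub> \<in> lin_hom K M M"
    unfolding End_alg_def by (simp, rule lin_hom_restrictI[OF module]) auto
qed

lemma End_alg_eqI:
  "\<lbrakk>f \<in> lin_hom K M M; g \<in> lin_hom K M M; \<And>x. x \<in> carrier M \<Longrightarrow> f x = g x\<rbrakk> \<Longrightarrow> f = g"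
  by (rule lin_hom_ext)

lemma module_End_alg: "module K (End_alg K M)"
proof (rule moduleI)
  show "abelian_group (End_alg K M)"
  proof (rule abelian_groupI; unfold End_alg_carrier)
    fix f assume f: "f \<in> lin_hom K M M"
    let ?g = "(\<ominus>\<^bsub>K\<^esub> \<one>\<^bsub>K\<^esub>) \<odot>\<^bsub>End_alg K M\<^esub> f"
    have g: "?g \<in> lin_hom K M M" using f by (intro End_alg_closed) auto
    have "?g \<oplus>\<^bsub>End_alg K M\<^esub> f = \<zero>\<^bsub>End_alg K M\<^esub>"
      by (rule End_alg_eqI)
         (use f g in \<open>auto simp: End_alg_closed End_alg_apply M.smult_l_minus lin_hom_closed[OF f] M.M.l_neg\<close>)
    with g show "\<exists>g\<in>lin_hom K M M. g \<oplus>\<^bsub>End_alg K M\<^esub> f = \<zero>\<^bsub>End_alg K M\<^esub>" by blast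
  qed (auto simp: End_alg_closed End_alg_apply lin_hom_closed M.M.a_ac intro!: End_alg_eqI)
qed (auto simp: End_alg_carrier End_alg_closed End_alg_apply lin_hom_closed M.R.is_cring
    M.smult_l_distr M.smult_r_distr M.smult_assoc1 intro!: End_alg_eqI)

lemma assoc_algebra_End_alg: "assoc_algebra K (End_alg K M)"
proof (rule assoc_algebra_bilinI[OF module_End_alg])
  show "bilin K (End_alg K M) (End_alg K M) (End_alg K M) (mult (End_alg K M))"
    by (rule bilinI)
       (auto simp: End_alg_carrier End_alg_closed End_alg_apply lin_hom_closed lin_hom_add lin_hom_smult
          intro!: End_alg_eqI)
qed (auto simp: End_alg_carrier End_alg_closed End_alg_apply lin_hom_closed intro!: End_alg_eqI)

text \<open>Subtraction in \<open>End_alg\<close> uses the additive inverse of the abstract group,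
  not a pointwise definition, so the difference is evaluated by adding \<open>g\<close>
  back.\<close>

lemma End_alg_minus_apply:
  assumes f: "f \<in> lin_hom K M M" and g: "g \<in> lin_hom K M M" and x: "x \<in> carrier M"
  shows "(f \<ominus>\<^bsub>End_alg K M\<^esub> g) x = f x \<ominus>\<^bsub>M\<^esub> g x"
proof -
  interpret E: assoc_algebra K "End_alg K M" by (rule assoc_algebra_End_alg)
  have fg: "f \<in> carrier (End_alg K M)" "g \<in> carrier (End_alg K M)" using f g by (auto simp: End_alg_carrier)
  then have d: "f \<ominus>\<^bsub>End_alg K M\<^esub> g \<in> lin_hom K M M" by (simp add: End_alg_carrier[symmetric])
  have "f = (f \<ominus>\<^bsub>End_alg K M\<^esub> g) \<oplus>\<^bsub>End_alg K M\<^esub> g"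
    using fg by (simp add: a_minus_def E.a_assoc E.l_neg)
  then have "f x = (f \<ominus>\<^bsub>End_alg K M\<^esub> g) x \<oplus>\<^bsub>M\<^esub> g x" using x by (metis End_alg_apply(2))
  then show ?thesis
    using x lin_hom_closed[OF g] lin_hom_closed[OF d]
    by (simp add: a_minus_def M.M.a_assoc M.M.r_neg)
qed

lemma End_alg_commutator_apply:
  assumes f: "f \<in> lin_hom K M M" and g: "g \<in> lin_hom K M M" and x: "x \<in> carrier M"
  shows "commutator (End_alg K M) f g x = f (g x) \<ominus>\<^bsub>M\<^esub> g (f x)"
  unfolding commutator_def using assms
  by (simp add: End_alg_minus_apply End_alg_closed End_alg_apply)

end

section \<open>Tensor products of algebras\<close>

context two_modules
begin

text \<open>Both sides are bilinear in \<open>s\<close> and \<open>t\<close>, hence determined by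
  pairs of pure tensors.\<close>

lemma mult_on_tensor:
  assumes P: "module K P" and \<mu>: "bilin K (tensor K M N) (tensor K M N) (tensor K M N) \<mu>"
    and \<nu>: "bilin K P P P \<nu>" and f: "f \<in> lin_hom K (tensor K M N) P"
    and eq: "\<And>m n m' n'. \<lbrakk>m \<in> carrier M; n \<in> carrier N; m' \<in> carrier M; n' \<in> carrier N\<rbrakk> \<Longrightarrow>
      f (\<mu> (tens K M N m n) (tens K M N m' n')) = \<nu> (f (tens K M N m n)) (f (tens K M N m' n'))"
    and s: "s \<in> carrier (tensor K M N)" and t: "t \<in> carrier (tensor K M N)"
  shows "f (\<mu> s t) = \<nu> (f s) (f t)"
  using s
proof (induction rule: tensor_induct)
  case (tens m n)
  show ?case using t
    by (induction rule: tensor_induct)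
       (use tens in \<open>auto simp: eq bilinD[OF \<mu>] bilinD[OF \<nu>] lin_hom_add[OF f] lin_hom_closed[OF f]\<close>)
next
  case (add r s)
  then show ?case
    using t by (simp add: bilinD[OF \<mu>] bilinD[OF \<nu>] lin_hom_add[OF f] lin_hom_closed[OF f])
qed

lemma assoc_algebra_tensorI:
  assumes \<mu>: "bilin K (tensor K M N) (tensor K M N) (tensor K M N) \<mu>"
    and e: "e \<in> carrier (tensor K M N)"
    and l_one: "\<And>m n. \<lbrakk>m \<in> carrier M; n \<in> carrier N\<rbrakk> \<Longrightarrow> \<mu> e (tens K M N m n) = tens K M N m n"
    and r_one: "\<And>m n. \<lbrakk>m \<in> carrier M; n \<in> carrier N\<rbrakk> \<Longrightarrow> \<mu> (tens K M N m n) e = tens K M N m n"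
    and assoc: "\<And>m n m' n' m'' n''. \<lbrakk>m \<in> carrier M; n \<in> carrier N; m' \<in> carrier M; n' \<in> carrier N;
        m'' \<in> carrier M; n'' \<in> carrier N\<rbrakk> \<Longrightarrow>
      \<mu> (\<mu> (tens K M N m n) (tens K M N m' n')) (tens K M N m'' n'') =
      \<mu> (tens K M N m n) (\<mu> (tens K M N m' n') (tens K M N m'' n''))"
  shows "assoc_algebra K ((tensor K M N)\<lparr>mult := \<mu>, one := e\<rparr>)" (is "assoc_algebra K ?R")
proof (rule assoc_algebra_bilinI)
  show "module K ?R"
    by (rule module_image[OF T.module_axioms, of "\<lambda>x. x"]) auto
  show "bilin K ?R ?R ?R (mult ?R)"
    using \<mu> by (simp add: bilin_def)
  note [simp] = bilinD[OF \<mu>]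
  fix x assume "x \<in> carrier ?R"
  then have x: "x \<in> carrier (tensor K M N)" by simp
  then show "\<one>\<^bsub>?R\<^esub> \<otimes>\<^bsub>?R\<^esub> x = x" "x \<otimes>\<^bsub>?R\<^esub> \<one>\<^bsub>?R\<^esub> = x"
    by (induction rule: tensor_induct) (auto simp: l_one r_one e)
  fix y z assume "y \<in> carrier ?R" "z \<in> carrier ?R"
  then have y: "y \<in> carrier (tensor K M N)" and z: "z \<in> carrier (tensor K M N)" by auto
  \<comment> \<open>Associativity is a trilinear identity; it spreads from pure tensors to arbitrary
    ones in the last argument, then in the middle one, then in the first.\<close>
  have 1: "\<mu> (\<mu> (tens K M N m n) (tens K M N m' n')) z = \<mu> (tens K M N m n) (\<mu> (tens K M N m' n') z)"
    if "m \<in> carrier M" "n \<in> carrier N" "m' \<in> carrier M" "n' \<in> carrier N" for m n m' n'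
    using z by (induction rule: tensor_induct) (use that in \<open>auto simp: assoc\<close>)
  have 2: "\<mu> (\<mu> (tens K M N m n) y) z = \<mu> (tens K M N m n) (\<mu> y z)"
    if "m \<in> carrier M" "n \<in> carrier N" for m n
    using y by (induction rule: tensor_induct) (use that z in \<open>auto simp: 1\<close>)
  have "\<mu> (\<mu> x y) z = \<mu> x (\<mu> y z)"
    using x by (induction rule: tensor_induct) (use y z in \<open>auto simp: 2\<close>)
  then show "x \<otimes>\<^bsub>?R\<^esub> y \<otimes>\<^bsub>?R\<^esub> z = x \<otimes>\<^bsub>?R\<^esub> (y \<otimes>\<^bsub>?R\<^esub> z)" by simp
qed (use e in simp)

end

locale two_algebras = R: assoc_algebra K R + S: assoc_algebra K S
  for K :: "'k ring" and R :: "('k, 'r) module" and S :: "('k, 's) module"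
begin

sublocale RS: two_modules K R S ..

lemma bilin_tens_mult_right:
  assumes "r \<in> carrier R" "s \<in> carrier S"
  shows "bilin K R S (tensor K R S) (\<lambda>r' s'. tens K R S (r \<otimes>\<^bsub>R\<^esub> r') (s \<otimes>\<^bsub>S\<^esub> s'))"
  by (rule bilinI)
     (use assms in \<open>auto simp: R.r_distr S.r_distr R.smult_mult_right S.smult_mult_right
       RS.tens_add_left RS.tens_add_right RS.tens_smult_left RS.tens_smult_right\<close>)

lemma bilin_tens_mult_left:
  assumes "r' \<in> carrier R" "s' \<in> carrier S"
  shows "bilin K R S (tensor K R S) (\<lambda>r s. tens K R S (r \<otimes>\<^bsub>R\<^esub> r') (s \<otimes>\<^bsub>S\<^esub> s'))"
  by (rule bilinI)
     (use assms in \<open>auto simp: R.l_distr S.l_distr R.smult_mult_left S.smult_mult_left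
       RS.tens_add_left RS.tens_add_right RS.tens_smult_left RS.tens_smult_right\<close>)

lemma tensor_alg_simps:
  "carrier (tensor_alg K R S) = carrier (tensor K R S)"
  "add (tensor_alg K R S) = add (tensor K R S)"
  "zero (tensor_alg K R S) = zero (tensor K R S)"
  "smult (tensor_alg K R S) = smult (tensor K R S)"
  "one (tensor_alg K R S) = tens K R S \<one>\<^bsub>R\<^esub> \<one>\<^bsub>S\<^esub>"
  by (simp_all add: tensor_alg_def)

lemma bilin_tensor_alg_mult:
  "bilin K (tensor K R S) (tensor K R S) (tensor K R S) (mult (tensor_alg K R S))"
  using bilin_nested_tensor_lift[OF RS.two_modules_axioms RS.two_modules_axioms RS.T.module_axioms
      bilin_tens_mult_right bilin_tens_mult_left]
  by (simp add: tensor_alg_def)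

lemma tensor_alg_mult:
  assumes "r \<in> carrier R" "s \<in> carrier S" "r' \<in> carrier R" "s' \<in> carrier S"
  shows "tens K R S r s \<otimes>\<^bsub>tensor_alg K R S\<^esub> tens K R S r' s' = tens K R S (r \<otimes>\<^bsub>R\<^esub> r') (s \<otimes>\<^bsub>S\<^esub> s')"
  using assms
  by (simp add: tensor_alg_def RS.tensor_lift_tens[OF RS.T.module_axioms]
      RS.bilin_tensor_lift[OF RS.T.module_axioms R.module_axioms S.module_axioms
        bilin_tens_mult_right bilin_tens_mult_left] bilin_tens_mult_right)

lemma assoc_algebra_tensor_alg: "assoc_algebra K (tensor_alg K R S)"
proof -
  have "tensor_alg K R S =
    (tensor K R S)\<lparr>mult := mult (tensor_alg K R S), one := tens K R S \<one>\<^bsub>R\<^esub> \<one>\<^bsub>S\<^esub>\<rparr>"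
    by (simp add: tensor_alg_def)
  moreover have "assoc_algebra K \<dots>"
    by (rule RS.assoc_algebra_tensorI[OF bilin_tensor_alg_mult])
       (auto simp: tensor_alg_mult R.m_assoc S.m_assoc)
  ultimately show ?thesis by simp
qed

end

section \<open>The free algebra\<close>

lemma free_alg_simps:
  "carrier (free_alg K S) = carrier (free_mod K (lists S))"
  "add (free_alg K S) = add (free_mod K (lists S))"
  "zero (free_alg K S) = zero (free_mod K (lists S))"
  "smult (free_alg K S) = smult (free_mod K (lists S))"
  "one (free_alg K S) = basis_elt K []"
  by (simp_all add: free_alg_def)

lemma free_alg_mult:
  "(f \<otimes>\<^bsub>free_alg K S\<^esub> g) w = (\<Oplus>\<^bsub>K\<^esub>i\<in>{..length w}. f (take i w) \<otimes>\<^bsub>K\<^esub> g (drop i w))"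
  by (simp add: free_alg_def)

lemma lin_hom_free_alg: "lin_hom K (free_alg K S) P = lin_hom K (free_mod K (lists S)) P"
  by (simp add: lin_hom_def free_alg_simps)

context
  fixes K :: "'k ring" and S :: "'p set"
  assumes cring: "cring K"
begin

interpretation K: cring K by (rule cring)

interpretation F0: module K "free_mod K (lists S)" by (rule module_free_mod[OF cring])

lemma module_free_alg: "module K (free_alg K S)"
  by (rule module_image[OF F0.module_axioms, of "\<lambda>x. x"]) (auto simp: free_alg_simps)

interpretation F: module K "free_alg K S" by (rule module_free_alg)

lemma word_closed [simp]: "set w \<subseteq> S \<Longrightarrow> basis_elt K w \<in> carrier (free_alg K S)"
  by (auto simp: free_alg_simps intro: basis_elt_closed[OF cring])

lemma free_alg_value_closed [simp]: "f \<in> carrier (free_alg K S) \<Longrightarrow> f w \<in> carrier K"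
  by (simp add: free_alg_simps free_mod_carrier)

lemma free_alg_mult_closed:
  assumes f: "f \<in> carrier (free_alg K S)" and g: "g \<in> carrier (free_alg K S)"
  shows "f \<otimes>\<^bsub>free_alg K S\<^esub> g \<in> carrier (free_alg K S)"
proof -
  let ?supp = "\<lambda>f. {w. f w \<noteq> \<zero>\<^bsub>K\<^esub>}"
  \<comment> \<open>A word that is no concatenation of two support words has a zero factor at every
    cut. The finite set of such concatenations therefore bounds the support of the product.\<close>
  have "w \<in> (\<lambda>(u, v). u @ v) ` (?supp f \<times> ?supp g)" if w: "(f \<otimes>\<^bsub>free_alg K S\<^esub> g) w \<noteq> \<zero>\<^bsub>K\<^esub>" for w
  proof (rule ccontr)
    assume *: "\<not> ?thesis"
    have "f (take i w) \<otimes>\<^bsub>K\<^esub> g (drop i w) = \<zero>\<^bsub>K\<^esub>" for i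
    proof -
      have "(take i w, drop i w) \<notin> ?supp f \<times> ?supp g"
        using * by (metis (no_types, lifting) append_take_drop_id case_prod_conv image_eqI)
      then show ?thesis using f g by auto
    qed
    then have "(f \<otimes>\<^bsub>free_alg K S\<^esub> g) w = \<zero>\<^bsub>K\<^esub>" by (simp add: free_alg_mult K.finsum_zero)
    with w show False by simp
  qed
  then have sub: "?supp (f \<otimes>\<^bsub>free_alg K S\<^esub> g) \<subseteq> (\<lambda>(u, v). u @ v) ` (?supp f \<times> ?supp g)" by blast
  moreover have "finite \<dots>" using f g by (auto simp: free_alg_simps free_mod_carrier)
  moreover have "(\<lambda>(u, v). u @ v) ` (?supp f \<times> ?supp g) \<subseteq> lists S"
  proof (rule image_subsetI)
    fix p assume p: "p \<in> ?supp f \<times> ?supp g"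
    have "?supp f \<subseteq> lists S" "?supp g \<subseteq> lists S"
      using f g by (auto simp: free_alg_simps free_mod_carrier)
    then have "fst p \<in> lists S" "snd p \<in> lists S" using p unfolding mem_Times_iff by blast+
    then show "(case p of (u, v) \<Rightarrow> u @ v) \<in> lists S" by (simp add: case_prod_unfold)
  qed
  moreover have "(f \<otimes>\<^bsub>free_alg K S\<^esub> g) w \<in> carrier K" for w
    using f g by (auto simp: free_alg_mult intro!: K.finsum_closed)
  ultimately show ?thesis
    by (auto simp: free_alg_simps(1) free_mod_carrier dest: finite_subset)
qed

lemma bilin_free_alg_mult: "bilin K (free_alg K S) (free_alg K S) (free_alg K S) (mult (free_alg K S))"
proof (rule bilinI)
  fix f g h c
  assume *: "f \<in> carrier (free_alg K S)" "g \<in> carrier (free_alg K S)"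
  {
    assume h: "h \<in> carrier (free_alg K S)"
    show "(f \<oplus>\<^bsub>free_alg K S\<^esub> g) \<otimes>\<^bsub>free_alg K S\<^esub> h =
        f \<otimes>\<^bsub>free_alg K S\<^esub> h \<oplus>\<^bsub>free_alg K S\<^esub> g \<otimes>\<^bsub>free_alg K S\<^esub> h"
      "f \<otimes>\<^bsub>free_alg K S\<^esub> (g \<oplus>\<^bsub>free_alg K S\<^esub> h) =
        f \<otimes>\<^bsub>free_alg K S\<^esub> g \<oplus>\<^bsub>free_alg K S\<^esub> f \<otimes>\<^bsub>free_alg K S\<^esub> h"
      using * h
      by (auto simp: free_alg_mult free_alg_simps(2) free_mod_simps K.l_distr K.r_distr fun_eq_iff
          intro!: K.finsum_addf)
  }
  {
    assume c: "c \<in> carrier K"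
    show "(c \<odot>\<^bsub>free_alg K S\<^esub> f) \<otimes>\<^bsub>free_alg K S\<^esub> g = c \<odot>\<^bsub>free_alg K S\<^esub> (f \<otimes>\<^bsub>free_alg K S\<^esub> g)"
      using * c
      by (auto simp: free_alg_mult free_alg_simps(4) free_mod_simps fun_eq_iff K.m_assoc
          intro!: K.finsum_rdistr[symmetric])
    show "f \<otimes>\<^bsub>free_alg K S\<^esub> (c \<odot>\<^bsub>free_alg K S\<^esub> g) = c \<odot>\<^bsub>free_alg K S\<^esub> (f \<otimes>\<^bsub>free_alg K S\<^esub> g)"
      using * c
      by (auto simp: free_alg_mult free_alg_simps(4) free_mod_simps fun_eq_iff K.m_lcomm
          intro!: K.finsum_rdistr[symmetric])
  }
qed (auto simp: free_alg_mult_closed)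

text \<open>Of all cuts of \<open>z\<close> only the one at position \<open>length v\<close> can
  contribute, since a prefix of any other length is not \<open>v\<close>. If \<open>z\<close> is too
  short for that cut, the sum is empty of nonzero terms and \<open>z\<close> differs from
  \<open>v @ w\<close>.\<close>

lemma word_mult: "basis_elt K v \<otimes>\<^bsub>free_alg K S\<^esub> basis_elt K w = basis_elt K (v @ w)"
proof
  fix z
  have "(basis_elt K v \<otimes>\<^bsub>free_alg K S\<^esub> basis_elt K w) z
      = (\<Oplus>\<^bsub>K\<^esub>i\<in>{..length z}. if length v = i then basis_elt K (v @ w) z else \<zero>\<^bsub>K\<^esub>)"
    unfolding free_alg_mult
  proof (rule K.finsum_cong')
    fix i assume "i \<in> {..length z}"
    then have "z = v @ w \<longleftrightarrow> take i z = v \<and> drop i z = w" if "length v = i"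
      using that by (metis append_eq_conv_conj)
    moreover have "take i z \<noteq> v" if "length v \<noteq> i" using that \<open>i \<in> {..length z}\<close> by auto
    ultimately show "basis_elt K v (take i z) \<otimes>\<^bsub>K\<^esub> basis_elt K w (drop i z)
        = (if length v = i then basis_elt K (v @ w) z else \<zero>\<^bsub>K\<^esub>)"
      by (auto simp: basis_elt_def)
  qed (auto simp: basis_elt_def)
  also have "\<dots> = basis_elt K (v @ w) z"
  proof (cases "z = v @ w")
    case True
    then show ?thesis
      by (subst K.finsum_singleton) (auto simp: basis_elt_def)
  next
    case False
    then show ?thesis by (simp add: basis_elt_def K.finsum_zero cong: if_cong)
  qed
  finally show "(basis_elt K v \<otimes>\<^bsub>free_alg K S\<^esub> basis_elt K w) z = basis_elt K (v @ w) z" .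
qed

end

lemma free_alg_induct [consumes 2, case_names word add smult]:
  assumes cring: "cring K" and f: "f \<in> carrier (free_alg K S)"
    and word: "\<And>w. set w \<subseteq> S \<Longrightarrow> P (basis_elt K w)"
    and add: "\<And>f g. \<lbrakk>f \<in> carrier (free_alg K S); g \<in> carrier (free_alg K S); P f; P g\<rbrakk> \<Longrightarrow>
      P (f \<oplus>\<^bsub>free_alg K S\<^esub> g)"
    and smult: "\<And>c f. \<lbrakk>c \<in> carrier K; f \<in> carrier (free_alg K S); P f\<rbrakk> \<Longrightarrow>
      P (c \<odot>\<^bsub>free_alg K S\<^esub> f)"
  shows "P f"
  using cring f[unfolded free_alg_simps]
proof (induction rule: free_mod_induct)
  case zero
  interpret F: module K "free_alg K S" by (rule module_free_alg[OF cring])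
  \<comment> \<open>Zero is presented as 0 times the empty word, which spares users of the rule a
    zero case.\<close>
  have "P (\<zero>\<^bsub>K\<^esub> \<odot>\<^bsub>free_alg K S\<^esub> basis_elt K [])"
    by (intro smult word word_closed[OF cring]) auto
  then show ?case
    using word_closed[OF cring, of "[]" S] by (simp add: free_alg_simps(3)[symmetric])
qed (use word add smult in \<open>auto simp: free_alg_simps in_lists_conv_set subset_iff\<close>)

context
  fixes K :: "'k ring" and S :: "'p set"
  assumes cring: "cring K"
begin

text \<open>On words, associativity is that of append; linearity in one argument at a time does the
  rest.\<close>

lemma assoc_algebra_free_alg: "assoc_algebra K (free_alg K S)"
proof (rule assoc_algebra_bilinI[OF module_free_alg[OF cring] bilin_free_alg_mult[OF cring]])
  note [simp] = bilinD[OF bilin_free_alg_mult[OF cring]] word_mult[OF cring] word_closed[OF cring]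
  show "\<one>\<^bsub>free_alg K S\<^esub> \<in> carrier (free_alg K S)" using word_closed[OF cring, of "[]"] by (simp add: free_alg_simps)
  have e: "\<one>\<^bsub>free_alg K S\<^esub> = basis_elt K []" by (simp add: free_alg_simps)
  have ec: "basis_elt K [] \<in> carrier (free_alg K S)" by simp
  fix f assume f: "f \<in> carrier (free_alg K S)"
  with cring show "\<one>\<^bsub>free_alg K S\<^esub> \<otimes>\<^bsub>free_alg K S\<^esub> f = f" "f \<otimes>\<^bsub>free_alg K S\<^esub> \<one>\<^bsub>free_alg K S\<^esub> = f"
    unfolding e by (induction rule: free_alg_induct) (auto simp: ec)
  fix g h assume g: "g \<in> carrier (free_alg K S)" and h: "h \<in> carrier (free_alg K S)"
  have 1: "(basis_elt K v \<otimes>\<^bsub>free_alg K S\<^esub> basis_elt K w) \<otimes>\<^bsub>free_alg K S\<^esub> h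
      = basis_elt K v \<otimes>\<^bsub>free_alg K S\<^esub> (basis_elt K w \<otimes>\<^bsub>free_alg K S\<^esub> h)"
    if "set v \<subseteq> S" "set w \<subseteq> S" for v w
    using cring h by (induction rule: free_alg_induct) (use that in auto)
  have 2: "(basis_elt K v \<otimes>\<^bsub>free_alg K S\<^esub> g) \<otimes>\<^bsub>free_alg K S\<^esub> h
      = basis_elt K v \<otimes>\<^bsub>free_alg K S\<^esub> (g \<otimes>\<^bsub>free_alg K S\<^esub> h)" if "set v \<subseteq> S" for v
    using cring g by (induction rule: free_alg_induct) (use that h 1 in \<open>auto simp del: word_mult[OF cring]\<close>)
  show "(f \<otimes>\<^bsub>free_alg K S\<^esub> g) \<otimes>\<^bsub>free_alg K S\<^esub> h = f \<otimes>\<^bsub>free_alg K S\<^esub> (g \<otimes>\<^bsub>free_alg K S\<^esub> h)"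
    using cring f by (induction rule: free_alg_induct) (use g h 2 in auto)
qed

lemma free_alg_lift:
  assumes R: "assoc_algebra K R" and b: "\<And>x. x \<in> S \<Longrightarrow> b x \<in> carrier R"
  obtains h where "h \<in> alg_hom K (free_alg K S) R" "\<And>x. x \<in> S \<Longrightarrow> h (basis_elt K [x]) = b x"
proof -
  interpret R: assoc_algebra K R by fact
  define p where "p w = foldr (\<lambda>x r. b x \<otimes>\<^bsub>R\<^esub> r) w \<one>\<^bsub>R\<^esub>" for w
  have p: "p w \<in> carrier R" if "set w \<subseteq> S" for w
    using that by (induction w) (auto simp: p_def b)
  have p_append: "p (v @ w) = p v \<otimes>\<^bsub>R\<^esub> p w" if "set v \<subseteq> S" "set w \<subseteq> S" for v w
    using that p by (induction v) (auto simp: p_def b R.m_assoc)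
  obtain h where h: "h \<in> lin_hom K (free_alg K S) R" and "\<And>w. w \<in> lists S \<Longrightarrow> h (basis_elt K w) = p w"
    by (rule free_mod_lift[OF cring R.module_axioms, of "lists S" p])
       (auto simp: lin_hom_free_alg in_lists_conv_set intro: p)
  then have hw: "h (basis_elt K w) = p w" if "set w \<subseteq> S" for w
    using that by (auto simp: in_lists_conv_set)
  note [simp] = bilinD[OF bilin_free_alg_mult[OF cring]] word_closed[OF cring] lin_hom_closed[OF h]
    lin_hom_add[OF h] lin_hom_smult[OF h]
  have "h \<in> alg_hom K (free_alg K S) R"
  proof (rule alg_homI[OF h])
    fix f g assume f: "f \<in> carrier (free_alg K S)" and g: "g \<in> carrier (free_alg K S)"
    have 1: "h (basis_elt K v \<otimes>\<^bsub>free_alg K S\<^esub> g) = h (basis_elt K v) \<otimes>\<^bsub>R\<^esub> h g" if "set v \<subseteq> S" for v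
      using cring g
      by (induction rule: free_alg_induct)
         (use that in \<open>auto simp: word_mult[OF cring] hw p p_append R.r_distr R.smult_mult_right\<close>)
    show "h (f \<otimes>\<^bsub>free_alg K S\<^esub> g) = h f \<otimes>\<^bsub>R\<^esub> h g"
      using cring f by (induction rule: free_alg_induct) (use g 1 in \<open>auto simp: R.l_distr R.smult_mult_left\<close>)
  qed (simp add: free_alg_simps hw, simp add: p_def)
  moreover have "h (basis_elt K [x]) = b x" if "x \<in> S" for x
    using that b by (simp add: hw) (simp add: p_def)
  ultimately show ?thesis by (rule that)
qed

end

section \<open>The universal enveloping algebra\<close>

context lie_algebra
begin

abbreviation "F \<equiv> free_alg K (carrier L)"
abbreviation "gen x \<equiv> basis_elt K [x]"

interpretation F: assoc_algebra K F by (rule assoc_algebra_free_alg) (rule R.is_cring)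

definition env_rels :: "('l list \<Rightarrow> 'k) set" where
  "env_rels =
      {gen (x \<oplus>\<^bsub>L\<^esub> y) \<ominus>\<^bsub>F\<^esub> (gen x \<oplus>\<^bsub>F\<^esub> gen y) | x y. x \<in> carrier L \<and> y \<in> carrier L}
    \<union> {gen (c \<odot>\<^bsub>L\<^esub> x) \<ominus>\<^bsub>F\<^esub> c \<odot>\<^bsub>F\<^esub> gen x | c x. c \<in> carrier K \<and> x \<in> carrier L}
    \<union> {commutator F (gen x) (gen y) \<ominus>\<^bsub>F\<^esub> gen (bracket L x y) | x y.
         x \<in> carrier L \<and> y \<in> carrier L}"

lemma env_ideal_eq: "env_ideal K L = Idl\<^bsub>F\<^esub> env_rels"
  by (simp add: env_ideal_def env_rels_def Let_def)

lemma gen_closed [simp]: "x \<in> carrier L \<Longrightarrow> gen x \<in> carrier F"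
  by (rule word_closed[OF R.is_cring]) simp

lemma env_rels_closed: "env_rels \<subseteq> carrier F"
  by (auto simp: env_rels_def commutator_def bracket_closed)

lemma ideal_env_ideal: "ideal (env_ideal K L) F"
  unfolding env_ideal_eq by (rule F.genideal_ideal[OF env_rels_closed])

lemma submodule_env_ideal: "submodule (env_ideal K L) K F"
proof -
  interpret I: ideal "env_ideal K L" F by (rule ideal_env_ideal)
  show ?thesis
  proof (rule F.submoduleI)
    fix c x assume c: "c \<in> carrier K" and x: "x \<in> env_ideal K L"
    have xc: "x \<in> carrier F" using x I.a_subset by blast
    \<comment> \<open>An ideal absorbs ring multiplication; the scalar \<open>c\<close> acts as
      multiplication by \<open>c\<close> times the unit, which gives closure under scalars.\<close>
    have "(c \<odot>\<^bsub>F\<^esub> \<one>\<^bsub>F\<^esub>) \<otimes>\<^bsub>F\<^esub> x \<in> env_ideal K L" using c x by (intro I.I_l_closed) auto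
    then show "c \<odot>\<^bsub>F\<^esub> x \<in> env_ideal K L" using c xc by (simp add: F.smult_mult_left)
  qed (use I.a_subset in auto)
qed

lemmas env_quot = F.module_axioms submodule_env_ideal

sublocale U: assoc_algebra K "env K L"
  unfolding env_def
  by (rule assoc_algebra_quot_mod[OF env_quot F.assoc_algebra_axioms ideal_env_ideal])

definition env_proj :: "('l list \<Rightarrow> 'k) \<Rightarrow> ('k, 'l) env" where
  "env_proj = (\<lambda>f\<in>carrier F. env_ideal K L +>\<^bsub>F\<^esub> f)"

lemma env_proj_alg_hom: "env_proj \<in> alg_hom K F (env K L)"
proof (rule alg_homI)
  show "env_proj \<in> lin_hom K F (env K L)"
    unfolding env_proj_def
    by (rule lin_hom_restrictI[OF F.module_axioms])
       (auto simp: env_def quot_mod_carrier[OF env_quot] quot_mod_add[OF env_quot]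
          quot_mod_smult[OF env_quot])
qed (auto simp: env_def env_proj_def quot_mod_one[OF env_quot] quot_mod_mult[OF env_quot ideal_env_ideal])

lemma env_proj_surj: "u \<in> carrier (env K L) \<Longrightarrow> \<exists>f\<in>carrier F. u = env_proj f"
  by (auto simp: env_def quot_mod_carrier[OF env_quot] env_proj_def)

lemma env_incl_proj: "x \<in> carrier L \<Longrightarrow> env_incl K L x = env_proj (gen x)"
  by (simp add: env_incl_def env_proj_def)

lemma env_incl_closed [simp, intro]: "x \<in> carrier L \<Longrightarrow> env_incl K L x \<in> carrier (env K L)"
  by (simp add: env_incl_proj alg_hom_closed[OF env_proj_alg_hom])

lemma env_proj_eqI:
  assumes "f \<in> carrier F" "g \<in> carrier F" "f \<ominus>\<^bsub>F\<^esub> g \<in> env_rels"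
  shows "env_proj f = env_proj g"
proof -
  have "f \<ominus>\<^bsub>F\<^esub> g \<in> env_ideal K L"
    using F.genideal_self[OF env_rels_closed] assms(3) by (auto simp: env_ideal_eq)
  then show ?thesis using assms(1,2) by (simp add: env_proj_def coset_eq_iff[OF env_quot])
qed

lemma env_incl_add:
  assumes "x \<in> carrier L" "y \<in> carrier L"
  shows "env_incl K L (x \<oplus>\<^bsub>L\<^esub> y) = env_incl K L x \<oplus>\<^bsub>env K L\<^esub> env_incl K L y"
proof -
  have "env_proj (gen (x \<oplus>\<^bsub>L\<^esub> y)) = env_proj (gen x \<oplus>\<^bsub>F\<^esub> gen y)"
  proof (rule env_proj_eqI)
    show "gen (x \<oplus>\<^bsub>L\<^esub> y) \<ominus>\<^bsub>F\<^esub> (gen x \<oplus>\<^bsub>F\<^esub> gen y) \<in> env_rels"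
      using assms unfolding env_rels_def by blast
  qed (use assms in auto)
  then show ?thesis using assms by (simp add: env_incl_proj alg_hom_add[OF env_proj_alg_hom])
qed

lemma env_incl_smult:
  assumes "c \<in> carrier K" "x \<in> carrier L"
  shows "env_incl K L (c \<odot>\<^bsub>L\<^esub> x) = c \<odot>\<^bsub>env K L\<^esub> env_incl K L x"
proof -
  have "env_proj (gen (c \<odot>\<^bsub>L\<^esub> x)) = env_proj (c \<odot>\<^bsub>F\<^esub> gen x)"
  proof (rule env_proj_eqI)
    show "gen (c \<odot>\<^bsub>L\<^esub> x) \<ominus>\<^bsub>F\<^esub> c \<odot>\<^bsub>F\<^esub> gen x \<in> env_rels"
      using assms unfolding env_rels_def by blast
  qed (use assms in auto)
  then show ?thesis using assms by (simp add: env_incl_proj alg_hom_smult[OF env_proj_alg_hom])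
qed

lemma env_incl_bracket:
  assumes "x \<in> carrier L" "y \<in> carrier L"
  shows "env_incl K L (bracket L x y) = commutator (env K L) (env_incl K L x) (env_incl K L y)"
proof -
  have "env_proj (commutator F (gen x) (gen y)) = env_proj (gen (bracket L x y))"
  proof (rule env_proj_eqI)
    show "commutator F (gen x) (gen y) \<ominus>\<^bsub>F\<^esub> gen (bracket L x y) \<in> env_rels"
      using assms unfolding env_rels_def by blast
  qed (use assms bracket_closed in \<open>auto simp: commutator_def\<close>)
  then show ?thesis
    using assms bracket_closed
    by (simp add: env_incl_proj
        alg_hom_commutator[OF F.assoc_algebra_axioms U.assoc_algebra_axioms env_proj_alg_hom])
qed

text \<open>A word arises from the empty one by putting letters in front, so the enveloping algebra
  is spanned by what left multiplication by generators makes from 1. The one-sided product case lets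
  a fact about a single element of \<open>L\<close> drive the induction.\<close>

lemma env_induct [consumes 1, case_names one mult add smult]:
  assumes u: "u \<in> carrier (env K L)"
    and one: "P \<one>\<^bsub>env K L\<^esub>"
    and mult: "\<And>x u. \<lbrakk>x \<in> carrier L; u \<in> carrier (env K L); P u\<rbrakk> \<Longrightarrow>
      P (env_incl K L x \<otimes>\<^bsub>env K L\<^esub> u)"
    and add: "\<And>u v. \<lbrakk>u \<in> carrier (env K L); v \<in> carrier (env K L); P u; P v\<rbrakk> \<Longrightarrow>
      P (u \<oplus>\<^bsub>env K L\<^esub> v)"
    and smult: "\<And>c u. \<lbrakk>c \<in> carrier K; u \<in> carrier (env K L); P u\<rbrakk> \<Longrightarrow> P (c \<odot>\<^bsub>env K L\<^esub> u)"
  shows "P u"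
proof -
  note hom = env_proj_alg_hom
  obtain f where f: "f \<in> carrier F" "u = env_proj f" using env_proj_surj[OF u] by blast
  have "P (env_proj f)" using R.is_cring f(1)
  proof (induction rule: free_alg_induct)
    case (word w)
    then show ?case
    proof (induction w)
      case Nil
      then show ?case using one alg_hom_one[OF hom] by (simp add: free_alg_simps)
    next
      case (Cons x w)
      then have c: "x \<in> carrier L" "basis_elt K w \<in> carrier F" by (auto intro: word_closed[OF R.is_cring])
      have "basis_elt K (x # w) = gen x \<otimes>\<^bsub>F\<^esub> basis_elt K w"
        using word_mult[OF R.is_cring, of "carrier L" "[x]" w] by simp
      then have "env_proj (basis_elt K (x # w)) = env_incl K L x \<otimes>\<^bsub>env K L\<^esub> env_proj (basis_elt K w)"
        using c by (simp add: env_incl_proj alg_hom_mult[OF hom])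
      then show ?case using Cons c mult alg_hom_closed[OF hom] by auto
    qed
  qed (auto simp: alg_hom_add[OF hom] alg_hom_smult[OF hom] intro!: add smult alg_hom_closed[OF hom])
  then show ?thesis using f(2) by simp
qed

lemma env_hom_ext:
  assumes h: "h \<in> alg_hom K (env K L) S" and g: "g \<in> alg_hom K (env K L) S"
    and eq: "\<And>x. x \<in> carrier L \<Longrightarrow> h (env_incl K L x) = g (env_incl K L x)"
  shows "h = g"
proof (rule lin_hom_ext[OF alg_hom_lin[OF h] alg_hom_lin[OF g]])
  fix u assume "u \<in> carrier (env K L)"
  then show "h u = g u"
    by (induction rule: env_induct)
       (auto simp: eq alg_hom_one[OF h] alg_hom_one[OF g] alg_hom_mult[OF h] alg_hom_mult[OF g]
          alg_hom_add[OF h] alg_hom_add[OF g] alg_hom_smult[OF h] alg_hom_smult[OF g])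
qed

lemma env_lift_eqI:
  assumes h: "h \<in> alg_hom K (env K L) S" and eq: "\<And>x. x \<in> carrier L \<Longrightarrow> h (env_incl K L x) = f x"
  shows "env_lift K L S f = h"
  unfolding env_lift_def
proof (rule the_equality)
  fix g assume g: "g \<in> alg_hom K (env K L) S \<and> (\<forall>x\<in>carrier L. g (env_incl K L x) = f x)"
  show "g = h" by (rule env_hom_ext[OF g[THEN conjunct1] h]) (use g eq in auto)
qed (use assms in auto)

text \<open>A Lie morphism from \<open>L\<close> to \<open>S\<close> under the commutator bracket,
  spelled out so that \<open>S\<close> need not be repackaged as a \<open>lie_alg\<close> and
  \<open>f\<close> need not be extensional.\<close>

definition lie_rep :: "('k, 's) module \<Rightarrow> ('l \<Rightarrow> 's) \<Rightarrow> bool" where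
  "lie_rep S f \<longleftrightarrow>
     (\<forall>x\<in>carrier L. f x \<in> carrier S) \<and>
     (\<forall>x\<in>carrier L. \<forall>y\<in>carrier L. f (x \<oplus>\<^bsub>L\<^esub> y) = f x \<oplus>\<^bsub>S\<^esub> f y) \<and>
     (\<forall>c\<in>carrier K. \<forall>x\<in>carrier L. f (c \<odot>\<^bsub>L\<^esub> x) = c \<odot>\<^bsub>S\<^esub> f x) \<and>
     (\<forall>x\<in>carrier L. \<forall>y\<in>carrier L. f (bracket L x y) = commutator S (f x) (f y))"

lemma env_lift_ex:
  assumes S: "assoc_algebra K S" and f: "lie_rep S f"
  obtains h where "h \<in> alg_hom K (env K L) S" "\<And>x. x \<in> carrier L \<Longrightarrow> h (env_incl K L x) = f x"
proof -
  interpret S: assoc_algebra K S by fact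
  obtain h where h: "h \<in> alg_hom K F S" and hx: "\<And>x. x \<in> carrier L \<Longrightarrow> h (gen x) = f x"
    by (rule free_alg_lift[OF R.is_cring S, of "carrier L" f]) (use f in \<open>auto simp: lie_rep_def\<close>)
  note lin = alg_hom_lin[OF h]
  note zero = lin_hom_zero[OF F.module_axioms S.module_axioms lin]
  note uminus = lin_hom_uminus[OF F.module_axioms S.module_axioms lin]
  note minus = lin_hom_minus[OF F.module_axioms S.module_axioms lin]
  interpret ker: submodule "{x \<in> carrier F. h x = \<zero>\<^bsub>S\<^esub>}" K F
    by (rule submodule_ker[OF F.module_axioms S.module_axioms lin])
  \<comment> \<open>The kernel of an algebra map is an ideal, so it contains the generated ideal as
    soon as the three families of relations hold in \<open>S\<close>; \<open>lie_rep\<close>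
    provides one law for each family.\<close>
  have "ideal {x \<in> carrier F. h x = \<zero>\<^bsub>S\<^esub>} F"
    by (rule idealI[OF F.ring_axioms ker.subgroup_axioms]) (auto simp: alg_hom_mult[OF h] alg_hom_closed[OF h])
  moreover have "env_rels \<subseteq> {x \<in> carrier F. h x = \<zero>\<^bsub>S\<^esub>}"
    using f bracket_closed
    by (auto simp: env_rels_def minus alg_hom_add[OF h] alg_hom_smult[OF h] hx lie_rep_def alg_hom_mult[OF h]
        alg_hom_commutator[OF F.assoc_algebra_axioms S h] S.r_neg a_minus_def[of S] commutator_def)
  ultimately have "env_ideal K L \<subseteq> {x \<in> carrier F. h x = \<zero>\<^bsub>S\<^esub>}"
    unfolding env_ideal_eq by (rule F.genideal_minimal)
  then have "\<And>x. x \<in> env_ideal K L \<Longrightarrow> h x = \<zero>\<^bsub>S\<^esub>" by blast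
  from quot_mod_lift[OF env_quot S.module_axioms lin this, folded env_def]
  obtain g where g: "g \<in> lin_hom K (env K L) S"
    and gx: "\<And>x. x \<in> carrier F \<Longrightarrow> g (env_ideal K L +>\<^bsub>F\<^esub> x) = h x" by blast
  then have gp: "g (env_proj x) = h x" if "x \<in> carrier F" for x using that by (simp add: env_proj_def)
  have "g \<in> alg_hom K (env K L) S"
  proof (rule alg_homI[OF g])
    fix u v assume "u \<in> carrier (env K L)" "v \<in> carrier (env K L)"
    then obtain x y where "x \<in> carrier F" "u = env_proj x" "y \<in> carrier F" "v = env_proj y"
      using env_proj_surj by blast
    then show "g (u \<otimes>\<^bsub>env K L\<^esub> v) = g u \<otimes>\<^bsub>S\<^esub> g v"
      by (simp add: alg_hom_mult[OF env_proj_alg_hom, symmetric] gp alg_hom_mult[OF h])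
  next
    show "g \<one>\<^bsub>env K L\<^esub> = \<one>\<^bsub>S\<^esub>"
      using gp[OF F.one_closed] alg_hom_one[OF h] alg_hom_one[OF env_proj_alg_hom] by simp
  qed
  then show ?thesis
    by (rule that) (simp add: env_incl_proj gp hx)
qed

lemma
  assumes "assoc_algebra K S" "lie_rep S f"
  shows env_lift_alg_hom: "env_lift K L S f \<in> alg_hom K (env K L) S"
    and env_lift_incl: "\<And>x. x \<in> carrier L \<Longrightarrow> env_lift K L S f (env_incl K L x) = f x"
proof -
  obtain h where h: "h \<in> alg_hom K (env K L) S" "\<And>x. x \<in> carrier L \<Longrightarrow> h (env_incl K L x) = f x"
    using env_lift_ex[OF assms] by blast
  then have "env_lift K L S f = h" by (rule env_lift_eqI)
  with h show "env_lift K L S f \<in> alg_hom K (env K L) S"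
    "\<And>x. x \<in> carrier L \<Longrightarrow> env_lift K L S f (env_incl K L x) = f x" by auto
qed

end

section \<open>Commutators and derivations\<close>

context assoc_algebra
begin

lemma commutator_closed [simp]:
  "\<lbrakk>x \<in> carrier R; y \<in> carrier R\<rbrakk> \<Longrightarrow> commutator R x y \<in> carrier R"
  by (simp add: commutator_def)

lemma commutator_add_left:
  "\<lbrakk>x \<in> carrier R; y \<in> carrier R; z \<in> carrier R\<rbrakk> \<Longrightarrow>
    commutator R (x \<oplus>\<^bsub>R\<^esub> y) z = commutator R x z \<oplus>\<^bsub>R\<^esub> commutator R y z"
  unfolding commutator_def by algebra

lemma commutator_add_right:
  "\<lbrakk>x \<in> carrier R; y \<in> carrier R; z \<in> carrier R\<rbrakk> \<Longrightarrow>
    commutator R x (y \<oplus>\<^bsub>R\<^esub> z) = commutator R x y \<oplus>\<^bsub>R\<^esub> commutator R x z"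
  unfolding commutator_def by algebra

lemma commutator_smult_left:
  "\<lbrakk>c \<in> carrier K; x \<in> carrier R; y \<in> carrier R\<rbrakk> \<Longrightarrow>
    commutator R (c \<odot>\<^bsub>R\<^esub> x) y = c \<odot>\<^bsub>R\<^esub> commutator R x y"
  by (simp add: commutator_def smult_mult_left smult_mult_right smult_r_distr smult_r_minus a_minus_def)

lemma commutator_smult_right:
  "\<lbrakk>c \<in> carrier K; x \<in> carrier R; y \<in> carrier R\<rbrakk> \<Longrightarrow>
    commutator R x (c \<odot>\<^bsub>R\<^esub> y) = c \<odot>\<^bsub>R\<^esub> commutator R x y"
  by (simp add: commutator_def smult_mult_left smult_mult_right smult_r_distr smult_r_minus a_minus_def)

lemma commutator_self: "x \<in> carrier R \<Longrightarrow> commutator R x x = \<zero>\<^bsub>R\<^esub>"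
  unfolding commutator_def by algebra

lemma commutator_jacobi:
  "\<lbrakk>x \<in> carrier R; y \<in> carrier R; z \<in> carrier R\<rbrakk> \<Longrightarrow>
    commutator R x (commutator R y z) \<oplus>\<^bsub>R\<^esub> commutator R y (commutator R z x)
      \<oplus>\<^bsub>R\<^esub> commutator R z (commutator R x y) = \<zero>\<^bsub>R\<^esub>"
  unfolding commutator_def by algebra

lemma commutator_commuting:
  "\<lbrakk>x \<in> carrier R; y \<in> carrier R; x \<otimes>\<^bsub>R\<^esub> y = y \<otimes>\<^bsub>R\<^esub> x\<rbrakk> \<Longrightarrow> commutator R x y = \<zero>\<^bsub>R\<^esub>"
  by (simp add: commutator_def a_minus_def r_neg)

text \<open>Exchanges the bracket condition in the carrier of \<open>L_alg\<close> for the
  subtraction-free form in which \<open>smash_incl_mult\<close> and the extension of maps to the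
  smash product are stated.\<close>

lemma commutator_eq_iff:
  assumes "x \<in> carrier R" "y \<in> carrier R" "z \<in> carrier R"
  shows "commutator R x y = z \<longleftrightarrow> x \<otimes>\<^bsub>R\<^esub> y = z \<oplus>\<^bsub>R\<^esub> y \<otimes>\<^bsub>R\<^esub> x"
proof
  assume "commutator R x y = z"
  then show "x \<otimes>\<^bsub>R\<^esub> y = z \<oplus>\<^bsub>R\<^esub> y \<otimes>\<^bsub>R\<^esub> x"
    using assms by (auto simp: commutator_def a_minus_def a_assoc l_neg)
next
  assume "x \<otimes>\<^bsub>R\<^esub> y = z \<oplus>\<^bsub>R\<^esub> y \<otimes>\<^bsub>R\<^esub> x"
  then show "commutator R x y = z"
    using assms by (simp add: commutator_def a_minus_def a_assoc r_neg)
qed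

end

lemma Der_simps:
  "add (Der K A) = add (End_alg K A)"
  "zero (Der K A) = zero (End_alg K A)"
  "smult (Der K A) = smult (End_alg K A)"
  "bracket (Der K A) = commutator (End_alg K A)"
  by (simp_all add: Der_def module.defs lie_alg.defs)

lemma Der_carrier:
  "\<delta> \<in> carrier (Der K A) \<longleftrightarrow> \<delta> \<in> lin_hom K A A \<and> (\<forall>a\<in>carrier A. \<forall>b\<in>carrier A.
    \<delta> (a \<otimes>\<^bsub>A\<^esub> b) = \<delta> a \<otimes>\<^bsub>A\<^esub> b \<oplus>\<^bsub>A\<^esub> a \<otimes>\<^bsub>A\<^esub> \<delta> b)"
  by (simp add: Der_def module.defs lie_alg.defs)

lemma Der_lin: "\<delta> \<in> carrier (Der K A) \<Longrightarrow> \<delta> \<in> lin_hom K A A"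
  by (simp add: Der_carrier)

lemma Der_leibniz:
  "\<lbrakk>\<delta> \<in> carrier (Der K A); a \<in> carrier A; b \<in> carrier A\<rbrakk> \<Longrightarrow>
    \<delta> (a \<otimes>\<^bsub>A\<^esub> b) = \<delta> a \<otimes>\<^bsub>A\<^esub> b \<oplus>\<^bsub>A\<^esub> a \<otimes>\<^bsub>A\<^esub> \<delta> b"
  by (simp add: Der_carrier)

text \<open>The Leibniz rule at 1 = 1 * 1 makes this value equal to its own double.\<close>

lemma Der_one:
  assumes "assoc_algebra K A" "\<delta> \<in> carrier (Der K A)"
  shows "\<delta> \<one>\<^bsub>A\<^esub> = \<zero>\<^bsub>A\<^esub>"
proof -
  interpret A: assoc_algebra K A by fact
  have c: "\<delta> \<one>\<^bsub>A\<^esub> \<in> carrier A" using lin_hom_closed[OF Der_lin[OF assms(2)]] by simp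
  have "\<delta> \<one>\<^bsub>A\<^esub> = \<delta> \<one>\<^bsub>A\<^esub> \<oplus>\<^bsub>A\<^esub> \<delta> \<one>\<^bsub>A\<^esub>"
    using Der_leibniz[OF assms(2) A.one_closed A.one_closed] c by simp
  then show ?thesis using c by (metis A.add.r_cancel_one')
qed

context assoc_algebra
begin

text \<open>The Jacobi identity in adjoint form: bracketing with a commutator is the commutator of
  the two bracketings. With \<open>z\<close> in the image of \<open>A\<close> it shows that
  \<open>L_alg\<close> is closed under brackets.\<close>

lemma commutator_commutator:
  "\<lbrakk>x \<in> carrier R; y \<in> carrier R; z \<in> carrier R\<rbrakk> \<Longrightarrow>
    commutator R (commutator R x y) z =
      commutator R x (commutator R y z) \<ominus>\<^bsub>R\<^esub> commutator R y (commutator R x z)"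
  unfolding commutator_def by algebra

text \<open>The operations of \<open>Der\<close> are those of \<open>End_alg\<close>, so its vector
  space laws follow from closure alone.\<close>

lemma submodule_Der: "submodule (carrier (Der K R)) K (End_alg K R)"
proof -
  interpret E: assoc_algebra K "End_alg K R" by (rule assoc_algebra_End_alg[OF module_axioms])
  note E = End_alg_carrier[OF module_axioms] End_alg_closed[OF module_axioms] End_alg_apply[OF module_axioms]
  have smult: "c \<odot>\<^bsub>End_alg K R\<^esub> \<delta> \<in> carrier (Der K R)"
    if c: "c \<in> carrier K" and d: "\<delta> \<in> carrier (Der K R)" for c \<delta>
    using c lin_hom_closed[OF Der_lin[OF d]] Der_leibniz[OF d]
    by (simp add: Der_carrier E Der_lin[OF d] smult_mult_left smult_mult_right smult_r_distr)
  show ?thesis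
  proof (rule E.submoduleI)
    show "carrier (Der K R) \<subseteq> carrier (End_alg K R)" by (auto simp: Der_carrier E)
    show "\<zero>\<^bsub>End_alg K R\<^esub> \<in> carrier (Der K R)" by (auto simp: Der_carrier E)
    show "c \<odot>\<^bsub>End_alg K R\<^esub> \<delta> \<in> carrier (Der K R)"
      if "c \<in> carrier K" "\<delta> \<in> carrier (Der K R)" for c \<delta> using that by (rule smult)
    show "\<ominus>\<^bsub>End_alg K R\<^esub> \<delta> \<in> carrier (Der K R)" if d: "\<delta> \<in> carrier (Der K R)" for \<delta>
      using smult[OF _ d, of "\<ominus>\<^bsub>K\<^esub> \<one>\<^bsub>K\<^esub>"] Der_lin[OF d] by (simp add: E.smult_l_minus E)
    fix \<delta> \<epsilon> assume d: "\<delta> \<in> carrier (Der K R)" and e: "\<epsilon> \<in> carrier (Der K R)"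
    show "\<delta> \<oplus>\<^bsub>End_alg K R\<^esub> \<epsilon> \<in> carrier (Der K R)"
      using lin_hom_closed[OF Der_lin[OF d]] Der_leibniz[OF d] lin_hom_closed[OF Der_lin[OF e]] Der_leibniz[OF e]
      by (simp add: Der_carrier E Der_lin[OF d] Der_lin[OF e] l_distr r_distr a_ac)
  qed
qed

lemma module_Der: "module K (Der K R)"
proof (rule module_image[where q = "\<lambda>x. x"])
  show "module K ((End_alg K R)\<lparr>carrier := carrier (Der K R)\<rparr>)"
    by (rule submodule.submodule_is_module[OF submodule_Der module_End_alg[OF module_axioms]])
qed (auto simp: Der_simps)

text \<open>For derivations \<delta> and \<epsilon>, read \<open>p\<close>, \<open>p'\<close> as
  \<delta>(\<epsilon> a), \<epsilon>(\<delta> a), \<open>q\<close>, \<open>t\<close> as \<epsilon>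
  a, \<delta> a, \<open>s\<close>, \<open>r\<close> as \<delta> b, \<epsilon> b, and
  \<open>u\<close>, \<open>u'\<close> as \<delta>(\<epsilon> b), \<epsilon>(\<delta> b). The mixed
  products of \<open>q\<close> with \<open>s\<close> and of \<open>t\<close> with \<open>r\<close>
  occur in both expansions of a product and cancel.\<close>

lemma cross_terms_cancel:
  "\<lbrakk>a \<in> carrier R; b \<in> carrier R; p \<in> carrier R; p' \<in> carrier R; q \<in> carrier R; s \<in> carrier R;
    t \<in> carrier R; r \<in> carrier R; u \<in> carrier R; u' \<in> carrier R\<rbrakk> \<Longrightarrow>
    p \<otimes>\<^bsub>R\<^esub> b \<oplus>\<^bsub>R\<^esub> q \<otimes>\<^bsub>R\<^esub> s \<oplus>\<^bsub>R\<^esub> (t \<otimes>\<^bsub>R\<^esub> r \<oplus>\<^bsub>R\<^esub> a \<otimes>\<^bsub>R\<^esub> u)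
      \<ominus>\<^bsub>R\<^esub> (p' \<otimes>\<^bsub>R\<^esub> b \<oplus>\<^bsub>R\<^esub> t \<otimes>\<^bsub>R\<^esub> r \<oplus>\<^bsub>R\<^esub> (q \<otimes>\<^bsub>R\<^esub> s \<oplus>\<^bsub>R\<^esub> a \<otimes>\<^bsub>R\<^esub> u')) =
    (p \<ominus>\<^bsub>R\<^esub> p') \<otimes>\<^bsub>R\<^esub> b \<oplus>\<^bsub>R\<^esub> a \<otimes>\<^bsub>R\<^esub> (u \<ominus>\<^bsub>R\<^esub> u')"
  by algebra

lemma Der_bracket_closed:
  assumes d: "\<delta> \<in> carrier (Der K R)" and e: "\<epsilon> \<in> carrier (Der K R)"
  shows "commutator (End_alg K R) \<delta> \<epsilon> \<in> carrier (Der K R)"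
proof -
  interpret E: assoc_algebra K "End_alg K R" by (rule assoc_algebra_End_alg[OF module_axioms])
  note lin = Der_lin[OF d] Der_lin[OF e]
  note [simp] = lin_hom_closed[OF lin(1)] lin_hom_closed[OF lin(2)]
  show ?thesis
    unfolding Der_carrier
  proof (intro conjI ballI)
    show "commutator (End_alg K R) \<delta> \<epsilon> \<in> lin_hom K R R"
      using E.commutator_closed lin by (simp add: End_alg_carrier[OF module_axioms])
    fix a b assume "a \<in> carrier R" "b \<in> carrier R"
    then show "commutator (End_alg K R) \<delta> \<epsilon> (a \<otimes>\<^bsub>R\<^esub> b) =
        commutator (End_alg K R) \<delta> \<epsilon> a \<otimes>\<^bsub>R\<^esub> b \<oplus>\<^bsub>R\<^esub> a \<otimes>\<^bsub>R\<^esub> commutator (End_alg K R) \<delta> \<epsilon> b"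
      by (simp add: End_alg_commutator_apply[OF module_axioms lin] Der_leibniz[OF d] Der_leibniz[OF e]
          lin_hom_add[OF lin(1)] lin_hom_add[OF lin(2)] cross_terms_cancel)
  qed
qed

end

section \<open>The comultiplication\<close>

context lie_algebra
begin

sublocale UU: two_algebras K "env K L" "env K L" ..

abbreviation "prim x \<equiv> tens K (env K L) (env K L) (env_incl K L x) \<one>\<^bsub>env K L\<^esub>
  \<oplus>\<^bsub>tensor_alg K (env K L) (env K L)\<^esub> tens K (env K L) (env K L) \<one>\<^bsub>env K L\<^esub> (env_incl K L x)"

text \<open>An element of the first tensor factor commutes with one of the second, so the mixed
  commutators vanish and the bracket of two primitive elements is computed in each factor
  separately.\<close>

lemma lie_rep_prim: "lie_rep (tensor_alg K (env K L) (env K L)) prim"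
proof -
  let ?U = "env K L" and ?T = "tensor_alg K (env K L) (env K L)"
  let ?l = "\<lambda>x. tens K ?U ?U (env_incl K L x) \<one>\<^bsub>?U\<^esub>"
  let ?r = "\<lambda>x. tens K ?U ?U \<one>\<^bsub>?U\<^esub> (env_incl K L x)"
  interpret T: assoc_algebra K ?T by (rule UU.assoc_algebra_tensor_alg)
  have cl: "?l x \<in> carrier ?T" "?r x \<in> carrier ?T" if "x \<in> carrier L" for x
    using that by (auto simp: UU.tensor_alg_simps)
  have l: "?l (x \<oplus>\<^bsub>L\<^esub> y) = ?l x \<oplus>\<^bsub>?T\<^esub> ?l y" and r: "?r (x \<oplus>\<^bsub>L\<^esub> y) = ?r x \<oplus>\<^bsub>?T\<^esub> ?r y"
    if "x \<in> carrier L" "y \<in> carrier L" for x y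
    using that by (auto simp: UU.tensor_alg_simps env_incl_add UU.RS.tens_add_left UU.RS.tens_add_right)
  have lc: "?l (c \<odot>\<^bsub>L\<^esub> x) = c \<odot>\<^bsub>?T\<^esub> ?l x" and rc: "?r (c \<odot>\<^bsub>L\<^esub> x) = c \<odot>\<^bsub>?T\<^esub> ?r x"
    if "x \<in> carrier L" "c \<in> carrier K" for x c
    using that by (auto simp: UU.tensor_alg_simps env_incl_smult UU.RS.tens_smult_left UU.RS.tens_smult_right)
  \<comment> \<open>Retargeted from the module to the algebra record, because the subtraction inside
    \<open>commutator\<close> is that of the algebra.\<close>
  have bilin: "bilin K ?U ?U ?T (tens K ?U ?U)"
    using UU.RS.bilin_tens by (simp add: bilin_def UU.tensor_alg_simps)
  have com: "commutator ?T (prim x) (prim y) = prim (bracket L x y)"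
    if xy: "x \<in> carrier L" "y \<in> carrier L" for x y
  proof -
    have "commutator ?T (?l x) (?r y) = \<zero>\<^bsub>?T\<^esub>" "commutator ?T (?r x) (?l y) = \<zero>\<^bsub>?T\<^esub>"
      using xy by (intro T.commutator_commuting; auto simp: cl UU.tensor_alg_mult)+
    moreover have "?l (bracket L x y) = commutator ?T (?l x) (?l y)"
      using xy bilin_minus_left[OF U.module_axioms T.module_axioms bilin, of _ _ "\<one>\<^bsub>?U\<^esub>"]
      by (simp add: env_incl_bracket commutator_def UU.tensor_alg_mult)
    moreover have "?r (bracket L x y) = commutator ?T (?r x) (?r y)"
      using xy bilin_minus_right[OF U.module_axioms T.module_axioms bilin, of "\<one>\<^bsub>?U\<^esub>"]
      by (simp add: env_incl_bracket commutator_def UU.tensor_alg_mult)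
    ultimately show ?thesis
      using xy by (simp add: cl T.commutator_add_left T.commutator_add_right)
  qed
  show ?thesis
    unfolding lie_rep_def using com
    by (auto simp: cl l r lc rc T.a_ac T.smult_r_distr)
qed

lemmas env_comult_facts =
  env_lift_alg_hom[OF UU.assoc_algebra_tensor_alg lie_rep_prim]
  env_lift_incl[OF UU.assoc_algebra_tensor_alg lie_rep_prim]

lemma env_comult_alg_hom: "env_comult K L \<in> alg_hom K (env K L) (tensor_alg K (env K L) (env K L))"
  using env_comult_facts(1) by (simp add: env_comult_def Let_def)

lemma env_comult_incl: "x \<in> carrier L \<Longrightarrow> env_comult K L (env_incl K L x) = prim x"
  using env_comult_facts(2) by (simp add: env_comult_def Let_def)

lemma env_comult_closed:
  "u \<in> carrier (env K L) \<Longrightarrow> env_comult K L u \<in> carrier (tensor K (env K L) (env K L))"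
  using alg_hom_closed[OF env_comult_alg_hom] by (simp add: UU.tensor_alg_simps)

end

section \<open>The smash product\<close>

locale anchored_lie = A: assoc_algebra K A + L: lie_algebra K L
  for K :: "'k ring" and A :: "('k, 'a) module" and L :: "('k, 'l) lie_alg" +
  fixes \<omega> :: "'l \<Rightarrow> 'a \<Rightarrow> 'a"
  assumes anchor: "\<omega> \<in> lie_hom K L (Der K A)"
begin

abbreviation "U \<equiv> env K L"
abbreviation "T \<equiv> tensor K A U"
abbreviation "\<iota> \<equiv> env_incl K L"
abbreviation "act \<equiv> env_act K A (L, \<omega>)"
abbreviation "S \<equiv> smash_alg K A (L, \<omega>)"

sublocale AU: two_modules K A U ..

lemma anchor_der: "x \<in> carrier L \<Longrightarrow> \<omega> x \<in> carrier (Der K A)"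
  using anchor by (auto simp: lie_hom_def intro: lin_hom_closed[where N = "Der K A"])

lemmas anchor_lin = Der_lin[OF anchor_der]

lemma anchor_closed [simp]: "\<lbrakk>x \<in> carrier L; a \<in> carrier A\<rbrakk> \<Longrightarrow> \<omega> x a \<in> carrier A"
  by (rule lin_hom_closed[OF anchor_lin])

lemma anchor_one: "x \<in> carrier L \<Longrightarrow> \<omega> x \<one>\<^bsub>A\<^esub> = \<zero>\<^bsub>A\<^esub>"
  by (rule Der_one[OF A.assoc_algebra_axioms anchor_der])

lemma lie_rep_anchor: "L.lie_rep (End_alg K A) \<omega>"
  using anchor anchor_lin
  by (auto simp: L.lie_rep_def lie_hom_def Der_simps lin_hom_add lin_hom_smult
      End_alg_carrier[OF A.module_axioms] lin_hom_def[of K L])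

lemma act_alg_hom: "act \<in> alg_hom K U (End_alg K A)"
  using L.env_lift_alg_hom[OF assoc_algebra_End_alg[OF A.module_axioms] lie_rep_anchor]
  by (simp add: env_act_def)

lemma act_incl: "x \<in> carrier L \<Longrightarrow> act (\<iota> x) = \<omega> x"
  using L.env_lift_incl[OF assoc_algebra_End_alg[OF A.module_axioms] lie_rep_anchor]
  by (simp add: env_act_def)

lemma act_lin: "u \<in> carrier U \<Longrightarrow> act u \<in> lin_hom K A A"
  using alg_hom_closed[OF act_alg_hom] by (simp add: End_alg_carrier[OF A.module_axioms])

lemma act_closed [simp]: "\<lbrakk>u \<in> carrier U; a \<in> carrier A\<rbrakk> \<Longrightarrow> act u a \<in> carrier A"
  by (rule lin_hom_closed[OF act_lin])

lemmas act_simps =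
  alg_hom_add[OF act_alg_hom] alg_hom_smult[OF act_alg_hom] alg_hom_mult[OF act_alg_hom]
  alg_hom_one[OF act_alg_hom] End_alg_apply[OF A.module_axioms]
  lin_hom_add[OF act_lin] lin_hom_smult[OF act_lin]

lemmas tens_simps =
  AU.tens_add_left AU.tens_add_right AU.tens_smult_left AU.tens_smult_right

section \<open>The diagonal action of \<open>U\<close> on \<open>T\<close>\<close>

definition act2 :: "('k, 'l) env \<Rightarrow> ('k, 'l) env \<Rightarrow> ('k, 'a, ('k, 'l) env) tens \<Rightarrow> ('k, 'a, ('k, 'l) env) tens"
  where "act2 u1 u2 = tensor_lift K A U T (\<lambda>b v. tens K A U (act u1 b) (u2 \<otimes>\<^bsub>U\<^esub> v))"

lemma bilin_act2:
  assumes "u1 \<in> carrier U" "u2 \<in> carrier U"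
  shows "bilin K A U T (\<lambda>b v. tens K A U (act u1 b) (u2 \<otimes>\<^bsub>U\<^esub> v))"
  by (rule bilinI)
     (use assms in \<open>auto simp: act_simps tens_simps L.U.r_distr L.U.smult_mult_right\<close>)

lemmas act2_lin = AU.tensor_lift_lin[OF AU.T.module_axioms bilin_act2, folded act2_def]
lemmas act2_tens = AU.tensor_lift_tens[OF AU.T.module_axioms bilin_act2, folded act2_def]

abbreviation "E \<equiv> End_alg K T"

interpretation E: assoc_algebra K E
  by (rule assoc_algebra_End_alg[OF AU.T.module_axioms])

lemmas E_carrier = End_alg_carrier[OF AU.T.module_axioms]
lemmas E_apply = End_alg_apply[OF AU.T.module_axioms]
lemmas E_closed = End_alg_closed[OF AU.T.module_axioms]

lemma bilin_act2_E: "bilin K U U E act2"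
  by (rule bilinI)
     (auto simp: E_carrier act2_lin E_closed E_apply act2_tens act_simps tens_simps
       L.U.l_distr L.U.smult_mult_left intro!: AU.tensor_hom_ext[where P = T])

text \<open>\<open>act2\<close> is the action of two copies of \<open>U\<close> on the tensor
  product of the module \<open>A\<close> with the left regular module; \<open>rho\<close> pulls it
  back along the comultiplication. \<open>compose\<close> keeps the result extensional, as
  membership in \<open>alg_hom\<close> requires.\<close>

definition rho :: "('k, 'l) env \<Rightarrow> ('k, 'a, ('k, 'l) env) tens \<Rightarrow> ('k, 'a, ('k, 'l) env) tens"
  where "rho = compose (carrier U) (tensor_lift K U U E act2) (env_comult K L)"

lemmas Psi_lin = L.UU.RS.tensor_lift_lin[OF E.module_axioms bilin_act2_E]
lemmas Psi_tens = L.UU.RS.tensor_lift_tens[OF E.module_axioms bilin_act2_E]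

lemma Psi_alg_hom: "tensor_lift K U U E act2 \<in> alg_hom K (tensor_alg K U U) E" (is "?Psi \<in> _")
proof (rule alg_homI)
  show "?Psi \<in> lin_hom K (tensor_alg K U U) E"
    using Psi_lin by (simp add: lin_hom_def L.UU.tensor_alg_simps)
  fix s t assume "s \<in> carrier (tensor_alg K U U)" "t \<in> carrier (tensor_alg K U U)"
  then have st: "s \<in> carrier (tensor K U U)" "t \<in> carrier (tensor K U U)"
    by (auto simp: L.UU.tensor_alg_simps)
  \<comment> \<open>The first factors compose because \<open>act\<close> is an algebra map, the
    second ones because multiplication in \<open>U\<close> is associative.\<close>
  have "act2 (u1 \<otimes>\<^bsub>U\<^esub> v1) (u2 \<otimes>\<^bsub>U\<^esub> v2) = act2 u1 u2 \<otimes>\<^bsub>E\<^esub> act2 v1 v2"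
    if "u1 \<in> carrier U" "u2 \<in> carrier U" "v1 \<in> carrier U" "v2 \<in> carrier U" for u1 u2 v1 v2
    by (rule AU.tensor_hom_ext[where P = T])
       (use that in \<open>auto simp: act2_lin E_closed E_apply act2_tens act_simps L.U.m_assoc\<close>)
  then show "?Psi (s \<otimes>\<^bsub>tensor_alg K U U\<^esub> t) = ?Psi s \<otimes>\<^bsub>E\<^esub> ?Psi t"
    by (intro L.UU.RS.mult_on_tensor[OF E.module_axioms L.UU.bilin_tensor_alg_mult E.bilin_mult Psi_lin _ st])
       (auto simp: L.UU.tensor_alg_mult Psi_tens)
next
  have "act2 \<one>\<^bsub>U\<^esub> \<one>\<^bsub>U\<^esub> = \<one>\<^bsub>E\<^esub>"
    by (rule AU.tensor_hom_ext[where P = T]) (auto simp: act2_lin E_closed E_apply act2_tens act_simps)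
  then show "?Psi \<one>\<^bsub>tensor_alg K U U\<^esub> = \<one>\<^bsub>E\<^esub>"
    by (simp add: L.UU.tensor_alg_simps Psi_tens)
qed

lemma rho_alg_hom: "rho \<in> alg_hom K U E"
  unfolding rho_def by (rule alg_hom_compose[OF L.U.assoc_algebra_axioms L.env_comult_alg_hom Psi_alg_hom])

lemma rho_lin: "u \<in> carrier U \<Longrightarrow> rho u \<in> lin_hom K T T"
  using alg_hom_closed[OF rho_alg_hom] by (simp add: E_carrier)

lemma rho_closed [simp]: "\<lbrakk>u \<in> carrier U; t \<in> carrier T\<rbrakk> \<Longrightarrow> rho u t \<in> carrier T"
  by (rule lin_hom_closed[OF rho_lin])

lemmas rho_simps =
  alg_hom_add[OF rho_alg_hom] alg_hom_smult[OF rho_alg_hom] alg_hom_mult[OF rho_alg_hom]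
  alg_hom_one[OF rho_alg_hom] E_apply lin_hom_add[OF rho_lin] lin_hom_smult[OF rho_lin]

text \<open>The comultiplication of a primitive element has two terms, and 1 acts as the identity on
  either factor, so each term changes one factor.\<close>

lemma rho_incl:
  assumes "x \<in> carrier L" "b \<in> carrier A" "v \<in> carrier U"
  shows "rho (\<iota> x) (tens K A U b v) = tens K A U (\<omega> x b) v \<oplus>\<^bsub>T\<^esub> tens K A U b (\<iota> x \<otimes>\<^bsub>U\<^esub> v)"
proof -
  have "rho (\<iota> x) = act2 (\<iota> x) \<one>\<^bsub>U\<^esub> \<oplus>\<^bsub>E\<^esub> act2 \<one>\<^bsub>U\<^esub> (\<iota> x)"
    using assms
    by (simp add: rho_def compose_def L.env_comult_incl L.UU.tensor_alg_simps lin_hom_add[OF Psi_lin] Psi_tens)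
  then show ?thesis
    using assms by (simp add: E_apply act2_tens act_incl act_simps)
qed

section \<open>Left multiplication by \<open>A\<close> on \<open>T\<close>\<close>

definition lam :: "'a \<Rightarrow> ('k, 'a, ('k, 'l) env) tens \<Rightarrow> ('k, 'a, ('k, 'l) env) tens"
  where "lam a = tensor_lift K A U T (\<lambda>b v. tens K A U (a \<otimes>\<^bsub>A\<^esub> b) v)"

lemma bilin_lam: "a \<in> carrier A \<Longrightarrow> bilin K A U T (\<lambda>b v. tens K A U (a \<otimes>\<^bsub>A\<^esub> b) v)"
  by (rule bilinI) (auto simp: tens_simps A.r_distr A.smult_mult_right)

lemmas lam_lin = AU.tensor_lift_lin[OF AU.T.module_axioms bilin_lam, folded lam_def]
lemmas lam_tens = AU.tensor_lift_tens[OF AU.T.module_axioms bilin_lam, folded lam_def]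

lemma lam_closed [simp]: "\<lbrakk>a \<in> carrier A; t \<in> carrier T\<rbrakk> \<Longrightarrow> lam a t \<in> carrier T"
  by (rule lin_hom_closed[OF lam_lin])

lemma lam_add:
  assumes "a \<in> carrier A" "b \<in> carrier A" "t \<in> carrier T"
  shows "lam (a \<oplus>\<^bsub>A\<^esub> b) t = lam a t \<oplus>\<^bsub>T\<^esub> lam b t"
  using assms(3)
  by (induction rule: AU.tensor_induct)
     (use assms in \<open>auto simp: lam_tens A.l_distr tens_simps lin_hom_add[OF lam_lin] AU.T.a_ac\<close>)

lemma lam_smult:
  assumes "c \<in> carrier K" "a \<in> carrier A" "t \<in> carrier T"
  shows "lam (c \<odot>\<^bsub>A\<^esub> a) t = c \<odot>\<^bsub>T\<^esub> lam a t"
  using assms(3)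
  by (induction rule: AU.tensor_induct)
     (use assms in \<open>auto simp: lam_tens A.smult_mult_left tens_simps lin_hom_add[OF lam_lin] AU.T.smult_r_distr\<close>)

lemma lam_one:
  assumes "t \<in> carrier T"
  shows "lam \<one>\<^bsub>A\<^esub> t = t"
  using assms by (induction rule: AU.tensor_induct) (auto simp: lam_tens lin_hom_add[OF lam_lin])

lemma lam_lam:
  assumes "a \<in> carrier A" "b \<in> carrier A" "t \<in> carrier T"
  shows "lam a (lam b t) = lam (a \<otimes>\<^bsub>A\<^esub> b) t"
  using assms(3)
  by (induction rule: AU.tensor_induct)
     (use assms in \<open>auto simp: lam_tens A.m_assoc lin_hom_add[OF lam_lin]\<close>)

lemmas lam_simps = lin_hom_add[OF lam_lin] lin_hom_smult[OF lam_lin] lam_add lam_smult lam_one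

text \<open>On \<open>c \<otimes> v\<close> this is the Leibniz rule for \<open>\<omega> x\<close>
  at the product of \<open>b\<close> and \<open>c\<close>, with the term where \<open>x\<close>
  multiplies \<open>v\<close> carried along. Here the derivation property of the anchor enters the
  proof of associativity.\<close>

lemma rho_lam:
  assumes x: "x \<in> carrier L" and b: "b \<in> carrier A" and t: "t \<in> carrier T"
  shows "rho (\<iota> x) (lam b t) = lam (\<omega> x b) t \<oplus>\<^bsub>T\<^esub> lam b (rho (\<iota> x) t)"
  using t
proof (induction rule: AU.tensor_induct)
  case (tens c v)
  then show ?case
    using x b
    by (simp add: lam_tens rho_incl lam_simps Der_leibniz[OF anchor_der] tens_simps AU.T.a_assoc)
next
  case (add s t)
  then show ?case using x b by (simp add: lam_simps rho_simps AU.T.a_ac)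
qed

lemma bilin_lam_rho_left:
  assumes "a \<in> carrier A" "u \<in> carrier U"
  shows "bilin K A U T (\<lambda>b v. lam a (rho u (tens K A U b v)))"
  using bilin_lin_hom[OF bilin_lin_hom[OF AU.bilin_tens rho_lin] lam_lin] assms by blast

lemma bilin_lam_rho_right:
  assumes "t \<in> carrier T"
  shows "bilin K A U T (\<lambda>a u. lam a (rho u t))"
  by (rule bilinI) (use assms in \<open>auto simp: lam_simps rho_simps\<close>)

section \<open>The smash product in terms of \<open>lam\<close> and \<open>rho\<close>\<close>

lemma smash_simps:
  "carrier S = carrier T" "add S = add T" "zero S = zero T" "smult S = smult T"
  "one S = tens K A U \<one>\<^bsub>A\<^esub> \<one>\<^bsub>U\<^esub>"
  by (simp_all add: smash_alg_def Let_def)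

lemma smash_inner:
  assumes "a \<in> carrier A" "u \<in> carrier U" "b \<in> carrier A" "v \<in> carrier U"
  shows "tensor_lift K U U T (\<lambda>u1 u2. tens K A U (a \<otimes>\<^bsub>A\<^esub> act u1 b) (u2 \<otimes>\<^bsub>U\<^esub> v)) (env_comult K L u)
    = lam a (rho u (tens K A U b v))"
proof -
  let ?Psi = "tensor_lift K U U E act2"
  \<comment> \<open>The candidate for the lift: it sends \<open>u1 \<otimes> u2\<close> to
    \<open>lam a (act2 u1 u2 (b \<otimes> v))\<close>, and at the comultiplication of
    \<open>u\<close> the operator \<open>?Psi z\<close> becomes \<open>rho u\<close>.\<close>
  let ?h = "\<lambda>z\<in>carrier (tensor K U U). lam a (?Psi z (tens K A U b v))"
  have Psi: "?Psi z \<in> lin_hom K T T" if "z \<in> carrier (tensor K U U)" for z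
    using lin_hom_closed[OF Psi_lin that] by (simp add: E_carrier)
  have "tensor_lift K U U T (\<lambda>u1 u2. tens K A U (a \<otimes>\<^bsub>A\<^esub> act u1 b) (u2 \<otimes>\<^bsub>U\<^esub> v)) = ?h"
  proof (rule L.UU.RS.tensor_lift_eqI)
    show "?h \<in> lin_hom K (tensor K U U) T"
      by (rule lin_hom_restrictI[OF L.UU.RS.T.module_axioms])
         (use assms in \<open>auto simp: lin_hom_add[OF Psi_lin] lin_hom_smult[OF Psi_lin] E_apply lam_simps
           lin_hom_closed[OF Psi]\<close>)
  qed (use assms in \<open>auto simp: Psi_tens act2_tens lam_tens\<close>)
  then show ?thesis
    using assms by (simp add: L.env_comult_closed rho_def compose_def)
qed

text \<open>The innermost lift is rewritten under the outer descriptions by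
  \<open>tensor_lift_cong\<close>, so the equation holds for all \<open>s\<close> and
  \<open>t\<close>. The two multiplications are then equal as functions, which
  \<open>bilin_smash_mult\<close> uses.\<close>

lemma smash_mult:
  "s \<otimes>\<^bsub>S\<^esub> t = tensor_lift K A U T
    (\<lambda>a u. tensor_lift K A U T (\<lambda>b v. lam a (rho u (tens K A U b v))) t) s"
proof -
  have "tensor_lift K A U T (\<lambda>b v.
          tensor_lift K U U T (\<lambda>u1 u2. tens K A U (a \<otimes>\<^bsub>A\<^esub> act u1 b) (u2 \<otimes>\<^bsub>U\<^esub> v)) (env_comult K L u))
      = tensor_lift K A U T (\<lambda>b v. lam a (rho u (tens K A U b v)))"
    if "a \<in> carrier A" "u \<in> carrier U" for a u
    using that by (intro AU.tensor_lift_cong smash_inner)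
  then show ?thesis
    by (simp add: smash_alg_def Let_def cong: AU.tensor_lift_cong)
qed

lemma bilin_smash_mult: "bilin K T T T (mult S)"
proof -
  have *: "bilin K A U T (\<lambda>a u. lam a (rho u (tens K A U b v)))" if "b \<in> carrier A" "v \<in> carrier U" for b v
    using that by (intro bilin_lam_rho_right) auto
  have "mult S = (\<lambda>s t. tensor_lift K A U T
      (\<lambda>a u. tensor_lift K A U T (\<lambda>b v. lam a (rho u (tens K A U b v))) t) s)"
    by (intro ext smash_mult)
  then show ?thesis
    using bilin_nested_tensor_lift[OF AU.two_modules_axioms AU.two_modules_axioms AU.T.module_axioms
        bilin_lam_rho_left *] by simp
qed

text \<open>On pure tensors the inner lift takes the values of \<open>lam a\<close> after
  \<open>rho u\<close>, which is linear, so it is that composite. The second factor of a product can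
  now stay an arbitrary tensor.\<close>

lemma smash_mult_tens:
  assumes a: "a \<in> carrier A" and u: "u \<in> carrier U" and t: "t \<in> carrier T"
  shows "tens K A U a u \<otimes>\<^bsub>S\<^esub> t = lam a (rho u t)"
proof -
  have inner: "tensor_lift K A U T (\<lambda>b v. lam a (rho u (tens K A U b v))) t = lam a (rho u t)"
    if "a \<in> carrier A" "u \<in> carrier U" for a u
    using AU.tensor_lift_eqI[OF lin_hom_compose[OF AU.T.module_axioms rho_lin[OF that(2)] lam_lin[OF that(1)]],
        of "\<lambda>b v. lam a (rho u (tens K A U b v))"] t
    by (simp add: compose_def)
  have "tens K A U a u \<otimes>\<^bsub>S\<^esub> t = tensor_lift K A U T (\<lambda>a u. lam a (rho u t)) (tens K A U a u)"
    unfolding smash_mult by (simp add: inner cong: AU.tensor_lift_cong)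
  also have "\<dots> = lam a (rho u t)"
    by (rule AU.tensor_lift_tens[OF AU.T.module_axioms bilin_lam_rho_right[OF t] a u])
  finally show ?thesis .
qed

section \<open>Associativity and unit of the smash product\<close>

lemmas smash_bilin = bilinD[OF bilin_smash_mult]

lemma lam_smash:
  assumes a: "a \<in> carrier A" and s: "s \<in> carrier T" and t: "t \<in> carrier T"
  shows "lam a s \<otimes>\<^bsub>S\<^esub> t = lam a (s \<otimes>\<^bsub>S\<^esub> t)"
  using s
  by (induction rule: AU.tensor_induct)
     (use a t in \<open>auto simp: lam_tens smash_mult_tens lam_lam lam_simps smash_bilin\<close>)

text \<open>For \<open>s = b \<otimes> v\<close> the left side is the sum of
  \<open>lam (\<omega> x b) (rho v t)\<close> and \<open>lam b (rho (\<iota> x) (rho v t))\<close>;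
  \<open>rho_lam\<close>, read backwards at \<open>rho v t\<close>, collects it into the right
  side.\<close>

lemma rho_incl_smash:
  assumes x: "x \<in> carrier L" and s: "s \<in> carrier T" and t: "t \<in> carrier T"
  shows "rho (\<iota> x) s \<otimes>\<^bsub>S\<^esub> t = rho (\<iota> x) (s \<otimes>\<^bsub>S\<^esub> t)"
  using s
proof (induction rule: AU.tensor_induct)
  case (tens b v)
  then show ?case
    using x t by (simp add: rho_incl smash_bilin smash_mult_tens rho_lam rho_simps)
next
  case (add r s)
  then show ?case using x t by (simp add: rho_simps smash_bilin)
qed

lemma rho_smash:
  assumes u: "u \<in> carrier U" and s: "s \<in> carrier T" and t: "t \<in> carrier T"
  shows "rho u s \<otimes>\<^bsub>S\<^esub> t = rho u (s \<otimes>\<^bsub>S\<^esub> t)"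
  using u
  by (induction rule: L.env_induct)
     (use s t in \<open>auto simp: rho_simps smash_bilin rho_incl_smash\<close>)

text \<open>A derivation kills 1, so a generator acts on \<open>\<one> \<otimes> v\<close> through
  the second factor alone; multiplicativity of \<open>rho\<close> extends this to all of
  \<open>U\<close>.\<close>

lemma rho_one:
  assumes u: "u \<in> carrier U" and v: "v \<in> carrier U"
  shows "rho u (tens K A U \<one>\<^bsub>A\<^esub> v) = tens K A U \<one>\<^bsub>A\<^esub> (u \<otimes>\<^bsub>U\<^esub> v)"
  using u
  by (induction rule: L.env_induct)
     (use v in \<open>auto simp: rho_simps rho_incl anchor_one AU.tens_zero_left tens_simps L.U.l_distr
       L.U.smult_mult_left L.U.m_assoc\<close>)

text \<open>Multiplying by \<open>a \<otimes> u\<close> is \<open>lam a\<close> after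
  \<open>rho u\<close>, and by \<open>lam_smash\<close> and \<open>rho_smash\<close> both operators
  commute with right multiplications; this is associativity. The right unit law comes from
  \<open>rho_one\<close>.\<close>

lemma smash_algebra: "assoc_algebra K S"
proof -
  have "assoc_algebra K (T\<lparr>mult := mult S, one := tens K A U \<one>\<^bsub>A\<^esub> \<one>\<^bsub>U\<^esub>\<rparr>)"
    by (rule AU.assoc_algebra_tensorI[OF bilin_smash_mult])
       (auto simp: smash_mult_tens rho_one lam_tens lam_simps rho_simps lam_smash rho_smash smash_bilin)
  then show ?thesis by (simp add: smash_alg_def Let_def)
qed

sublocale S: assoc_algebra K S by (rule smash_algebra)

section \<open>Generators of the smash product and maps out of it\<close>

lemma smash_tens_split:
  assumes "a \<in> carrier A" "u \<in> carrier U"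
  shows "tens K A U a u = tens K A U a \<one>\<^bsub>U\<^esub> \<otimes>\<^bsub>S\<^esub> tens K A U \<one>\<^bsub>A\<^esub> u"
  using assms by (simp add: smash_mult_tens rho_one lam_tens)

text \<open>The condition, written without subtraction, for the pair of
  \<open>\<one> \<otimes> \<iota> x\<close> and \<open>\<omega> x\<close> to lie in
  \<open>L_alg\<close> of the smash product; this pair is the value at \<open>x\<close> of the unit
  of the adjunction.\<close>

lemma smash_incl_mult:
  assumes "x \<in> carrier L" "a \<in> carrier A"
  shows "tens K A U \<one>\<^bsub>A\<^esub> (\<iota> x) \<otimes>\<^bsub>S\<^esub> tens K A U a \<one>\<^bsub>U\<^esub>
    = tens K A U (\<omega> x a) \<one>\<^bsub>U\<^esub> \<oplus>\<^bsub>S\<^esub> tens K A U a \<one>\<^bsub>U\<^esub> \<otimes>\<^bsub>S\<^esub> tens K A U \<one>\<^bsub>A\<^esub> (\<iota> x)"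
  using assms by (simp add: smash_mult_tens lam_simps lam_tens rho_incl rho_simps smash_simps)

lemma smash_scalars_alg_hom: "(\<lambda>a\<in>carrier A. tens K A U a \<one>\<^bsub>U\<^esub>) \<in> alg_hom K A S"
proof (rule alg_homI)
  show "(\<lambda>a\<in>carrier A. tens K A U a \<one>\<^bsub>U\<^esub>) \<in> lin_hom K A S"
    by (rule lin_hom_restrictI[OF A.module_axioms]) (auto simp: smash_simps tens_simps)
qed (auto simp: smash_mult_tens rho_simps lam_tens smash_simps)

lemma smash_env_alg_hom: "(\<lambda>u\<in>carrier U. tens K A U \<one>\<^bsub>A\<^esub> u) \<in> alg_hom K U S"
proof (rule alg_homI)
  show "(\<lambda>u\<in>carrier U. tens K A U \<one>\<^bsub>A\<^esub> u) \<in> lin_hom K U S"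
    by (rule lin_hom_restrictI[OF L.U.module_axioms]) (auto simp: smash_simps tens_simps)
qed (auto simp: smash_mult_tens rho_one lam_one smash_simps)

lemma smash_hom_ext:
  assumes h: "h \<in> alg_hom K S R" and g: "g \<in> alg_hom K S R"
    and scal: "\<And>a. a \<in> carrier A \<Longrightarrow> h (tens K A U a \<one>\<^bsub>U\<^esub>) = g (tens K A U a \<one>\<^bsub>U\<^esub>)"
    and incl: "\<And>x. x \<in> carrier L \<Longrightarrow> h (tens K A U \<one>\<^bsub>A\<^esub> (\<iota> x)) = g (tens K A U \<one>\<^bsub>A\<^esub> (\<iota> x))"
  shows "h = g"
proof -
  let ?j = "\<lambda>u\<in>carrier U. tens K A U \<one>\<^bsub>A\<^esub> u"
  \<comment> \<open>Along \<open>u \<mapsto> \<one> \<otimes> u\<close> both maps restrict to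
    algebra maps out of \<open>U\<close>, for which agreement on the image of \<open>L\<close> is
    enough.\<close>
  have "compose (carrier U) h ?j = compose (carrier U) g ?j"
    by (rule L.env_hom_ext[OF alg_hom_compose[OF L.U.assoc_algebra_axioms smash_env_alg_hom h]
          alg_hom_compose[OF L.U.assoc_algebra_axioms smash_env_alg_hom g]])
       (simp add: compose_def incl)
  then have j: "h (tens K A U \<one>\<^bsub>A\<^esub> u) = g (tens K A U \<one>\<^bsub>A\<^esub> u)" if "u \<in> carrier U" for u
    using that by (auto simp: compose_def dest!: fun_cong[where x = u])
  have lin: "h \<in> lin_hom K T R" "g \<in> lin_hom K T R"
    using alg_hom_lin[OF h] alg_hom_lin[OF g] by (auto simp: lin_hom_def smash_simps)
  show ?thesis
  proof (rule AU.tensor_hom_ext[OF lin])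
    fix a u assume au: "a \<in> carrier A" "u \<in> carrier U"
    then have "tens K A U a \<one>\<^bsub>U\<^esub> \<in> carrier S" "tens K A U \<one>\<^bsub>A\<^esub> u \<in> carrier S" by (auto simp: smash_simps)
    then show "h (tens K A U a u) = g (tens K A U a u)"
      using au by (subst (1 2) smash_tens_split) (auto simp: alg_hom_mult[OF h] alg_hom_mult[OF g] scal j)
  qed
qed

text \<open>The lift turns \<open>lam a\<close> into left multiplication by \<open>\<phi> a\<close>
  and \<open>rho u\<close> into left multiplication by \<open>G u\<close>. Since multiplying by
  \<open>a \<otimes> u\<close> is \<open>lam a\<close> after \<open>rho u\<close>, the lift is
  multiplicative.\<close>

lemma
  assumes R: "assoc_algebra K R" and \<phi>: "\<phi> \<in> alg_hom K A R" and G: "G \<in> alg_hom K U R"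
    and comm: "\<And>x a. \<lbrakk>x \<in> carrier L; a \<in> carrier A\<rbrakk> \<Longrightarrow>
      G (\<iota> x) \<otimes>\<^bsub>R\<^esub> \<phi> a = \<phi> (\<omega> x a) \<oplus>\<^bsub>R\<^esub> \<phi> a \<otimes>\<^bsub>R\<^esub> G (\<iota> x)"
  shows smash_lift_alg_hom: "tensor_lift K A U R (\<lambda>a u. \<phi> a \<otimes>\<^bsub>R\<^esub> G u) \<in> alg_hom K S R"
      (is "?h \<in> _")
    and smash_lift_tens: "\<And>a u. \<lbrakk>a \<in> carrier A; u \<in> carrier U\<rbrakk> \<Longrightarrow>
      tensor_lift K A U R (\<lambda>a u. \<phi> a \<otimes>\<^bsub>R\<^esub> G u) (tens K A U a u) = \<phi> a \<otimes>\<^bsub>R\<^esub> G u"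
proof -
  interpret R: assoc_algebra K R by fact
  note [simp] = alg_hom_closed[OF \<phi>] alg_hom_closed[OF G]
  have bilin: "bilin K A U R (\<lambda>a u. \<phi> a \<otimes>\<^bsub>R\<^esub> G u)"
    by (rule bilinI)
       (auto simp: alg_hom_add[OF \<phi>] alg_hom_add[OF G] alg_hom_smult[OF \<phi>] alg_hom_smult[OF G]
         R.l_distr R.r_distr R.smult_mult_left R.smult_mult_right)
  note lin = AU.tensor_lift_lin[OF R.module_axioms bilin]
  note lift_tens = AU.tensor_lift_tens[OF R.module_axioms bilin]
  show "?h (tens K A U a u) = \<phi> a \<otimes>\<^bsub>R\<^esub> G u" if "a \<in> carrier A" "u \<in> carrier U" for a u
    using that by (rule lift_tens)
  note [simp] = lin_hom_closed[OF lin] lin_hom_add[OF lin] lin_hom_smult[OF lin]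
  have lam: "?h (lam a t) = \<phi> a \<otimes>\<^bsub>R\<^esub> ?h t" if a: "a \<in> carrier A" and t: "t \<in> carrier T" for a t
    using t
    by (induction rule: AU.tensor_induct)
       (use a in \<open>auto simp: lam_tens lift_tens alg_hom_mult[OF \<phi>] R.m_assoc lam_simps R.r_distr\<close>)
  \<comment> \<open>Here \<open>comm\<close> enters: moving \<open>G (\<iota> x)\<close> past
    \<open>\<phi> b\<close> produces the images of the two terms by which \<open>\<iota> x\<close>
    acts on \<open>b \<otimes> v\<close>.\<close>
  have rho_incl: "?h (rho (\<iota> x) t) = G (\<iota> x) \<otimes>\<^bsub>R\<^esub> ?h t" if x: "x \<in> carrier L" and t: "t \<in> carrier T" for x t
    using t
  proof (induction rule: AU.tensor_induct)
    case (tens b v)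
    have "G (\<iota> x) \<otimes>\<^bsub>R\<^esub> (\<phi> b \<otimes>\<^bsub>R\<^esub> G v) = (G (\<iota> x) \<otimes>\<^bsub>R\<^esub> \<phi> b) \<otimes>\<^bsub>R\<^esub> G v"
      using tens x by (simp add: R.m_assoc)
    then show ?case
      using tens x
      by (simp add: rho_incl lift_tens comm alg_hom_mult[OF G] R.l_distr R.m_assoc)
  next
    case (add s t)
    then show ?case using x by (simp add: rho_simps R.r_distr)
  qed
  have rho: "?h (rho u t) = G u \<otimes>\<^bsub>R\<^esub> ?h t" if u: "u \<in> carrier U" and t: "t \<in> carrier T" for u t
    using u
    by (induction rule: L.env_induct)
       (use t in \<open>auto simp: rho_simps alg_hom_one[OF G] alg_hom_mult[OF G] alg_hom_add[OF G]
         alg_hom_smult[OF G] R.l_distr R.smult_mult_left R.m_assoc rho_incl\<close>)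
  show "?h \<in> alg_hom K S R"
  proof (rule alg_homI)
    show "?h \<in> lin_hom K S R" using lin by (simp add: lin_hom_def smash_simps)
    fix s t assume "s \<in> carrier S" "t \<in> carrier S"
    then have s: "s \<in> carrier T" and t: "t \<in> carrier T" by (auto simp: smash_simps)
    show "?h (s \<otimes>\<^bsub>S\<^esub> t) = ?h s \<otimes>\<^bsub>R\<^esub> ?h t"
      using s
      by (induction rule: AU.tensor_induct)
         (use t in \<open>auto simp: smash_mult_tens lam rho lift_tens R.m_assoc smash_bilin R.l_distr\<close>)
  qed (simp add: smash_simps lift_tens alg_hom_one[OF \<phi>] alg_hom_one[OF G])
qed

end

section \<open>The functor \<open>L_A\<close>\<close>

lemma lie_algebraI:
  assumes "module K L"
    and "\<And>x y. \<lbrakk>x \<in> carrier L; y \<in> carrier L\<rbrakk> \<Longrightarrow> bracket L x y \<in> carrier L"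
    and "\<And>x y z. \<lbrakk>x \<in> carrier L; y \<in> carrier L; z \<in> carrier L\<rbrakk> \<Longrightarrow>
      bracket L (x \<oplus>\<^bsub>L\<^esub> y) z = bracket L x z \<oplus>\<^bsub>L\<^esub> bracket L y z"
    and "\<And>x y z. \<lbrakk>x \<in> carrier L; y \<in> carrier L; z \<in> carrier L\<rbrakk> \<Longrightarrow>
      bracket L x (y \<oplus>\<^bsub>L\<^esub> z) = bracket L x y \<oplus>\<^bsub>L\<^esub> bracket L x z"
    and "\<And>c x y. \<lbrakk>c \<in> carrier K; x \<in> carrier L; y \<in> carrier L\<rbrakk> \<Longrightarrow>
      bracket L (c \<odot>\<^bsub>L\<^esub> x) y = c \<odot>\<^bsub>L\<^esub> bracket L x y"
    and "\<And>c x y. \<lbrakk>c \<in> carrier K; x \<in> carrier L; y \<in> carrier L\<rbrakk> \<Longrightarrow>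
      bracket L x (c \<odot>\<^bsub>L\<^esub> y) = c \<odot>\<^bsub>L\<^esub> bracket L x y"
    and "\<And>x. x \<in> carrier L \<Longrightarrow> bracket L x x = \<zero>\<^bsub>L\<^esub>"
    and "\<And>x y z. \<lbrakk>x \<in> carrier L; y \<in> carrier L; z \<in> carrier L\<rbrakk> \<Longrightarrow>
      bracket L x (bracket L y z) \<oplus>\<^bsub>L\<^esub> bracket L y (bracket L z x)
        \<oplus>\<^bsub>L\<^esub> bracket L z (bracket L x y) = \<zero>\<^bsub>L\<^esub>"
  shows "lie_algebra K L"
  by (intro lie_algebra.intro lie_algebra_axioms.intro assms)

locale aring = A: assoc_algebra K A + R: assoc_algebra K R
  for K :: "'k ring" and A :: "('k, 'a) module" and R :: "('k, 'r) module" +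
  fixes \<phi> :: "'a \<Rightarrow> 'r"
  assumes hom: "\<phi> \<in> alg_hom K A R"
begin

abbreviation "LR \<equiv> L_alg K A (R, \<phi>)"

interpretation D: module K "Der K A" by (rule A.module_Der)
interpretation E: assoc_algebra K "End_alg K A" by (rule assoc_algebra_End_alg[OF A.module_axioms])

lemmas E_apply = End_alg_apply[OF A.module_axioms]

lemma L_alg_carrier:
  "p \<in> carrier LR \<longleftrightarrow> fst p \<in> carrier R \<and> snd p \<in> carrier (Der K A) \<and>
    (\<forall>a\<in>carrier A. commutator R (fst p) (\<phi> a) = \<phi> (snd p a))"
  by (auto simp: L_alg_def Let_def)

lemma L_alg_simps:
  "p \<oplus>\<^bsub>LR\<^esub> q = (fst p \<oplus>\<^bsub>R\<^esub> fst q, snd p \<oplus>\<^bsub>Der K A\<^esub> snd q)"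
  "c \<odot>\<^bsub>LR\<^esub> p = (c \<odot>\<^bsub>R\<^esub> fst p, c \<odot>\<^bsub>Der K A\<^esub> snd p)"
  "\<zero>\<^bsub>LR\<^esub> = (\<zero>\<^bsub>R\<^esub>, \<zero>\<^bsub>Der K A\<^esub>)"
  "bracket LR p q = (commutator R (fst p) (fst q), bracket (Der K A) (snd p) (snd q))"
  by (simp_all add: L_alg_def Let_def split: prod.splits)

lemma der_value [simp]: "\<lbrakk>\<delta> \<in> carrier (Der K A); a \<in> carrier A\<rbrakk> \<Longrightarrow> \<delta> a \<in> carrier A"
  by (rule lin_hom_closed[OF Der_lin])

lemma L_alg_closed:
  "\<lbrakk>p \<in> carrier LR; q \<in> carrier LR\<rbrakk> \<Longrightarrow> p \<oplus>\<^bsub>LR\<^esub> q \<in> carrier LR"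
  "\<lbrakk>c \<in> carrier K; p \<in> carrier LR\<rbrakk> \<Longrightarrow> c \<odot>\<^bsub>LR\<^esub> p \<in> carrier LR"
  "\<zero>\<^bsub>LR\<^esub> \<in> carrier LR"
  "\<lbrakk>p \<in> carrier LR; q \<in> carrier LR\<rbrakk> \<Longrightarrow> bracket LR p q \<in> carrier LR"
proof -
  note [simp] = alg_hom_closed[OF hom]
  show "p \<oplus>\<^bsub>LR\<^esub> q \<in> carrier LR" if "p \<in> carrier LR" "q \<in> carrier LR"
    using that
    by (auto simp: L_alg_carrier L_alg_simps R.commutator_add_left)
       (simp add: Der_simps E_apply alg_hom_add[OF hom])
  show "c \<odot>\<^bsub>LR\<^esub> p \<in> carrier LR" if "c \<in> carrier K" "p \<in> carrier LR"
    using that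
    by (auto simp: L_alg_carrier L_alg_simps R.commutator_smult_left)
       (simp add: Der_simps E_apply alg_hom_smult[OF hom])
  show "\<zero>\<^bsub>LR\<^esub> \<in> carrier LR"
    using lin_hom_zero[OF A.module_axioms R.module_axioms alg_hom_lin[OF hom]] D.zero_closed
    by (auto simp: L_alg_carrier L_alg_simps R.commutator_commuting)
       (simp add: Der_simps E_apply)
  show "bracket LR p q \<in> carrier LR" if pq: "p \<in> carrier LR" "q \<in> carrier LR"
    unfolding L_alg_carrier
  proof (intro conjI ballI)
    show "fst (bracket LR p q) \<in> carrier R" using pq by (simp add: L_alg_simps L_alg_carrier)
    show "snd (bracket LR p q) \<in> carrier (Der K A)"
      using pq by (simp add: L_alg_simps L_alg_carrier Der_simps A.Der_bracket_closed)
    fix a assume a: "a \<in> carrier A"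
    \<comment> \<open>With \<open>p = (r, \<delta>)\<close> and \<open>q = (s, \<epsilon>)\<close>,
      \<open>commutator_commutator\<close> yields [r, [s, \<phi> a]] - [s, [r, \<phi> a]], which the
      conditions on \<open>p\<close> and \<open>q\<close> turn into the value of \<phi> at
      \<delta>(\<epsilon> a) - \<epsilon>(\<delta> a).\<close>
    then show "commutator R (fst (bracket LR p q)) (\<phi> a) = \<phi> (snd (bracket LR p q) a)"
      using pq
      by (simp add: L_alg_simps L_alg_carrier R.commutator_commutator Der_simps
          End_alg_commutator_apply[OF A.module_axioms] Der_lin
          alg_hom_minus[OF A.assoc_algebra_axioms R.assoc_algebra_axioms hom])
  qed
qed

lemma module_L_alg: "module K LR"
proof (rule moduleI)
  show "abelian_group LR"
  proof (rule abelian_groupI)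
    fix p assume p: "p \<in> carrier LR"
    let ?q = "(\<ominus>\<^bsub>K\<^esub> \<one>\<^bsub>K\<^esub>) \<odot>\<^bsub>LR\<^esub> p"
    have "?q \<oplus>\<^bsub>LR\<^esub> p = \<zero>\<^bsub>LR\<^esub>"
      using p by (simp add: L_alg_simps L_alg_carrier R.smult_l_minus D.smult_l_minus R.l_neg D.l_neg)
    moreover have "?q \<in> carrier LR" using p by (intro L_alg_closed) auto
    ultimately show "\<exists>q\<in>carrier LR. q \<oplus>\<^bsub>LR\<^esub> p = \<zero>\<^bsub>LR\<^esub>" by blast
  qed (simp_all add: L_alg_closed, auto simp: L_alg_simps L_alg_carrier R.a_ac D.a_ac)
qed (simp_all add: L_alg_closed module.axioms(1)[OF A.module_axioms], auto simp: L_alg_simps L_alg_carrier R.smult_l_distr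
    D.smult_l_distr R.smult_r_distr D.smult_r_distr R.smult_assoc1 D.smult_assoc1)

text \<open>The bracket is a commutator in \<open>R\<close> paired with a commutator in
  \<open>End_alg K A\<close>, so each law holds componentwise in an associative algebra.\<close>

lemma lie_algebra_L_alg: "lie_algebra K LR"
proof (rule lie_algebraI[OF module_L_alg])
  have E: "snd p \<in> carrier (End_alg K A)" if "p \<in> carrier LR" for p
    using that by (auto simp: L_alg_carrier Der_lin End_alg_carrier[OF A.module_axioms])
  have Rc: "fst p \<in> carrier R" if "p \<in> carrier LR" for p using that by (simp add: L_alg_carrier)
  show "bracket LR x y \<in> carrier LR" if "x \<in> carrier LR" "y \<in> carrier LR" for x y
    using that by (rule L_alg_closed)
qed (simp_all add: L_alg_simps Der_simps L_alg_carrier Der_lin End_alg_carrier[OF A.module_axioms]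
    R.commutator_add_left R.commutator_add_right R.commutator_smult_left R.commutator_smult_right
    R.commutator_self R.commutator_jacobi
    E.commutator_add_left E.commutator_add_right E.commutator_smult_left E.commutator_smult_right
    E.commutator_self E.commutator_jacobi)

lemma L_ob_closed: "L_ob K A (R, \<phi>) \<in> AnchLie_Ob K A"
proof -
  have "(\<lambda>x\<in>carrier LR. snd x) \<in> lin_hom K LR (Der K A)"
    by (rule lin_hom_restrictI[OF module_L_alg]) (auto simp: L_alg_carrier L_alg_simps)
  then show ?thesis
    using lie_algebra_L_alg L_alg_closed(4)
    by (simp add: AnchLie_Ob_def L_ob_def lie_hom_def L_alg_simps)
qed

end

lemma aring_Ring_Ob:
  "assoc_algebra K A \<Longrightarrow> (R, \<phi>) \<in> Ring_Ob K A \<Longrightarrow> aring K A R \<phi>"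
  by (simp add: Ring_Ob_def aring_def aring_axioms_def)

lemma L_mor_closed:
  assumes A: "assoc_algebra K A" and R: "(R, \<phi>) \<in> Ring_Ob K A" and S: "(S, \<psi>) \<in> Ring_Ob K A"
    and h: "h \<in> Ring_Hom K A (R, \<phi>) (S, \<psi>)"
  shows "L_mor K A (R, \<phi>) h \<in> AnchLie_Hom K (L_ob K A (R, \<phi>)) (L_ob K A (S, \<psi>))"
proof -
  interpret R: aring K A R \<phi> by (rule aring_Ring_Ob[OF A R])
  interpret S: aring K A S \<psi> by (rule aring_Ring_Ob[OF A S])
  have hh: "h \<in> alg_hom K R S" and h\<phi>: "\<And>a. a \<in> carrier A \<Longrightarrow> h (\<phi> a) = \<psi> a"
    using h by (auto simp: Ring_Hom_def)
  note com = alg_hom_commutator[OF R.R.assoc_algebra_axioms S.R.assoc_algebra_axioms hh]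
  let ?f = "\<lambda>x\<in>carrier R.LR. (h (fst x), snd x)"
  \<comment> \<open>Applying \<open>h\<close> to the defining condition of \<open>p\<close> gives
    that of its image, with the same derivation, because \<open>h\<close> carries
    \<open>\<phi>\<close> to \<open>\<psi>\<close>.\<close>
  have cl: "(h (fst p), snd p) \<in> carrier S.LR" if p: "p \<in> carrier R.LR" for p
    using p com[of "fst p" "\<phi> a" for a] h\<phi>
    by (auto simp: R.L_alg_carrier S.L_alg_carrier alg_hom_closed[OF hh] alg_hom_closed[OF R.hom]
        simp flip: h\<phi> com)
  have "?f \<in> lin_hom K R.LR S.LR"
    by (rule lin_hom_restrictI[OF R.module_L_alg])
       (simp_all add: cl, auto simp: R.L_alg_simps S.L_alg_simps R.L_alg_carrier alg_hom_add[OF hh]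
         alg_hom_smult[OF hh])
  then have "?f \<in> lie_hom K R.LR S.LR"
    by (auto simp: lie_hom_def R.L_alg_closed(4))
       (auto simp: R.L_alg_simps S.L_alg_simps R.L_alg_carrier com)
  then show ?thesis by (simp add: AnchLie_Hom_def L_ob_def L_mor_def cl)
qed

lemma L_mor_id: "L_mor K A R (Id_mor R) = Id_mor (L_ob K A R)"
  by (cases R) (auto simp: L_mor_def Id_mor_def L_ob_def L_alg_def Let_def fun_eq_iff)

lemma L_mor_comp:
  assumes A: "assoc_algebra K A" and R: "(R, \<phi>) \<in> Ring_Ob K A" and S: "(S, \<psi>) \<in> Ring_Ob K A"
    and h: "h \<in> Ring_Hom K A (R, \<phi>) (S, \<psi>)"
  shows "L_mor K A (R, \<phi>) (comp_mor (R, \<phi>) k h) =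
    comp_mor (L_ob K A (R, \<phi>)) (L_mor K A (S, \<psi>) k) (L_mor K A (R, \<phi>) h)"
proof
  fix p
  interpret R: aring K A R \<phi> by (rule aring_Ring_Ob[OF A R])
  interpret S: aring K A S \<psi> by (rule aring_Ring_Ob[OF A S])
  have "L_mor K A (R, \<phi>) h p \<in> carrier S.LR" if "p \<in> carrier R.LR"
    using L_mor_closed[OF A R S h] that
    by (auto simp: AnchLie_Hom_def L_ob_def lie_hom_def intro: lin_hom_closed)
  then show "L_mor K A (R, \<phi>) (comp_mor (R, \<phi>) k h) p =
      comp_mor (L_ob K A (R, \<phi>)) (L_mor K A (S, \<psi>) k) (L_mor K A (R, \<phi>) h) p"
    by (auto simp: L_mor_def comp_mor_def compose_def L_ob_def R.L_alg_carrier)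
qed

section \<open>The functor \<open>U_A\<close>\<close>

lemma anchored_lie_AnchLie_Ob:
  "assoc_algebra K A \<Longrightarrow> (L, \<omega>) \<in> AnchLie_Ob K A \<Longrightarrow> anchored_lie K A L \<omega>"
  by (simp add: AnchLie_Ob_def anchored_lie_def anchored_lie_axioms_def)

lemma U_ob_closed:
  assumes "assoc_algebra K A" "X \<in> AnchLie_Ob K A"
  shows "U_ob K A X \<in> Ring_Ob K A"
proof (cases X)
  case (Pair L \<omega>)
  interpret anchored_lie K A L \<omega> using assms anchored_lie_AnchLie_Ob Pair by blast
  show ?thesis
    using smash_scalars_alg_hom smash_algebra by (simp add: Pair U_ob_def Ring_Ob_def)
qed

text \<open>The lift \<open>smash_lift_alg_hom\<close> is reused with a smash product as target:
  \<open>a \<otimes> u\<close> goes to the product of \<open>a \<otimes> \<one>\<close> and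
  \<open>\<one> \<otimes> ?m u\<close>. Its commutation hypothesis is \<open>smash_incl_mult\<close>
  at \<open>f x\<close>, where \<open>\<omega>' (f x) = \<omega> x\<close>.\<close>

lemma
  assumes A: "assoc_algebra K A" and X: "(L, \<omega>) \<in> AnchLie_Ob K A" and Y: "(L', \<omega>') \<in> AnchLie_Ob K A"
    and f: "f \<in> AnchLie_Hom K (L, \<omega>) (L', \<omega>')"
  shows U_mor_alg_hom: "U_mor K A (L, \<omega>) (L', \<omega>') f \<in>
      alg_hom K (smash_alg K A (L, \<omega>)) (smash_alg K A (L', \<omega>'))" (is "?F \<in> _")
    and U_mor_scalar: "\<And>a. a \<in> carrier A \<Longrightarrow> U_mor K A (L, \<omega>) (L', \<omega>') f
      (tens K A (env K L) a \<one>\<^bsub>env K L\<^esub>) = tens K A (env K L') a \<one>\<^bsub>env K L'\<^esub>"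
    and U_mor_incl: "\<And>x. x \<in> carrier L \<Longrightarrow> U_mor K A (L, \<omega>) (L', \<omega>') f
      (tens K A (env K L) \<one>\<^bsub>A\<^esub> (env_incl K L x)) = tens K A (env K L') \<one>\<^bsub>A\<^esub> (env_incl K L' (f x))"
proof -
  interpret X: anchored_lie K A L \<omega> by (rule anchored_lie_AnchLie_Ob[OF A X])
  interpret Y: anchored_lie K A L' \<omega>' by (rule anchored_lie_AnchLie_Ob[OF A Y])
  have lin: "f \<in> lin_hom K L L'"
    and br: "\<And>x y. \<lbrakk>x \<in> carrier L; y \<in> carrier L\<rbrakk> \<Longrightarrow> f (bracket L x y) = bracket L' (f x) (f y)"
    and anch: "\<And>x. x \<in> carrier L \<Longrightarrow> \<omega>' (f x) = \<omega> x"
    using f by (auto simp: AnchLie_Hom_def lie_hom_def)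
  note [simp] = lin_hom_closed[OF lin]
  let ?m = "env_map K L L' f" and ?\<phi> = "\<lambda>a\<in>carrier A. tens K A Y.U a \<one>\<^bsub>Y.U\<^esub>"
  let ?G = "compose (carrier X.U) (\<lambda>u\<in>carrier Y.U. tens K A Y.U \<one>\<^bsub>A\<^esub> u) ?m"
  have rep: "X.L.lie_rep Y.U (\<lambda>x. Y.\<iota> (f x))"
    by (auto simp: X.L.lie_rep_def lin_hom_add[OF lin] lin_hom_smult[OF lin] br
        Y.L.env_incl_add Y.L.env_incl_smult Y.L.env_incl_bracket)
  have m: "?m \<in> alg_hom K X.U Y.U" and mi: "\<And>x. x \<in> carrier L \<Longrightarrow> ?m (X.\<iota> x) = Y.\<iota> (f x)"
    using X.L.env_lift_alg_hom[OF Y.L.U.assoc_algebra_axioms rep]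
      X.L.env_lift_incl[OF Y.L.U.assoc_algebra_axioms rep] by (auto simp: env_map_def)
  have G: "?G \<in> alg_hom K X.U Y.S"
    by (rule alg_hom_compose[OF X.L.U.assoc_algebra_axioms m Y.smash_env_alg_hom])
  have Gm: "?G u = tens K A Y.U \<one>\<^bsub>A\<^esub> (?m u)" if "u \<in> carrier X.U" for u
    using that by (simp add: compose_def alg_hom_closed[OF m])
  have comm: "?G (X.\<iota> x) \<otimes>\<^bsub>Y.S\<^esub> ?\<phi> a = ?\<phi> (\<omega> x a) \<oplus>\<^bsub>Y.S\<^esub> ?\<phi> a \<otimes>\<^bsub>Y.S\<^esub> ?G (X.\<iota> x)"
    if "x \<in> carrier L" "a \<in> carrier A" for x a
    using that Y.smash_incl_mult[of "f x" a] by (simp add: Gm mi anch)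
  have \<phi>G: "?\<phi> a \<otimes>\<^bsub>Y.S\<^esub> ?G u = tens K A Y.U a (?m u)" if "a \<in> carrier A" "u \<in> carrier X.U" for a u
    using that by (simp add: Gm Y.smash_tens_split[symmetric] alg_hom_closed[OF m])
  have F: "?F = tensor_lift K A X.U Y.S (\<lambda>a u. ?\<phi> a \<otimes>\<^bsub>Y.S\<^esub> ?G u)"
    unfolding U_mor_def fst_conv
    by (rule X.AU.tensor_lift_cong) (rule \<phi>G[symmetric])
  show "?F \<in> alg_hom K X.S Y.S"
    unfolding F by (rule X.smash_lift_alg_hom[OF Y.smash_algebra Y.smash_scalars_alg_hom G comm])
  have tens: "?F (tens K A X.U a u) = tens K A Y.U a (?m u)" if "a \<in> carrier A" "u \<in> carrier X.U" for a u
    unfolding F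
    by (rule trans[OF X.smash_lift_tens[OF Y.smash_algebra Y.smash_scalars_alg_hom G comm that] \<phi>G[OF that]])
  show "?F (tens K A X.U a \<one>\<^bsub>X.U\<^esub>) = tens K A Y.U a \<one>\<^bsub>Y.U\<^esub>" if "a \<in> carrier A" for a
    using that by (simp add: tens alg_hom_one[OF m])
  show "?F (tens K A X.U \<one>\<^bsub>A\<^esub> (X.\<iota> x)) = tens K A Y.U \<one>\<^bsub>A\<^esub> (Y.\<iota> (f x))" if "x \<in> carrier L" for x
    using that by (simp add: tens mi)
qed

lemma U_mor_closed:
  assumes A: "assoc_algebra K A" and X: "X \<in> AnchLie_Ob K A" and Y: "Y \<in> AnchLie_Ob K A"
    and f: "f \<in> AnchLie_Hom K X Y"
  shows "U_mor K A X Y f \<in> Ring_Hom K A (U_ob K A X) (U_ob K A Y)"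
proof (cases X; cases Y)
  fix L \<omega> L' \<omega>' assume [simp]: "X = (L, \<omega>)" "Y = (L', \<omega>')"
  show ?thesis
    using U_mor_alg_hom[of K A L \<omega> L' \<omega>' f] U_mor_scalar[of K A L \<omega> L' \<omega>' f] assms
    by (simp add: Ring_Hom_def U_ob_def)
qed

lemma Id_mor_AnchLie_Hom:
  assumes "X \<in> AnchLie_Ob K A"
  shows "Id_mor X \<in> AnchLie_Hom K X X"
proof (cases X)
  case (Pair L \<omega>)
  interpret lie_algebra K L using assms by (simp add: Pair AnchLie_Ob_def)
  show ?thesis
    using lin_hom_id[OF module_axioms] bracket_closed
    by (simp add: Pair Id_mor_def AnchLie_Hom_def lie_hom_def)
qed

lemma comp_mor_AnchLie_Hom:
  assumes "X \<in> AnchLie_Ob K A" "f \<in> AnchLie_Hom K X Y" "g \<in> AnchLie_Hom K Y Z"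
  shows "comp_mor X g f \<in> AnchLie_Hom K X Z"
proof (cases X; cases Y; cases Z)
  fix L \<omega> L' \<omega>' L'' \<omega>'' assume [simp]: "X = (L, \<omega>)" "Y = (L', \<omega>')" "Z = (L'', \<omega>'')"
  interpret lie_algebra K L using assms by (simp add: AnchLie_Ob_def)
  have f: "f \<in> lin_hom K L L'" and g: "g \<in> lin_hom K L' L''"
    using assms by (auto simp: AnchLie_Hom_def lie_hom_def)
  show ?thesis
    using assms(2,3) lin_hom_compose[OF module_axioms f g] bracket_closed
    by (auto simp: comp_mor_def AnchLie_Hom_def lie_hom_def compose_def lin_hom_closed[OF f])
qed

text \<open>As for composites below, both sides are algebra maps, so \<open>smash_hom_ext\<close>
  reduces the functor law to the generators \<open>a \<otimes> \<one>\<close> and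
  \<open>\<one> \<otimes> \<iota> x\<close>.\<close>

lemma U_mor_id:
  assumes A: "assoc_algebra K A" and X: "X \<in> AnchLie_Ob K A"
  shows "U_mor K A X X (Id_mor X) = Id_mor (U_ob K A X)"
proof (cases X)
  case (Pair L \<omega>)
  interpret anchored_lie K A L \<omega> using anchored_lie_AnchLie_Ob[OF A] X Pair by blast
  note F = A X[unfolded Pair] X[unfolded Pair] Id_mor_AnchLie_Hom[OF X[unfolded Pair]]
  have "U_mor K A (L, \<omega>) (L, \<omega>) (Id_mor (L, \<omega>)) = (\<lambda>x\<in>carrier S. x)"
    by (rule smash_hom_ext[OF U_mor_alg_hom[OF F] alg_hom_id[OF smash_algebra]])
       (simp_all add: U_mor_scalar[OF F] U_mor_incl[OF F] smash_simps, simp add: Id_mor_def)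
  then show ?thesis by (simp add: Pair Id_mor_def U_ob_def)
qed

lemma U_mor_comp:
  assumes A: "assoc_algebra K A"
    and X: "X \<in> AnchLie_Ob K A" and Y: "Y \<in> AnchLie_Ob K A" and Z: "Z \<in> AnchLie_Ob K A"
    and f: "f \<in> AnchLie_Hom K X Y" and g: "g \<in> AnchLie_Hom K Y Z"
  shows "U_mor K A X Z (comp_mor X g f) = comp_mor (U_ob K A X) (U_mor K A Y Z g) (U_mor K A X Y f)"
proof -
  obtain L \<omega> L' \<omega>' L'' \<omega>'' where [simp]: "X = (L, \<omega>)" "Y = (L', \<omega>')" "Z = (L'', \<omega>'')"
    by (cases X; cases Y; cases Z)
  interpret X: anchored_lie K A L \<omega> using anchored_lie_AnchLie_Ob[OF A] X by simp
  have fc: "f x \<in> carrier L'" if "x \<in> carrier L" for x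
    using f that by (auto simp: AnchLie_Hom_def lie_hom_def intro: lin_hom_closed)
  note F = A X[simplified] Y[simplified] f[simplified]
  note G = A Y[simplified] Z[simplified] g[simplified]
  note H = A X[simplified] Z[simplified] comp_mor_AnchLie_Hom[OF X f g, simplified]
  have "U_mor K A (L, \<omega>) (L'', \<omega>'') (comp_mor (L, \<omega>) g f) =
      compose (carrier X.S) (U_mor K A (L', \<omega>') (L'', \<omega>'') g) (U_mor K A (L, \<omega>) (L', \<omega>') f)"
    by (rule X.smash_hom_ext[OF U_mor_alg_hom[OF H]
          alg_hom_compose[OF X.smash_algebra U_mor_alg_hom[OF F] U_mor_alg_hom[OF G]]])
       (simp_all add: compose_def U_mor_scalar[OF F] U_mor_incl[OF F] U_mor_scalar[OF G] U_mor_incl[OF G]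
         U_mor_scalar[OF H] U_mor_incl[OF H] X.smash_simps fc, simp add: comp_mor_def compose_def)
  then show ?thesis by (simp add: comp_mor_def U_ob_def)
qed

section \<open>The adjunction\<close>

lemma adj_transpose_closed:
  assumes A: "assoc_algebra K A" and X: "(L, \<omega>) \<in> AnchLie_Ob K A" and R: "(R, \<phi>) \<in> Ring_Ob K A"
    and h: "h \<in> Ring_Hom K A (U_ob K A (L, \<omega>)) (R, \<phi>)"
  shows "adj_transpose K A (L, \<omega>) h \<in> AnchLie_Hom K (L, \<omega>) (L_ob K A (R, \<phi>))"
proof -
  interpret X: anchored_lie K A L \<omega> by (rule anchored_lie_AnchLie_Ob[OF A X])
  interpret R: aring K A R \<phi> by (rule aring_Ring_Ob[OF A R])
  have hh: "h \<in> alg_hom K X.S R" and h\<phi>: "\<And>a. a \<in> carrier A \<Longrightarrow> h (tens K A X.U a \<one>\<^bsub>X.U\<^esub>) = \<phi> a"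
    using h by (auto simp: Ring_Hom_def U_ob_def)
  define r where "r x = h (tens K A X.U \<one>\<^bsub>A\<^esub> (X.\<iota> x))" for x
  \<comment> \<open>\<open>r\<close> is the restriction to \<open>L\<close> of the algebra map from
    \<open>U\<close> to \<open>R\<close> given by \<open>h\<close> after \<open>?j\<close>, whence
    it is linear and turns brackets into commutators.\<close>
  let ?j = "\<lambda>u\<in>carrier X.U. tens K A X.U \<one>\<^bsub>A\<^esub> u"
  have r: "r x = compose (carrier X.U) h ?j (X.\<iota> x)" if "x \<in> carrier L" for x
    using that by (simp add: r_def compose_def)
  note hom = alg_hom_compose[OF X.L.U.assoc_algebra_axioms X.smash_env_alg_hom hh]
  have r_closed: "r x \<in> carrier R" if "x \<in> carrier L" for x
    using that by (simp add: r alg_hom_closed[OF hom])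
  have r_bracket: "r (bracket L x y) = commutator R (r x) (r y)" if "x \<in> carrier L" "y \<in> carrier L" for x y
    using that X.L.bracket_closed
    by (simp add: r X.L.env_incl_bracket
        alg_hom_commutator[OF X.L.U.assoc_algebra_axioms R.R.assoc_algebra_axioms hom])
  \<comment> \<open>The image under \<open>h\<close> of the commutation relation
    \<open>smash_incl_mult\<close>.\<close>
  have r_comm: "commutator R (r x) (\<phi> a) = \<phi> (\<omega> x a)" if xa: "x \<in> carrier L" "a \<in> carrier A" for x a
  proof -
    have S: "tens K A X.U \<one>\<^bsub>A\<^esub> (X.\<iota> x) \<in> carrier X.S" "tens K A X.U a \<one>\<^bsub>X.U\<^esub> \<in> carrier X.S"
      "tens K A X.U (\<omega> x a) \<one>\<^bsub>X.U\<^esub> \<in> carrier X.S"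
      using xa by (auto simp: X.smash_simps)
    then have "commutator X.S (tens K A X.U \<one>\<^bsub>A\<^esub> (X.\<iota> x)) (tens K A X.U a \<one>\<^bsub>X.U\<^esub>)
        = tens K A X.U (\<omega> x a) \<one>\<^bsub>X.U\<^esub>"
      using X.smash_incl_mult[OF xa] by (simp add: X.S.commutator_eq_iff)
    then have "h (commutator X.S (tens K A X.U \<one>\<^bsub>A\<^esub> (X.\<iota> x)) (tens K A X.U a \<one>\<^bsub>X.U\<^esub>)) = \<phi> (\<omega> x a)"
      using xa by (simp add: h\<phi>)
    then show ?thesis
      using S xa
      by (simp add: alg_hom_commutator[OF X.smash_algebra R.R.assoc_algebra_axioms hh] r_def h\<phi>)
  qed
  have cl: "(r x, \<omega> x) \<in> carrier R.LR" if "x \<in> carrier L" for x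
    using that by (simp add: R.L_alg_carrier r_closed r_comm X.anchor_der)
  have \<omega>: "\<omega> \<in> lin_hom K L (Der K A)" using X.anchor by (simp add: lie_hom_def)
  have "(\<lambda>x\<in>carrier L. (r x, \<omega> x)) \<in> lin_hom K L R.LR"
    by (rule lin_hom_restrictI[OF X.L.module_axioms])
       (simp_all add: cl, simp_all add: R.L_alg_simps lin_hom_add[OF \<omega>] lin_hom_smult[OF \<omega>] r
         X.L.env_incl_add X.L.env_incl_smult alg_hom_add[OF hom] alg_hom_smult[OF hom])
  then have "(\<lambda>x\<in>carrier L. (r x, \<omega> x)) \<in> lie_hom K L R.LR"
    using X.anchor X.L.bracket_closed by (simp add: lie_hom_def R.L_alg_simps r_bracket)
  then show ?thesis
    by (simp add: AnchLie_Hom_def adj_transpose_def L_ob_def cl flip: r_def)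
qed

text \<open>A map of \<open>A\<close>-rings is forced on \<open>a \<otimes> \<one>\<close>, and the
  first component of the transpose records its value on \<open>\<one> \<otimes> \<iota> x\<close>;
  these elements generate the smash product.\<close>

lemma adj_transpose_inj:
  assumes A: "assoc_algebra K A" and X: "(L, \<omega>) \<in> AnchLie_Ob K A"
  shows "inj_on (adj_transpose K A (L, \<omega>)) (Ring_Hom K A (U_ob K A (L, \<omega>)) R)"
proof (rule inj_onI)
  interpret X: anchored_lie K A L \<omega> by (rule anchored_lie_AnchLie_Ob[OF A X])
  fix h g
  assume h: "h \<in> Ring_Hom K A (U_ob K A (L, \<omega>)) R" and g: "g \<in> Ring_Hom K A (U_ob K A (L, \<omega>)) R"
    and eq: "adj_transpose K A (L, \<omega>) h = adj_transpose K A (L, \<omega>) g"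
  show "h = g"
  proof (rule X.smash_hom_ext)
    show "h \<in> alg_hom K X.S (fst R)" "g \<in> alg_hom K X.S (fst R)"
      using h g by (auto simp: Ring_Hom_def U_ob_def split: prod.splits)
    show "h (tens K A X.U a \<one>\<^bsub>X.U\<^esub>) = g (tens K A X.U a \<one>\<^bsub>X.U\<^esub>)" if "a \<in> carrier A" for a
      using h g that by (auto simp: Ring_Hom_def U_ob_def split: prod.splits)
    show "h (tens K A X.U \<one>\<^bsub>A\<^esub> (X.\<iota> x)) = g (tens K A X.U \<one>\<^bsub>A\<^esub> (X.\<iota> x))" if "x \<in> carrier L" for x
      using fun_cong[OF eq, of x] that by (simp add: adj_transpose_def)
  qed
qed

text \<open>The anchor of \<open>L_ob\<close> is the second projection, so the second component of
  \<open>g x\<close> must be \<open>\<omega> x\<close>. Membership of \<open>g x\<close> in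
  \<open>L_alg\<close> is then precisely the commutation hypothesis of
  \<open>smash_lift_alg_hom\<close>.\<close>

lemma adj_transpose_surj:
  assumes A: "assoc_algebra K A" and X: "(L, \<omega>) \<in> AnchLie_Ob K A" and R: "(R, \<phi>) \<in> Ring_Ob K A"
    and g: "g \<in> AnchLie_Hom K (L, \<omega>) (L_ob K A (R, \<phi>))"
  shows "g \<in> adj_transpose K A (L, \<omega>) ` Ring_Hom K A (U_ob K A (L, \<omega>)) (R, \<phi>)"
proof -
  interpret X: anchored_lie K A L \<omega> by (rule anchored_lie_AnchLie_Ob[OF A X])
  interpret R: aring K A R \<phi> by (rule aring_Ring_Ob[OF A R])
  have lin: "g \<in> lin_hom K L R.LR"
    and br: "\<And>x y. \<lbrakk>x \<in> carrier L; y \<in> carrier L\<rbrakk> \<Longrightarrow> g (bracket L x y) = bracket R.LR (g x) (g y)"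
    using g by (auto simp: AnchLie_Hom_def lie_hom_def L_ob_def)
  note gc = lin_hom_closed[OF lin]
  have snd: "snd (g x) = \<omega> x" if "x \<in> carrier L" for x
    using g gc[OF that] that by (auto simp: AnchLie_Hom_def L_ob_def)
  have rc: "fst (g x) \<in> carrier R" and comm: "\<And>a. a \<in> carrier A \<Longrightarrow> commutator R (fst (g x)) (\<phi> a) = \<phi> (\<omega> x a)"
    if "x \<in> carrier L" for x
    using gc[OF that] snd[OF that] by (auto simp: R.L_alg_carrier)
  have rep: "X.L.lie_rep R (\<lambda>x. fst (g x))"
    by (auto simp: X.L.lie_rep_def rc lin_hom_add[OF lin] lin_hom_smult[OF lin] br R.L_alg_simps)
  define G where "G = env_lift K L R (\<lambda>x. fst (g x))"
  have G: "G \<in> alg_hom K X.U R" and Gi: "\<And>x. x \<in> carrier L \<Longrightarrow> G (X.\<iota> x) = fst (g x)"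
    using X.L.env_lift_alg_hom[OF R.R.assoc_algebra_axioms rep]
      X.L.env_lift_incl[OF R.R.assoc_algebra_axioms rep] by (auto simp: G_def)
  have Gcomm: "G (X.\<iota> x) \<otimes>\<^bsub>R\<^esub> \<phi> a = \<phi> (\<omega> x a) \<oplus>\<^bsub>R\<^esub> \<phi> a \<otimes>\<^bsub>R\<^esub> G (X.\<iota> x)"
    if "x \<in> carrier L" "a \<in> carrier A" for x a
    using comm[OF that] that
    by (simp add: Gi R.R.commutator_eq_iff rc alg_hom_closed[OF R.hom])
  let ?h = "tensor_lift K A X.U R (\<lambda>a u. \<phi> a \<otimes>\<^bsub>R\<^esub> G u)"
  note h = X.smash_lift_alg_hom[OF R.R.assoc_algebra_axioms R.hom G Gcomm]
  note ht = X.smash_lift_tens[OF R.R.assoc_algebra_axioms R.hom G Gcomm]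
  have "?h \<in> Ring_Hom K A (U_ob K A (L, \<omega>)) (R, \<phi>)"
    using h by (simp add: Ring_Hom_def U_ob_def ht alg_hom_one[OF G] alg_hom_closed[OF R.hom])
  moreover have "adj_transpose K A (L, \<omega>) ?h = g"
  proof (rule extensionalityI)
    show "adj_transpose K A (L, \<omega>) ?h \<in> extensional (carrier L)" by (simp add: adj_transpose_def)
    show "g \<in> extensional (carrier L)" using lin by (auto simp: lin_hom_def PiE_def)
    show "adj_transpose K A (L, \<omega>) ?h x = g x" if "x \<in> carrier L" for x
      using that
      by (simp add: adj_transpose_def ht alg_hom_one[OF R.hom] Gi rc prod_eq_iff snd)
  qed
  ultimately show ?thesis by blast
qed

lemma adj_transpose_bij:
  assumes "assoc_algebra K A" "X \<in> AnchLie_Ob K A" "R \<in> Ring_Ob K A"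
  shows "bij_betw (adj_transpose K A X) (Ring_Hom K A (U_ob K A X) R) (AnchLie_Hom K X (L_ob K A R))"
  using assms adj_transpose_closed adj_transpose_inj adj_transpose_surj
  unfolding bij_betw_def by (cases X; cases R) blast

text \<open>One equation covers both variables: \<open>f\<close> varies the Lie algebra and
  \<open>h\<close> the ring. Each side sends \<open>x\<close> to the pair of
  \<open>h (p (\<one> \<otimes> env_incl K L' (f x)))\<close> and \<open>\<omega> x\<close>.\<close>

lemma adj_transpose_natural:
  assumes A: "assoc_algebra K A"
    and X: "X \<in> AnchLie_Ob K A" and Y: "Y \<in> AnchLie_Ob K A" and R: "R \<in> Ring_Ob K A"
    and f: "f \<in> AnchLie_Hom K X Y" and p: "p \<in> Ring_Hom K A (U_ob K A Y) R"
  shows "adj_transpose K A X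
      (comp_mor (U_ob K A X) h (comp_mor (U_ob K A X) p (U_mor K A X Y f))) =
    comp_mor X (L_mor K A R h) (comp_mor X (adj_transpose K A Y p) f)"
proof -
  obtain L \<omega> L' \<omega>' S \<phi> where [simp]: "X = (L, \<omega>)" "Y = (L', \<omega>')" "R = (S, \<phi>)"
    by (cases X; cases Y; cases R)
  interpret X: anchored_lie K A L \<omega> using anchored_lie_AnchLie_Ob[OF A] X by simp
  have fc: "f x \<in> carrier L'" and anch: "\<omega>' (f x) = \<omega> x" if "x \<in> carrier L" for x
    using f that by (auto simp: AnchLie_Hom_def lie_hom_def intro: lin_hom_closed)
  \<comment> \<open>\<open>L_mor\<close> is \<open>undefined\<close> off the carrier of
    \<open>L_alg\<close>, so the transposed pair must be known to lie there before
    \<open>L_mor\<close> can be evaluated.\<close>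
  have "adj_transpose K A Y p y \<in> carrier (L_alg K A (S, \<phi>))" if "y \<in> carrier L'" for y
    using adj_transpose_closed[OF A, of L' \<omega>' S \<phi> p] Y R p that
    by (auto simp: AnchLie_Hom_def L_ob_def lie_hom_def intro: lin_hom_closed)
  from this[OF fc]
  have "(p (tens K A (env K L') \<one>\<^bsub>A\<^esub> (env_incl K L' (f x))), \<omega> x) \<in> carrier (L_alg K A (S, \<phi>))"
    if "x \<in> carrier L" for x
    using that by (simp add: adj_transpose_def fc anch)
  then show ?thesis
    using U_mor_incl[OF A X[simplified] Y[simplified] f[simplified]]
    by (auto simp: fun_eq_iff adj_transpose_def comp_mor_def compose_def L_mor_def U_ob_def X.smash_simps
        fc anch)
qed

theorem theorem2p6:
  fixes K :: "'k ring" and A :: "('k, 'a) module"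
  assumes "field K" and "char_zero K" and "assoc_algebra K A"
  shows
    \<comment> \<open>\<open>U_A\<close> is a functor\<close>
    "(\<forall>X \<in> (AnchLie_Ob K A :: ('k, 'a, 'l1) anch set). U_ob K A X \<in> Ring_Ob K A) \<and>
     (\<forall>X \<in> (AnchLie_Ob K A :: ('k, 'a, 'l1) anch set).
      \<forall>Y \<in> (AnchLie_Ob K A :: ('k, 'a, 'l2) anch set).
      \<forall>f \<in> AnchLie_Hom K X Y. U_mor K A X Y f \<in> Ring_Hom K A (U_ob K A X) (U_ob K A Y)) \<and>
     (\<forall>X \<in> (AnchLie_Ob K A :: ('k, 'a, 'l1) anch set).
        U_mor K A X X (Id_mor X) = Id_mor (U_ob K A X)) \<and>
     (\<forall>X \<in> (AnchLie_Ob K A :: ('k, 'a, 'l1) anch set).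
      \<forall>Y \<in> (AnchLie_Ob K A :: ('k, 'a, 'l2) anch set).
      \<forall>Z \<in> (AnchLie_Ob K A :: ('k, 'a, 'l3) anch set).
      \<forall>f \<in> AnchLie_Hom K X Y. \<forall>g \<in> AnchLie_Hom K Y Z.
        U_mor K A X Z (comp_mor X g f) =
          comp_mor (U_ob K A X) (U_mor K A Y Z g) (U_mor K A X Y f)) \<and>
    \<comment> \<open>\<open>L_A\<close> is a functor\<close>
     (\<forall>R \<in> (Ring_Ob K A :: ('k, 'a, 'r1) aring set). L_ob K A R \<in> AnchLie_Ob K A) \<and>
     (\<forall>R \<in> (Ring_Ob K A :: ('k, 'a, 'r1) aring set).
      \<forall>S \<in> (Ring_Ob K A :: ('k, 'a, 'r2) aring set).
      \<forall>h \<in> Ring_Hom K A R S. L_mor K A R h \<in> AnchLie_Hom K (L_ob K A R) (L_ob K A S)) \<and>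
     (\<forall>R \<in> (Ring_Ob K A :: ('k, 'a, 'r1) aring set).
        L_mor K A R (Id_mor R) = Id_mor (L_ob K A R)) \<and>
     (\<forall>R \<in> (Ring_Ob K A :: ('k, 'a, 'r1) aring set).
      \<forall>S \<in> (Ring_Ob K A :: ('k, 'a, 'r2) aring set).
      \<forall>T \<in> (Ring_Ob K A :: ('k, 'a, 'r3) aring set).
      \<forall>h \<in> Ring_Hom K A R S. \<forall>k \<in> Ring_Hom K A S T.
        L_mor K A R (comp_mor R k h) = comp_mor (L_ob K A R) (L_mor K A S k) (L_mor K A R h)) \<and>
    \<comment> \<open>\<open>U_A\<close> is left adjoint to \<open>L_A\<close>: natural bijection \<open>Hom(U_A X, R) = Hom(X, L_A R)\<close>\<close>
     (\<forall>X \<in> (AnchLie_Ob K A :: ('k, 'a, 'l1) anch set).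
      \<forall>R \<in> (Ring_Ob K A :: ('k, 'a, 'r1) aring set).
        bij_betw (adj_transpose K A X)
          (Ring_Hom K A (U_ob K A X) R) (AnchLie_Hom K X (L_ob K A R))) \<and>
     (\<forall>X \<in> (AnchLie_Ob K A :: ('k, 'a, 'l1) anch set).
      \<forall>Y \<in> (AnchLie_Ob K A :: ('k, 'a, 'l2) anch set).
      \<forall>R \<in> (Ring_Ob K A :: ('k, 'a, 'r1) aring set).
      \<forall>S \<in> (Ring_Ob K A :: ('k, 'a, 'r2) aring set).
      \<forall>f \<in> AnchLie_Hom K X Y. \<forall>h \<in> Ring_Hom K A R S. \<forall>p \<in> Ring_Hom K A (U_ob K A Y) R.
        adj_transpose K A X
          (comp_mor (U_ob K A X) h (comp_mor (U_ob K A X) p (U_mor K A X Y f))) =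
        comp_mor X (L_mor K A R h) (comp_mor X (adj_transpose K A Y p) f))"
proof (intro conjI ballI)
  note A = assms(3)
  {
    fix X :: "('k, 'a, 'l1) anch" and Y :: "('k, 'a, 'l2) anch" and Z :: "('k, 'a, 'l3) anch" and f g
    assume X: "X \<in> AnchLie_Ob K A"
    show "U_ob K A X \<in> Ring_Ob K A" by (rule U_ob_closed[OF A X])
    show "U_mor K A X X (Id_mor X) = Id_mor (U_ob K A X)" by (rule U_mor_id[OF A X])
    assume Y: "Y \<in> AnchLie_Ob K A" and f: "f \<in> AnchLie_Hom K X Y"
    show "U_mor K A X Y f \<in> Ring_Hom K A (U_ob K A X) (U_ob K A Y)" by (rule U_mor_closed[OF A X Y f])
    assume "Z \<in> AnchLie_Ob K A" "g \<in> AnchLie_Hom K Y Z"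
    then show "U_mor K A X Z (comp_mor X g f) =
        comp_mor (U_ob K A X) (U_mor K A Y Z g) (U_mor K A X Y f)"
      by (intro U_mor_comp[OF A X Y _ f])
  }
  {
    fix R :: "('k, 'a, 'r1) aring" and S :: "('k, 'a, 'r2) aring" and T :: "('k, 'a, 'r3) aring" and h k
    assume R: "R \<in> Ring_Ob K A"
    show "L_ob K A R \<in> AnchLie_Ob K A" using aring.L_ob_closed aring_Ring_Ob[OF A] R by (cases R) blast
    show "L_mor K A R (Id_mor R) = Id_mor (L_ob K A R)" by (rule L_mor_id)
    assume S: "S \<in> Ring_Ob K A" and h: "h \<in> Ring_Hom K A R S"
    show "L_mor K A R h \<in> AnchLie_Hom K (L_ob K A R) (L_ob K A S)"
      using L_mor_closed[OF A] R S h by (cases R; cases S) blast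
    show "L_mor K A R (comp_mor R k h) = comp_mor (L_ob K A R) (L_mor K A S k) (L_mor K A R h)"
      using L_mor_comp[OF A] R S h by (cases R; cases S) blast
  }
qed (auto intro: adj_transpose_bij adj_transpose_natural assms(3))

end
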